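(* Let $n\le m$, let $Z=\sum_{i=1}^n\sigma_i(Z)u_iv_i^{\mathsf T}\in\mathbb R^{n\times m}$ be a singular value decomposition, let $\gamma>0$, $1\le r\le n$, let $g:\mathbb R^n\to\mathbb R$ be a symmetric gauge function, and let $f:\mathbb R\to\mathbb R\cup\{\infty\}$ be proper, closed and convex. For each $(t,s)\in\{1,\dots,r\}\times\{0,\dots,n-r\}$ let $\tilde z=\tilde z^{(t,s)}\in\mathbb R^{r-t+1}$ be given by $$\tilde z_i=\sigma_i(Z)\ (1\le i\le r-t),\qquad \tilde z_{r-t+1}=\frac{\sum_{i=r-t+1}^{r+s}\sigma_i(Z)}{\sqrt{t+s}},$$ and let $(y^{(t,s)},w^{(t,s)})\in\mathbb R^{n+1}$ be defined by $$y^{(t,s)}_i:=\begin{cases}\tilde y_i,&1\le i\le r-t,\\ \dfrac{\tilde y_{r-t+1}}{\sqrt{t+s}},&r-t+1\le i\le r+s,\\ \sigma_i(Z),&i\ge r+s+1,\end{cases}\qquad w^{(t,s)}:=\tilde w,$$ where $(\tilde y,\tilde w)\in\mathbb R^{r-t+2}$ (with $\tilde y\in\mathbb R^{r-t+1}$, $\tilde w\in\mathbb R$) fulfills one of the following cases: (C1) $\tilde y=\tilde z$, $\tilde w=\operatorname{argmin}_w f(w)$ and $\tilde w\ge g^D_{r,s,t}(\tilde z)$; (C2) $(\tilde y,\tilde w)=0$, where $g_{r,s,t}(\tilde z)\le \mu/\gamma$ for some $\mu\in\partial f(0)$; (C3) $\frac{\gamma}{\mu}(\tilde z-\tilde y)\in\partial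 g^D_{r,s,t}(\tilde y)$ for some $\mu\in\partial f(\tilde w)\cap\mathbb R_{\ge0}$, and $\tilde w=g^D_{r,s,t}(\tilde y)$. Define $$s_t^\star:=\min\big(\{s: y^{(t,s)}_{r+s}>y^{(t,s)}_{r+s+1}\}\cup\{n-r\}\big),\qquad t^\star:=\min\big(\{t: y^{(t,s_t^\star)}_{r-t}>y^{(t,s_t^\star)}_{r-t+1}\}\cup\{r\}\big),\qquad s^\star:=s^\star_{t^\star}.$$ Then $(Y^\star,w^\star)=\big(\sum_{i=1}^n y_i^{(t^\star,s^\star)}u_iv_i^{\mathsf T},\,w^{(t^\star,s^\star)}\big)$ is the solution to $$\underset{Y\in\mathbb R^{n\times m},\,w\in\mathbb R}{\text{minimize}}\ \ f(w)+\frac{\gamma}{2}\|Y-Z\|_{\ell_2}^2\qquad\text{subject to}\quad w\ge\|Y\|_{g^D,r}.$$ In particular, $(t^\star,s^\star)$ can be found by a nested search over $t$ and $s$, because the following hold: I. $y^{(t,s_t^\star)}_{r-t}\ge y^{(t,s_t^\star)}_{r-t+1}$ for all $t\ge t^\star$. II. $y^{(t,s_t^\star)}_{r-t}\le y^{(t,s_t^\star)}_{r-t+1}$ for all $t<t^\star$. III. If $t<t^\star$ and $y^{(t,s_t^\star)}_{r-t}=y^{(t,s_t^\star)}_{r-t+1}$, then $(y^{(t,s_t^\star)},w^{(t,s_t^\star)})=(y^{(t^\star,s^\star)},w^{(t^\star,s^\star)})$. And for every $t\in\{1,\dots,r\}$: IV. $y^{(t,s)}_{r+s}\ge y^{(t,s)}_{r+s+1}$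 for all $s\ge s_t^\star$. V. $y^{(t,s)}_{r+s}\le y^{(t,s)}_{r+s+1}$ for all $s<s_t^\star$. VI. If $s<s_t^\star$ and $y^{(t,s)}_{r+s}=y^{(t,s)}_{r+s+1}$, then $(y^{(t,s)},w^{(t,s)})=(y^{(t,s_t^\star)},w^{(t,s_t^\star)})$.
   Context: A symmetric gauge function $g:\mathbb R^n\to\mathbb R_{\ge0}$ is a norm with $g(|x|)=g(x)$ (entrywise absolute value) and $g(Px)=g(x)$ for all permutation matrices $P$. $\sigma_1(X)\ge\dots\ge\sigma_n(X)$ are the singular values of $X\in\mathbb R^{n\times m}$, $\|X\|_g:=g(\sigma_1(X),\dots,\sigma_n(X))$, $\langle X,Y\rangle=\operatorname{trace}(X^{\mathsf T}Y)$, and $\|\cdot\|_{\ell_2}$ is the Frobenius norm. $g^D$ is the dual norm of $g$ on $\mathbb R^n$. The rank constrained dual norm is $$\|Y\|_{g^D,r}:=\max_{\operatorname{rank}(X)\le r,\ \|X\|_g\le1}\langle X,Y\rangle ,$$ which equals $g^D(\sigma_1(Y),\dots,\sigma_r(Y),0,\dots,0)$. For $x\in\mathbb R^{r-t+1}$ the truncated gauge function and its dual gauge function are $$g^D_{r,s,t}(x):=g^D\Big(x_1,\dots,x_{r-t},\underbrace{\tfrac{x_{r-t+1}}{\sqrt{t+s}},\dots,\tfrac{x_{r-t+1}}{\sqrt{t+s}}}_{t\text{ times}},0,\dots,0\Big),$$ $$g_{r,s,t}(x):=g\Big(x_1,\dots,x_{r-t},\underbrace{\tfrac{\sqrt{t+s}}{t}x_{r-t+1},\dots,\tfrac{\sqrt{t+s}}{t}x_{r-t+1}}_{t\text{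 times}},0,\dots,0\Big).$$ $\partial$ denotes the convex subdifferential. Conventions: the inclusion in (C3) means $\gamma(\tilde z-\tilde y)\in\mu\,\partial g^D_{r,s,t}(\tilde y)$. Comparisons that would involve the non-existent entries $y_0$ (i.e. $t=r$) or $y_{n+1}$ (i.e. $s=n-r$) are omitted (so in the set defining $t^\star$ and in I only $t\le r-1$ are considered, and in the set defining $s_t^\star$ and in IV only $s\le n-r-1$). If $f$ has several minimizers, $\tilde w=\operatorname{argmin}_w f$ means that $\tilde w$ is one of them; then "the solution" means a solution, and the equalities of the $w$-components in III and VI are understood up to the choice of this minimizer. *)

theory Defs
  imports
    "HOL-Analysis.Analysis"
    "Jordan_Normal_Form.Char_Poly"
    "Jordan_Normal_Form.DL_Rank"
begin

hide_type (open) Finite_Cartesian_Product.vec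
hide_const (open) Finite_Cartesian_Product.vec Finite_Cartesian_Product.vec_nth
  Finite_Cartesian_Product.mat Finite_Cartesian_Product.row
no_notation Finite_Cartesian_Product.vec_nth (infixl "$" 90)
no_notation Inner_Product.real_inner_class.inner (infix "\<bullet>" 70)

text \<open>Vectors and matrices are indexed from 0: the mathematical entry $x_i$, $1 \le i \le n$,
  is \<open>x $ (i - 1)\<close>.\<close>

definition sym_gauge :: "nat \<Rightarrow> (real vec \<Rightarrow> real) \<Rightarrow> bool" where
  "sym_gauge n g \<longleftrightarrow>
     (\<forall>x\<in>carrier_vec n. 0 \<le> g x \<and> (g x = 0 \<longleftrightarrow> x = 0\<^sub>v n)) \<and>
     (\<forall>c. \<forall>x\<in>carrier_vec n. g (c \<cdot>\<^sub>v x) = \<bar>c\<bar> * g x) \<and>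
     (\<forall>x\<in>carrier_vec n. \<forall>y\<in>carrier_vec n. g (x + y) \<le> g x + g y) \<and>
     (\<forall>x\<in>carrier_vec n. g (map_vec abs x) = g x) \<and>
     (\<forall>p. \<forall>x\<in>carrier_vec n. p permutes {0..<n} \<longrightarrow> g (vec n (\<lambda>i. x $ p i)) = g x)"

definition dual_norm :: "nat \<Rightarrow> (real vec \<Rightarrow> real) \<Rightarrow> real vec \<Rightarrow> real" where
  "dual_norm n g y = Sup {scalar_prod x y | x. x \<in> carrier_vec n \<and> g x \<le> 1}"

text \<open>For \<open>dim_row X \<le> dim_col X\<close>: the singular values of \<open>X\<close>, with multiplicity and in
  nonincreasing order, are the square roots of the eigenvalues of $X X^T$.\<close>

definition sing_vals :: "real mat \<Rightarrow> real vec" where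
  "sing_vals X = vec_of_list (rev (sorted_list_of_multiset
     (image_mset sqrt (proots (char_poly (X * transpose_mat X))))))"

definition mat_trace :: "real mat \<Rightarrow> real" where
  "mat_trace A = (\<Sum>i<dim_row A. A $$ (i, i))"

definition mat_inner :: "real mat \<Rightarrow> real mat \<Rightarrow> real" where
  "mat_inner X Y = mat_trace (transpose_mat X * Y)"

definition frob_norm :: "real mat \<Rightarrow> real" where
  "frob_norm X = sqrt (mat_inner X X)"

definition gauge_norm :: "(real vec \<Rightarrow> real) \<Rightarrow> real mat \<Rightarrow> real" where
  "gauge_norm g X = g (sing_vals X)"

definition rank_dual_norm :: "nat \<Rightarrow> nat \<Rightarrow> (real vec \<Rightarrow> real) \<Rightarrow> nat \<Rightarrow> real mat \<Rightarrow> real" where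
  "rank_dual_norm n m g r Y =
     Sup {mat_inner X Y | X. X \<in> carrier_mat n m \<and> vec_space.rank n X \<le> r \<and> gauge_norm g X \<le> 1}"

text \<open>The matrix $\sum_i \sigma_i u_i v_i^T$, written entrywise.\<close>

definition sum_outer ::
    "nat \<Rightarrow> nat \<Rightarrow> real vec \<Rightarrow> (nat \<Rightarrow> real vec) \<Rightarrow> (nat \<Rightarrow> real vec) \<Rightarrow> real mat" where
  "sum_outer n m \<sigma> u v = mat n m (\<lambda>(a, b). \<Sum>i<n. \<sigma> $ i * u i $ a * v i $ b)"

definition orthonormal_family :: "nat \<Rightarrow> nat \<Rightarrow> (nat \<Rightarrow> real vec) \<Rightarrow> bool" where
  "orthonormal_family d n u \<longleftrightarrow>
     (\<forall>i<n. u i \<in> carrier_vec d) \<and>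
     (\<forall>i<n. \<forall>j<n. scalar_prod (u i) (u j) = (if i = j then 1 else 0))"

definition is_svd ::
    "nat \<Rightarrow> nat \<Rightarrow> real mat \<Rightarrow> (nat \<Rightarrow> real vec) \<Rightarrow> (nat \<Rightarrow> real vec) \<Rightarrow> bool" where
  "is_svd n m Z u v \<longleftrightarrow>
     orthonormal_family n n u \<and> orthonormal_family m n v \<and> Z = sum_outer n m (sing_vals Z) u v"

definition proper_fun :: "(real \<Rightarrow> ereal) \<Rightarrow> bool" where
  "proper_fun f \<longleftrightarrow> (\<forall>x. f x \<noteq> -\<infinity>) \<and> (\<exists>x. f x \<noteq> \<infinity>)"

definition ereal_epigraph :: "(real \<Rightarrow> ereal) \<Rightarrow> (real \<times> real) set" where
  "ereal_epigraph f = {(x, a). f x \<le> ereal a}"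

definition proper_closed_convex :: "(real \<Rightarrow> ereal) \<Rightarrow> bool" where
  "proper_closed_convex f \<longleftrightarrow>
     proper_fun f \<and> closed (ereal_epigraph f) \<and> convex (ereal_epigraph f)"

text \<open>For proper \<open>f\<close> this set is empty at points where \<open>f\<close> is infinite.\<close>

definition subdiff :: "(real \<Rightarrow> ereal) \<Rightarrow> real \<Rightarrow> real set" where
  "subdiff f w = {\<mu>. \<forall>v. f w + ereal (\<mu> * (v - w)) \<le> f v}"

definition vec_subdiff :: "nat \<Rightarrow> (real vec \<Rightarrow> real) \<Rightarrow> real vec \<Rightarrow> real vec set" where
  "vec_subdiff d G y =
     {p \<in> carrier_vec d. \<forall>x\<in>carrier_vec d. G y + scalar_prod p (x - y) \<le> G x}"

definition minimizer :: "(real \<Rightarrow> ereal) \<Rightarrow> real \<Rightarrow> bool" where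
  "minimizer f w \<longleftrightarrow> is_arg_min f (\<lambda>_. True) w"

text \<open>$(x_1, \dots, x_{r-t}, c\,x_{r-t+1}, \dots, c\,x_{r-t+1}, 0, \dots, 0) \in R^n$ with
  $t$ copies of $c\,x_{r-t+1}$.\<close>

definition trunc_pad :: "nat \<Rightarrow> nat \<Rightarrow> nat \<Rightarrow> real \<Rightarrow> real vec \<Rightarrow> real vec" where
  "trunc_pad n r t c x =
     vec n (\<lambda>i. if i < r - t then x $ i else if i < r then c * x $ (r - t) else 0)"

definition trunc_dual_gauge ::
    "nat \<Rightarrow> (real vec \<Rightarrow> real) \<Rightarrow> nat \<Rightarrow> nat \<Rightarrow> nat \<Rightarrow> real vec \<Rightarrow> real" where
  "trunc_dual_gauge n g r s t x = dual_norm n g (trunc_pad n r t (1 / sqrt (real (t + s))) x)"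

definition trunc_gauge ::
    "nat \<Rightarrow> (real vec \<Rightarrow> real) \<Rightarrow> nat \<Rightarrow> nat \<Rightarrow> nat \<Rightarrow> real vec \<Rightarrow> real" where
  "trunc_gauge n g r s t x = g (trunc_pad n r t (sqrt (real (t + s)) / real t) x)"

definition trunc_sv :: "nat \<Rightarrow> nat \<Rightarrow> nat \<Rightarrow> real vec \<Rightarrow> real vec" where
  "trunc_sv r s t \<sigma> =
     vec (r - t + 1) (\<lambda>i. if i < r - t then \<sigma> $ i
       else (\<Sum>j = r - t..<r + s. \<sigma> $ j) / sqrt (real (t + s)))"

definition extend_vec :: "nat \<Rightarrow> nat \<Rightarrow> nat \<Rightarrow> nat \<Rightarrow> real vec \<Rightarrow> real vec \<Rightarrow> real vec" where
  "extend_vec n r s t \<sigma> y =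
     vec n (\<lambda>i. if i < r - t then y $ i
       else if i < r + s then y $ (r - t) / sqrt (real (t + s))
       else \<sigma> $ i)"

definition case_C1 ::
    "nat \<Rightarrow> (real vec \<Rightarrow> real) \<Rightarrow> (real \<Rightarrow> ereal) \<Rightarrow> nat \<Rightarrow> nat \<Rightarrow> nat \<Rightarrow> real vec \<Rightarrow> real vec \<Rightarrow> real \<Rightarrow> bool"
  where
  "case_C1 n g f r s t z y w \<longleftrightarrow>
     y = z \<and> minimizer f w \<and> trunc_dual_gauge n g r s t z \<le> w"

definition case_C2 ::
    "nat \<Rightarrow> (real vec \<Rightarrow> real) \<Rightarrow> (real \<Rightarrow> ereal) \<Rightarrow> real \<Rightarrow> nat \<Rightarrow> nat \<Rightarrow> nat \<Rightarrow>
     real vec \<Rightarrow> real vec \<Rightarrow> real \<Rightarrow> bool"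
  where
  "case_C2 n g f \<gamma> r s t z y w \<longleftrightarrow>
     y = 0\<^sub>v (r - t + 1) \<and> w = 0 \<and> (\<exists>\<mu>\<in>subdiff f 0. trunc_gauge n g r s t z \<le> \<mu> / \<gamma>)"

text \<open>The inclusion is stated as $\gamma (z - y) \in \mu\,\partial g^D_{r,s,t}(y)$, so that
  $\mu = 0$ is meaningful.\<close>

definition case_C3 ::
    "nat \<Rightarrow> (real vec \<Rightarrow> real) \<Rightarrow> (real \<Rightarrow> ereal) \<Rightarrow> real \<Rightarrow> nat \<Rightarrow> nat \<Rightarrow> nat \<Rightarrow>
     real vec \<Rightarrow> real vec \<Rightarrow> real \<Rightarrow> bool"
  where
  "case_C3 n g f \<gamma> r s t z y w \<longleftrightarrow>
     y \<in> carrier_vec (r - t + 1) \<and>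
     (\<exists>\<mu>\<in>subdiff f w \<inter> {0..}.
        \<exists>p\<in>vec_subdiff (r - t + 1) (trunc_dual_gauge n g r s t) y. \<gamma> \<cdot>\<^sub>v (z - y) = \<mu> \<cdot>\<^sub>v p) \<and>
     w = trunc_dual_gauge n g r s t y"

text \<open>In the next two definitions \<open>y t s\<close> is the vector $y^{(t,s)}$. Comparisons with the
  non-existent entries $y_{n+1}$ and $y_0$ are excluded by \<open>s < n - r\<close> and \<open>t < r\<close>.\<close>

definition s_star :: "nat \<Rightarrow> nat \<Rightarrow> (nat \<Rightarrow> nat \<Rightarrow> real vec) \<Rightarrow> nat \<Rightarrow> nat" where
  "s_star n r y t =
     Min ({s. s < n - r \<and> y t s $ (r + s - 1) > y t s $ (r + s)} \<union> {n - r})"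

definition t_star :: "nat \<Rightarrow> nat \<Rightarrow> (nat \<Rightarrow> nat \<Rightarrow> real vec) \<Rightarrow> nat" where
  "t_star n r y =
     Min ({t. 1 \<le> t \<and> t < r \<and>
             y t (s_star n r y t) $ (r - t - 1) > y t (s_star n r y t) $ (r - t)} \<union> {r})"

text \<open>As usual for extended-valued objectives, a solution has a finite objective value.\<close>

definition solves ::
    "nat \<Rightarrow> nat \<Rightarrow> (real vec \<Rightarrow> real) \<Rightarrow> (real \<Rightarrow> ereal) \<Rightarrow> real \<Rightarrow> nat \<Rightarrow> real mat \<Rightarrow>
     real mat \<Rightarrow> real \<Rightarrow> bool"
  where
  "solves n m g f \<gamma> r Z Y w \<longleftrightarrow>
     is_arg_min (\<lambda>(Y, w). f w + ereal (\<gamma> / 2 * (frob_norm (Y - Z))\<^sup>2))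
       (\<lambda>(Y, w). Y \<in> carrier_mat n m \<and> rank_dual_norm n m g r Y \<le> w \<and> f w \<noteq> \<infinity>) (Y, w)"

end

theory Submission
  imports Defs "Jordan_Normal_Form.Schur_Decomposition"
begin

text \<open>
  All candidates $y^{(t,s)}$ solve one and the same strongly convex vector problem, only on
  different subspaces. Let $G(x) = g^D(x_1, \dots, x_r, 0, \dots, 0)$ and minimize
  $f(a) + \gamma/2 \, |x - \sigma(Z)|^2$ subject to $a \ge G(x)$. Each of (C1), (C2), (C3) yields a
  multiplier $\mu \in \partial f(\tilde w)$ with $\mu \ge 0$,
  $\mu (\tilde w - g^D_{r,s,t}(\tilde y)) = 0$ and
  $\gamma \langle \tilde z - \tilde y, x - \tilde y \rangle \le
    \mu (g^D_{r,s,t}(x) - g^D_{r,s,t}(\tilde y))$ for all $x$ (\<open>kkt_of_cases\<close>); this says that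
  $(y^{(t,s)}, w^{(t,s)})$ is optimal among the $x$ that are constant on the positions
  $r-t+1, \dots, r+s$ (\<open>kkt_imp_opt\<close>). The factors $\sqrt{t+s}$ are exactly those that turn the
  inner product of the shortened vectors into the one of the full vectors.

  The comparison of neighbouring candidates rests on one convexity argument (\<open>crossing\<close>). If the
  minimizer over a convex set and a competitor lie on different sides of a hyperplane
  $x_p = x_q$, the segment between them meets the hyperplane in a point that is better than the
  competitor. Feeding it competitors made from $y^{(t,s+1)}$ by resetting one entry, or from
  $y^{(t+1,s^\star_{t+1})}$ by exchanging two entries, gives the monotonicity claims I and IV; II and V
  hold by the definition of the minimal indices, and in the tie cases III and VI the old
  minimizer lies in the smaller subspace, hence is the new one.

  For fixed $t$ the vector $y^{(t,s_t^\star)}$ is optimal even under the weaker constraint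
  $x_{r-t+1} = \dots = x_r \ge x_{r+1}, \dots, x_n$ (\<open>yt_opt\<close>). A sorted competitor is then moved, for
  $t = 1, 2, \dots, t^\star - 1$, along the segment towards $y^{(t,s_t^\star)}$ until one more entry
  joins the block, which never increases the objective; it arrives in the set on which
  $y^{(t^\star,s^\star)}$ is optimal (\<open>yt_ts_optimal\<close>).

  The matrix problem reduces to the vector problem by two facts. The von Neumann trace inequality
  bounds $\|Y^\star\|_{g^D,r}$ by $G(y^{(t^\star,s^\star)})$, so that $Y^\star$ is feasible. Conversely, for any
  feasible $Y$ the numbers $u_i^T Y v_i$, sorted, form a feasible vector whose distance to $\sigma(Z)$
  is at most $\|Y - Z\|$, by the Bessel and the rearrangement inequality. Uniqueness of $Y^\star$ is
  strong convexity, and two different optimal values of $w$ force the multiplier to vanish,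
  which is case (C1) with two minimizers of $f$.
\<close>

section \<open>Variational optimality and crossing segments\<close>

text \<open>The scalar problem enters through a real-valued convex \<open>F\<close> on its effective domain \<open>V\<close>.
  Vectors are functions on \<open>nat\<close>, of which only the first \<open>n\<close> values matter: this keeps index
  manipulations free of dimension conditions.\<close>

locale gauge_prox =
  fixes n r :: nat and z :: "nat \<Rightarrow> real" and G :: "(nat \<Rightarrow> real) \<Rightarrow> real"
    and F :: "real \<Rightarrow> real" and V :: "real set" and \<gamma> :: real
  assumes r_pos: "1 \<le> r" and r_le: "r \<le> n" and gamma_pos: "0 < \<gamma>"
    and z_antimono: "\<And>i j. i \<le> j \<Longrightarrow> j < n \<Longrightarrow> z j \<le> z i"
    and z_nonneg: "\<And>i. i < n \<Longrightarrow> 0 \<le> z i"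
    and F_convex: "convex_on V F"
    and G_convex: "\<And>x y c. 0 \<le> c \<Longrightarrow> c \<le> 1 \<Longrightarrow>
      G (\<lambda>i. (1 - c) * x i + c * y i) \<le> (1 - c) * G x + c * G y"
    and G_cong: "\<And>x y. (\<And>i. i < r \<Longrightarrow> x i = y i) \<Longrightarrow> G x = G y"
    and G_abs: "\<And>x. G (\<lambda>i. \<bar>x i\<bar>) \<le> G x"
    and G_swap: "\<And>x i j. i < r \<Longrightarrow> j < r \<Longrightarrow> G (x \<circ> Transposition.transpose i j) \<le> G x"
begin

definition sqdist :: "(nat \<Rightarrow> real) \<Rightarrow> (nat \<Rightarrow> real) \<Rightarrow> real" where
  "sqdist x y = (\<Sum>i<n. (x i - y i)\<^sup>2)"

definition feasible :: "(nat \<Rightarrow> real) \<Rightarrow> real \<Rightarrow> bool" where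
  "feasible x a \<longleftrightarrow> a \<in> V \<and> G x \<le> a"

definition obj :: "(nat \<Rightarrow> real) \<Rightarrow> real \<Rightarrow> real" where
  "obj x a = F a + \<gamma> / 2 * sqdist x z"

text \<open>The first-order form of optimality: expanding the square in the objective shows that it
  contains both optimality and the quadratic growth in \<open>opt_sharp\<close>.\<close>

definition opt :: "(nat \<Rightarrow> real) set \<Rightarrow> (nat \<Rightarrow> real) \<Rightarrow> real \<Rightarrow> bool" where
  "opt S x a \<longleftrightarrow> x \<in> S \<and> feasible x a \<and>
     (\<forall>x'\<in>S. \<forall>a'. feasible x' a' \<longrightarrow> F a + \<gamma> * (\<Sum>i<n. (z i - x i) * (x' i - x i)) \<le> F a')"

lemma sqdist_nonneg: "0 \<le> sqdist x y"
  by (auto simp: sqdist_def intro: sum_nonneg)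

lemma sqdist_pos: "i < n \<Longrightarrow> x i \<noteq> y i \<Longrightarrow> 0 < sqdist x y"
  unfolding sqdist_def by (rule sum_pos2[of _ i]) auto

lemma sqdist_convex:
  assumes "0 \<le> c" "c \<le> 1"
  shows "sqdist (\<lambda>i. (1 - c) * x i + c * y i) z \<le> (1 - c) * sqdist x z + c * sqdist y z"
proof -
  have "((1 - c) * a + c * b - d)\<^sup>2 \<le> (1 - c) * (a - d)\<^sup>2 + c * (b - d)\<^sup>2" for a b d :: real
  proof -
    have "(1 - c) * (a - d)\<^sup>2 + c * (b - d)\<^sup>2 - ((1 - c) * a + c * b - d)\<^sup>2
        = c * (1 - c) * (a - b)\<^sup>2"
      by (simp add: power2_eq_square algebra_simps)
    moreover have "0 \<le> c * (1 - c) * (a - b)\<^sup>2" using assms by simp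
    ultimately show ?thesis by linarith
  qed
  then show ?thesis
    unfolding sqdist_def sum_distrib_left sum.distrib[symmetric] by (intro sum_mono)
qed

lemma opt_sharp:
  assumes "opt S x a" "x' \<in> S" "feasible x' a'"
  shows "obj x a + \<gamma> / 2 * sqdist x x' \<le> obj x' a'"
proof -
  have "sqdist x' z = sqdist x z + sqdist x x' - 2 * (\<Sum>i<n. (z i - x i) * (x' i - x i))"
    unfolding sqdist_def sum_distrib_left sum.distrib[symmetric] sum_subtractf[symmetric]
    by (intro sum.cong) (auto simp: power2_eq_square algebra_simps)
  then have e: "\<gamma> / 2 * sqdist x' z = \<gamma> / 2 * sqdist x z + \<gamma> / 2 * sqdist x x'
      - \<gamma> * (\<Sum>i<n. (z i - x i) * (x' i - x i))"
    by (simp add: add_divide_distrib diff_divide_distrib right_diff_distrib distrib_left)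
  have "F a + \<gamma> * (\<Sum>i<n. (z i - x i) * (x' i - x i)) \<le> F a'"
    using assms by (auto simp: opt_def)
  then show ?thesis unfolding obj_def e by simp
qed

lemma opt_unique:
  assumes "opt S x a" "x' \<in> S" "feasible x' a'" "obj x' a' \<le> obj x a" "i < n"
  shows "x' i = x i"
proof (rule ccontr)
  assume "x' i \<noteq> x i"
  then have "0 < \<gamma> / 2 * sqdist x x'" using sqdist_pos[of i x x'] assms(5) gamma_pos by auto
  then show False using opt_sharp[OF assms(1-3)] assms(4) by linarith
qed

text \<open>Both points are optimal in the smaller set, and minimizers are unique in \<open>x\<close>.\<close>

lemma opt_subset_eq:
  assumes "opt S x a" "opt S' x' a'" "S' \<subseteq> S" "x \<in> S'" "i < n"
  shows "x' i = x i"
proof -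
  have "feasible x a" "feasible x' a'" "x' \<in> S" using assms by (auto simp: opt_def)
  moreover have "0 \<le> \<gamma> / 2 * sqdist x' x"
    using gamma_pos sqdist_nonneg by simp
  ultimately have "obj x' a' \<le> obj x a"
    using opt_sharp[OF assms(2,4), of a] by linarith
  then show ?thesis using opt_unique[OF assms(1)] \<open>x' \<in> S\<close> \<open>feasible x' a'\<close> assms(5) by blast
qed

text \<open>Symmetries of the problem are inherited by the minimizer: a modification of \<open>x\<close> that increases
  neither \<open>G\<close> nor the distance to \<open>z\<close> is \<open>x\<close> itself.\<close>

lemma opt_fixed:
  assumes "opt S x a" "x' \<in> S" "G x' \<le> G x" "sqdist x' z \<le> sqdist x z" "i < n"
  shows "x' i = x i"
proof (rule opt_unique[OF assms(1,2) _ _ assms(5)])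
  show "feasible x' a" using assms by (auto simp: opt_def feasible_def)
  show "obj x' a \<le> obj x a" using assms gamma_pos by (auto simp: obj_def)
qed

lemma sqdist_swap:
  assumes "p < n" "q < n" "x p \<le> x q" "z q \<le> z p"
  shows "sqdist (x \<circ> Transposition.transpose p q) z \<le> sqdist x z"
proof (cases "p = q")
  case True then show ?thesis by simp
next
  case False
  let ?T = "Transposition.transpose p q"
  have split: "(\<Sum>i<n. h i) = h p + h q + (\<Sum>i\<in>{..<n} - {p, q}. h i)" for h :: "nat \<Rightarrow> real"
  proof -
    have "(\<Sum>i<n. h i) = (\<Sum>i\<in>{p, q}. h i) + (\<Sum>i\<in>{..<n} - {p, q}. h i)"
      using assms by (subst sum.subset_diff[of "{p, q}"]) auto
    then show ?thesis using False by simp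
  qed
  have "(\<Sum>i\<in>{..<n} - {p, q}. ((x \<circ> ?T) i - z i)\<^sup>2) = (\<Sum>i\<in>{..<n} - {p, q}. (x i - z i)\<^sup>2)"
    by (intro sum.cong) (auto simp: Transposition.transpose_def)
  moreover have "(x q - z p)\<^sup>2 + (x p - z q)\<^sup>2 \<le> (x p - z p)\<^sup>2 + (x q - z q)\<^sup>2"
  proof -
    have "0 \<le> (x q - x p) * (z p - z q)" using assms by simp
    then show ?thesis by (simp add: power2_eq_square algebra_simps)
  qed
  ultimately show ?thesis unfolding sqdist_def by (simp add: split)
qed

text \<open>The point of the segment from \<open>x\<close> to the minimizer \<open>y\<close> where the entries \<open>p\<close> and \<open>q\<close> agree is
  feasible by convexity, and not worse than \<open>x\<close> since \<open>y\<close> is not. It may be taken to be \<open>x\<close> itself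
  unless \<open>x p < x q\<close>; then \<open>y \<noteq> x\<close> has positive weight in it, which makes it strictly better.\<close>

lemma crossing:
  assumes y: "opt S y b" and x: "x \<in> S" "feasible x a" and pq: "p < n" "q < n"
    and le: "x p \<le> x q" "y q \<le> y p"
  obtains c d where "0 \<le> c" "c \<le> 1"
    "(1 - c) * x p + c * y p = (1 - c) * x q + c * y q"
    "feasible (\<lambda>i. (1 - c) * x i + c * y i) d"
    "obj (\<lambda>i. (1 - c) * x i + c * y i) d \<le> obj x a"
    "x p < x q \<Longrightarrow> obj (\<lambda>i. (1 - c) * x i + c * y i) d < obj x a"
proof -
  define e where "e = (y p - y q) + (x q - x p)"
  define c where "c = (if x p < x q then (x q - x p) / e else 0)"
  have c: "0 \<le> c" "c \<le> 1" "x p < x q \<Longrightarrow> 0 < c"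
    using le by (auto simp: c_def e_def divide_simps)
  have eq: "(1 - c) * x p + c * y p = (1 - c) * x q + c * y q"
  proof (cases "x p < x q")
    case True
    then have "e \<noteq> 0" using le by (auto simp: e_def)
    then have "c * e = x q - x p" using True by (simp add: c_def)
    then show ?thesis by (simp add: e_def algebra_simps)
  next
    case False then show ?thesis using le by (simp add: c_def)
  qed
  let ?u = "\<lambda>i. (1 - c) * x i + c * y i"
  define d where "d = (1 - c) * a + c * b"
  have yb: "b \<in> V" "G y \<le> b" using y by (auto simp: opt_def feasible_def)
  have xa: "a \<in> V" "G x \<le> a" using x by (auto simp: feasible_def)
  have "d \<in> V" using convex_on_imp_convex[OF F_convex] xa yb c
    by (auto simp: d_def convex_alt)
  moreover have "G ?u \<le> d"
  proof -
    have "G ?u \<le> (1 - c) * G x + c * G y" using G_convex c by blast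
    also have "\<dots> \<le> d" unfolding d_def using xa yb c by (intro add_mono mult_left_mono) auto
    finally show ?thesis .
  qed
  ultimately have feas: "feasible ?u d" by (simp add: feasible_def)
  have "F d \<le> (1 - c) * F a + c * F b"
    using convex_onD[OF F_convex, of c a b] c xa yb by (simp add: d_def)
  moreover have "\<gamma> / 2 * sqdist ?u z \<le> \<gamma> / 2 * ((1 - c) * sqdist x z + c * sqdist y z)"
    using sqdist_convex[OF c(1,2), of x y] gamma_pos by (intro mult_left_mono) auto
  ultimately have "F d + \<gamma> / 2 * sqdist ?u z
      \<le> (1 - c) * F a + c * F b + \<gamma> / 2 * ((1 - c) * sqdist x z + c * sqdist y z)"
    by (rule add_mono)
  also have "\<dots> = (1 - c) * obj x a + c * obj y b"
    by (simp add: obj_def field_simps)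
  finally have "obj ?u d \<le> (1 - c) * obj x a + c * obj y b"
    by (simp add: obj_def)
  moreover have "c * obj y b \<le> c * (obj x a - \<gamma> / 2 * sqdist y x)"
    using opt_sharp[OF y x] c by (intro mult_left_mono) auto
  ultimately have o: "obj ?u d \<le> obj x a - c * (\<gamma> / 2 * sqdist y x)"
    by (simp add: algebra_simps)
  have "0 \<le> c * (\<gamma> / 2 * sqdist y x)" using c(1) gamma_pos sqdist_nonneg by simp
  then have "obj ?u d \<le> obj x a" using o by linarith
  moreover have "obj ?u d < obj x a" if "x p < x q"
  proof -
    have "x p \<noteq> y p \<or> x q \<noteq> y q" using that le by auto
    then have "0 < sqdist y x" using pq sqdist_pos[of p y x] sqdist_pos[of q y x] by metis
    then have "0 < c * (\<gamma> / 2 * sqdist y x)" using c(3)[OF that] gamma_pos by simp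
    then show ?thesis using o by linarith
  qed
  ultimately show ?thesis using that[OF c(1,2) eq feas] by blast
qed

text \<open>How the crossing point is used: \<open>y\<close> is optimal in \<open>S\<close>, and \<open>y'\<close> in a set \<open>S'\<close> that contains every
  point of the segment at which the entries \<open>p\<close> and \<open>q\<close> agree. If a competitor \<open>x\<close> that is at least
  as good as \<open>y'\<close> violates this equality in one direction, then \<open>y\<close> violates it in the same
  direction, as otherwise the crossing point would lie in \<open>S'\<close> and beat \<open>y'\<close>.\<close>

lemma no_crossing:
  assumes y: "opt S y b" and y': "opt S' y' b'"
    and x: "x \<in> S" "G x \<le> G y'" "sqdist x z \<le> sqdist y' z"
    and pq: "p < n" "q < n" "x p < x q"
    and seg: "\<And>c. 0 \<le> c \<Longrightarrow> c \<le> 1 \<Longrightarrow> (1 - c) * x p + c * y p = (1 - c) * x q + c * y q \<Longrightarrow>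
      (\<lambda>i. (1 - c) * x i + c * y i) \<in> S'"
  shows "y p < y q"
proof (rule ccontr)
  assume "\<not> y p < y q"
  then have le: "y q \<le> y p" by simp
  have fx: "feasible x b'" using y' x by (auto simp: opt_def feasible_def)
  obtain c d where c: "0 \<le> c" "c \<le> 1" and
    1: "(1 - c) * x p + c * y p = (1 - c) * x q + c * y q" and
    2: "feasible (\<lambda>i. (1 - c) * x i + c * y i) d" and
    3: "obj (\<lambda>i. (1 - c) * x i + c * y i) d < obj x b'"
    using crossing[OF y x(1) fx pq(1,2) less_imp_le[OF pq(3)] le] pq(3) by blast
  have "0 \<le> \<gamma> / 2 * sqdist y' (\<lambda>i. (1 - c) * x i + c * y i)"
    using gamma_pos sqdist_nonneg by simp
  then have "obj y' b' \<le> obj (\<lambda>i. (1 - c) * x i + c * y i) d"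
    using opt_sharp[OF y' seg[OF c 1] 2] by linarith
  moreover have "obj x b' \<le> obj y' b'" using x gamma_pos by (auto simp: obj_def)
  ultimately show False using 3 by linarith
qed

section \<open>Vectors that are constant on a block\<close>

text \<open>The block consists of the \<open>t\<close> positions before and the \<open>s\<close> positions after the boundary \<open>r\<close>.
  Its value is read off at position \<open>r - 1\<close>, which belongs to every block with \<open>t \<ge> 1\<close>.\<close>

definition pooled :: "nat \<Rightarrow> nat \<Rightarrow> (nat \<Rightarrow> real) set" where
  "pooled t s = {x. \<forall>i. r - t \<le> i \<and> i < r + s \<longrightarrow> x i = x (r - 1)}"

text \<open>The constraint set of the problem that the search over \<open>s\<close> solves for a fixed \<open>t\<close>.\<close>

definition pooled_top :: "nat \<Rightarrow> (nat \<Rightarrow> real) set" where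
  "pooled_top t = {x \<in> pooled t 0. \<forall>i. r \<le> i \<and> i < n \<longrightarrow> x i \<le> x (r - 1)}"

lemma pooledD: "x \<in> pooled t s \<Longrightarrow> r - t \<le> i \<Longrightarrow> i < r + s \<Longrightarrow> x i = x (r - 1)"
  unfolding pooled_def by blast

lemma pooled_topD:
  assumes "x \<in> pooled_top t"
  shows "r - t \<le> i \<Longrightarrow> i < r \<Longrightarrow> x i = x (r - 1)"
    and "r \<le> i \<Longrightarrow> i < n \<Longrightarrow> x i \<le> x (r - 1)"
proof -
  have "x \<in> pooled t 0" and top: "\<forall>i. r \<le> i \<and> i < n \<longrightarrow> x i \<le> x (r - 1)"
    using assms unfolding pooled_top_def by blast+
  then show "r - t \<le> i \<Longrightarrow> i < r \<Longrightarrow> x i = x (r - 1)" using pooledD[of x t 0 i] by simp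
  show "r \<le> i \<Longrightarrow> i < n \<Longrightarrow> x i \<le> x (r - 1)" using top by blast
qed

lemma pooled_topI:
  assumes "\<And>i. r - t \<le> i \<Longrightarrow> i < r \<Longrightarrow> x i = x (r - 1)"
    and "\<And>i. r \<le> i \<Longrightarrow> i < n \<Longrightarrow> x i \<le> x (r - 1)"
  shows "x \<in> pooled_top t"
  unfolding pooled_top_def pooled_def
proof (intro CollectI conjI allI impI)
  show "x i = x (r - 1)" if "r - t \<le> i \<and> i < r + 0" for i
    using assms(1)[of i] that by simp
qed (use assms(2) in blast)

lemma pooled_segment:
  assumes "x \<in> pooled t s" "y \<in> pooled t s"
  shows "(\<lambda>i. (1 - c) * x i + c * y i) \<in> pooled t s"
  unfolding pooled_def
proof (intro CollectI allI impI)
  fix i assume "r - t \<le> i \<and> i < r + s"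
  then have "x i = x (r - 1)" "y i = y (r - 1)" using assms pooledD by blast+
  then show "(1 - c) * x i + c * y i = (1 - c) * x (r - 1) + c * y (r - 1)" by simp
qed

text \<open>Taking absolute values does not leave the subspace, does not increase \<open>G\<close>, and moves the vector
  towards the nonnegative \<open>z\<close>.\<close>

lemma opt_pooled_nonneg:
  assumes "opt (pooled t s) y a" "i < n"
  shows "0 \<le> y i"
proof -
  have "\<bar>y i\<bar> = y i"
  proof (rule opt_fixed[OF assms(1) _ _ _ assms(2)])
    show "(\<lambda>i. \<bar>y i\<bar>) \<in> pooled t s" using assms(1) by (simp add: opt_def pooled_def)
    show "G (\<lambda>i. \<bar>y i\<bar>) \<le> G y" by (rule G_abs)
    have "(\<bar>y i\<bar> - z i)\<^sup>2 \<le> (y i - z i)\<^sup>2" if "i < n" for i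
      using z_nonneg[OF that] by (intro abs_le_square_iff[THEN iffD1]) auto
    then show "sqdist (\<lambda>i. \<bar>y i\<bar>) z \<le> sqdist y z"
      unfolding sqdist_def by (intro sum_mono) auto
  qed
  then show ?thesis by simp
qed

text \<open>Exchanging two entries before the block that are in the wrong order would not move the
  vector away from the decreasing \<open>z\<close>.\<close>

lemma opt_pooled_sorted:
  assumes "opt (pooled t s) y a" "i \<le> j" "j < r - t" "1 \<le> t"
  shows "y j \<le> y i"
proof (rule ccontr)
  assume "\<not> y j \<le> y i"
  then have less: "y i < y j" by simp
  have ij: "i < r" "j < r" "i < n" "j < n" using assms r_le by auto
  have "(y \<circ> Transposition.transpose i j) i = y i"
  proof (rule opt_fixed[OF assms(1) _ G_swap[OF ij(1,2)] _ ij(3)])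
    have yp: "\<And>k. r - t \<le> k \<Longrightarrow> k < r + s \<Longrightarrow> y k = y (r - 1)"
      using assms(1) pooledD unfolding opt_def by blast
    have "Transposition.transpose i j k = k" if "r - t \<le> k" for k
      using that assms(2,3) by (intro transpose_apply_other) auto
    then have "(y \<circ> Transposition.transpose i j) k = (y \<circ> Transposition.transpose i j) (r - 1)"
      if "r - t \<le> k \<and> k < r + s" for k
      using that yp[of k] assms(4) by simp
    then show "y \<circ> Transposition.transpose i j \<in> pooled t s"
      unfolding pooled_def by blast
    show "sqdist (y \<circ> Transposition.transpose i j) z \<le> sqdist y z"
      using ij less assms(2) z_antimono[of i j] by (intro sqdist_swap) auto
  qed
  then show False using less by simp
qed

lemma pooled_SucI:
  assumes "x \<in> pooled t s" "x (r + s) = x (r - 1)"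
  shows "x \<in> pooled t (Suc s)"
  using assms unfolding pooled_def by (auto simp: less_Suc_eq)

lemma pooled_top_SucI:
  assumes "x \<in> pooled_top t" "x (r - Suc t) = x (r - 1)"
  shows "x \<in> pooled_top (Suc t)"
proof -
  have "x i = x (r - 1)" if "r - Suc t \<le> i" "i < r" for i
  proof (cases "i = r - Suc t")
    case False
    then have "r - t \<le> i" using that by linarith
    then show ?thesis using pooled_topD(1)[OF assms(1)] that by blast
  qed (simp add: assms)
  then show ?thesis using pooled_topD(2)[OF assms(1)] by (intro pooled_topI)
qed

lemma pooled_antimono: "t' \<le> t \<Longrightarrow> s' \<le> s \<Longrightarrow> pooled t s \<subseteq> pooled t' s'"
  unfolding pooled_def by (auto simp: diff_le_mono2)

lemma pooled_top_antimono: "t' \<le> t \<Longrightarrow> pooled_top t \<subseteq> pooled_top t'"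
  unfolding pooled_top_def using pooled_antimono[of t' t 0 0] by auto

lemma pooled_top_segment:
  assumes "x \<in> pooled_top t" "y \<in> pooled_top t" "0 \<le> c" "c \<le> 1"
  shows "(\<lambda>i. (1 - c) * x i + c * y i) \<in> pooled_top t"
  using assms pooled_segment[of x t 0 y c] unfolding pooled_top_def
  by (auto intro!: add_mono mult_left_mono)

end

section \<open>The nested search over block sizes\<close>

text \<open>\<open>ss\<close> and \<open>ts\<close> are the first indices at which the candidate drops strictly behind, respectively
  before, the block.\<close>

locale nested_search = gauge_prox +
  fixes Y :: "nat \<Rightarrow> nat \<Rightarrow> nat \<Rightarrow> real" and W :: "nat \<Rightarrow> nat \<Rightarrow> real"
    and ss :: "nat \<Rightarrow> nat" and ts :: nat
  assumes Y_opt: "\<And>t s. t \<in> {1..r} \<Longrightarrow> s \<le> n - r \<Longrightarrow> opt (pooled t s) (Y t s) (W t s)"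
    and Y_tail: "\<And>t s i. t \<in> {1..r} \<Longrightarrow> r + s \<le> i \<Longrightarrow> i < n \<Longrightarrow> Y t s i = z i"
    and ss_le: "\<And>t. ss t \<le> n - r"
    and ss_min: "\<And>t s. s < ss t \<Longrightarrow> Y t s (r + s - 1) \<le> Y t s (r + s)"
    and ss_gap: "\<And>t. ss t < n - r \<Longrightarrow> Y t (ss t) (r + ss t) < Y t (ss t) (r + ss t - 1)"
    and ts_range: "1 \<le> ts" "ts \<le> r"
    and ts_min: "\<And>t. 1 \<le> t \<Longrightarrow> t < ts \<Longrightarrow> Y t (ss t) (r - t - 1) \<le> Y t (ss t) (r - t)"
    and ts_gap: "ts < r \<Longrightarrow> Y ts (ss ts) (r - ts) < Y ts (ss ts) (r - ts - 1)"
begin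

abbreviation yt :: "nat \<Rightarrow> nat \<Rightarrow> real" where
  "yt t \<equiv> Y t (ss t)"

lemma Y_pooled: "t \<in> {1..r} \<Longrightarrow> s \<le> n - r \<Longrightarrow> Y t s \<in> pooled t s"
  using Y_opt by (simp add: opt_def)

lemma Y_block:
  "t \<in> {1..r} \<Longrightarrow> s \<le> n - r \<Longrightarrow> r - t \<le> i \<Longrightarrow> i < r + s \<Longrightarrow> Y t s i = Y t s (r - 1)"
  using Y_pooled unfolding pooled_def by blast

lemma Y_last: "t \<in> {1..r} \<Longrightarrow> s \<le> n - r \<Longrightarrow> Y t s (r + s - 1) = Y t s (r - 1)"
  by (rule Y_block) auto

text \<open>Passing from \<open>s\<close> to \<open>s + 1\<close>. The competitor is the new candidate with its entry \<open>r + s\<close> reset to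
  the optimal value \<open>z (r + s)\<close>; this entry does not influence \<open>G\<close>.\<close>

lemma
  assumes t: "t \<in> {1..r}" and s: "s < n - r"
  shows s_step_le: "Y t s (r - 1) \<le> z (r + s) \<Longrightarrow> Y t (Suc s) (r - 1) \<le> z (r + s)"
    and s_step_ge: "z (r + s) \<le> Y t s (r - 1) \<Longrightarrow> z (r + s) \<le> Y t (Suc s) (r - 1)"
    and s_step_eq: "Y t s (r - 1) = z (r + s) \<Longrightarrow> i < n \<Longrightarrow> Y t (Suc s) i = Y t s i"
proof -
  let ?y = "Y t s" and ?y' = "Y t (Suc s)"
  let ?x = "?y'(r + s := z (r + s))"
  have o: "opt (pooled t s) ?y (W t s)" and o': "opt (pooled t (Suc s)) ?y' (W t (Suc s))"
    using Y_opt t s by auto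
  have n: "r + s < n" "r - 1 < n" "r + s \<noteq> r - 1" using s r_pos by auto
  have yrs: "?y (r + s) = z (r + s)" using Y_tail t n by auto
  have x: "?x \<in> pooled t s"
    using Y_pooled[OF t, of "Suc s"] s n(3) unfolding pooled_def by auto
  have Gx: "G ?x \<le> G ?y'" by (rule eq_refl, rule G_cong) simp
  have dx: "sqdist ?x z \<le> sqdist ?y' z" unfolding sqdist_def by (intro sum_mono) auto
  have seg: "(\<lambda>i. (1 - c) * ?x i + c * ?y i) \<in> pooled t (Suc s)"
    if "(1 - c) * ?x (r + s) + c * ?y (r + s) = (1 - c) * ?x (r - 1) + c * ?y (r - 1)" for c
    using pooled_SucI[OF pooled_segment[OF x, of ?y c]] Y_pooled[OF t, of s] s that by auto
  show "?y' (r - 1) \<le> z (r + s)" if "?y (r - 1) \<le> z (r + s)"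
  proof (rule ccontr)
    assume "\<not> ?thesis"
    then have "?y (r + s) < ?y (r - 1)"
      using no_crossing[OF o o' x Gx dx n(1,2)] seg n(3) by auto
    then show False using that yrs by simp
  qed
  show "z (r + s) \<le> ?y' (r - 1)" if "z (r + s) \<le> ?y (r - 1)"
  proof (rule ccontr)
    assume "\<not> ?thesis"
    then have "?y (r - 1) < ?y (r + s)"
      using no_crossing[OF o o' x Gx dx n(2,1)] seg[OF sym] n(3) by auto
    then show False using that yrs by simp
  qed
  show "?y' i = ?y i" if "?y (r - 1) = z (r + s)" "i < n"
  proof (rule opt_subset_eq[OF o o' _ _ that(2)])
    show "pooled t (Suc s) \<subseteq> pooled t s" by (rule pooled_antimono) auto
    show "?y \<in> pooled t (Suc s)"
      using pooled_SucI Y_pooled t s that(1) yrs by simp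
  qed
qed

lemma s_gap_above:
  assumes t: "t \<in> {1..r}" and "ss t \<le> s" "s < n - r"
  shows "z (r + s) \<le> Y t s (r - 1)"
  using assms(2,3)
proof (induction s rule: dec_induct)
  case base
  then show ?case
    using ss_gap[of t] Y_last[OF t ss_le] Y_tail[OF t, of "ss t" "r + ss t"] by auto
next
  case (step s)
  then have "z (r + s) \<le> Y t (Suc s) (r - 1)" using s_step_ge[OF t, of s] by simp
  moreover have "z (r + Suc s) \<le> z (r + s)" using step by (intro z_antimono) auto
  ultimately show ?case by simp
qed

lemma s_below:
  assumes t: "t \<in> {1..r}" and "s < ss t"
  shows "Y t s (r - 1) \<le> z (r + s)"
  using ss_min[OF assms(2)] Y_last[OF t, of s] Y_tail[OF t, of s "r + s"] ss_le[of t] assms(2) by auto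

text \<open>By \<open>s_step_eq\<close> a tie at \<open>s\<close> keeps the candidate, with block value \<open>z (r + s)\<close>. This is at least the
  next entry \<open>z (r + s + 1)\<close> and, before \<open>ss t\<close>, at most that entry: the tie persists up to \<open>ss t\<close>.\<close>

lemma s_tie:
  assumes t: "t \<in> {1..r}" and "s < ss t" and eq: "Y t s (r - 1) = z (r + s)" and "i < n"
  shows "Y t s i = yt t i"
proof -
  have "s \<le> k \<Longrightarrow> k \<le> ss t \<Longrightarrow> \<forall>i<n. Y t k i = Y t s i" for k
  proof (induction k rule: dec_induct)
    case (step k)
    have "z (r + k) \<le> z (r + s)" using step ss_le[of t] by (intro z_antimono) auto
    also have "z (r + s) = Y t k (r - 1)" using eq step r_pos r_le by simp
    finally have "Y t k (r - 1) = z (r + k)" using s_below[OF t, of k] step by simp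
    then show ?case using s_step_eq[OF t, of k] step ss_le[of t] by auto
  qed simp
  from this[of "ss t"] show ?thesis using assms(2,4) by simp
qed

lemma yt_le_z:
  assumes t: "t \<in> {1..r}" and "i < r + ss t" "r \<le> i"
  shows "yt t (r - 1) \<le> z i"
proof -
  obtain k where k: "ss t = Suc k" using assms by (cases "ss t") auto
  have "Y t (Suc k) (r - 1) \<le> z (r + k)"
    using s_step_le[OF t, of k] s_below[OF t, of k] k ss_le[of t] by auto
  also have "z (r + k) \<le> z i" using assms k ss_le[of t] by (intro z_antimono) auto
  finally show ?thesis using k by simp
qed

lemma yt_pooled_top:
  assumes t: "t \<in> {1..r}"
  shows "yt t \<in> pooled_top t"
proof -
  have "yt t i \<le> yt t (r - 1)" if "r \<le> i" "i < n" for i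
  proof (cases "i < r + ss t")
    case True
    then show ?thesis using Y_block[OF t ss_le, of i] that by simp
  next
    case False
    then have "ss t < n - r" using that by simp
    moreover have "z i \<le> z (r + ss t)" using False that by (intro z_antimono) auto
    ultimately show ?thesis using s_gap_above[OF t, of "ss t"] Y_tail[OF t, of "ss t" i] False that by simp
  qed
  moreover have "yt t \<in> pooled t 0"
    using Y_pooled[OF t ss_le[of t]] pooled_antimono[of t t 0 "ss t"] by auto
  ultimately show ?thesis by (simp add: pooled_top_def)
qed

text \<open>Replacing the entries behind the boundary by the block value turns an element of the larger set
  into one of the subspace. For the pooled positions behind the boundary \<open>z\<close> is at least the block
  value (\<open>yt_le_z\<close>), so this only increases the linear term in the optimality condition.\<close>

lemma yt_opt:
  assumes t: "t \<in> {1..r}"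
  shows "opt (pooled_top t) (yt t) (W t (ss t))"
proof -
  let ?y = "yt t" and ?s = "ss t"
  have o: "opt (pooled t ?s) ?y (W t ?s)" using Y_opt t ss_le by simp
  show ?thesis unfolding opt_def
  proof (intro conjI ballI allI impI)
    show "?y \<in> pooled_top t" by (rule yt_pooled_top[OF t])
    show "feasible ?y (W t ?s)" using o by (simp add: opt_def)
    fix x a assume x: "x \<in> pooled_top t" and f: "feasible x a"
    define x' where "x' i = (if i < r then x i else x (r - 1))" for i
    have xr: "x i = x (r - 1)" if "r - t \<le> i" "i < r" for i
      using pooled_topD(1)[OF x that] .
    have "x' i = x' (r - 1)" if "r - t \<le> i" for i
      using xr[OF that] r_pos by (simp add: x'_def)
    then have x': "x' \<in> pooled t ?s" unfolding pooled_def by blast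
    have "G x' = G x" by (rule G_cong) (simp add: x'_def)
    then have "feasible x' a" using f by (simp add: feasible_def)
    then have "F (W t ?s) + \<gamma> * (\<Sum>i<n. (z i - ?y i) * (x' i - ?y i)) \<le> F a"
      using o x' by (auto simp: opt_def)
    moreover have "(\<Sum>i<n. (z i - ?y i) * (x i - ?y i)) \<le> (\<Sum>i<n. (z i - ?y i) * (x' i - ?y i))"
    proof (intro sum_mono)
      fix i assume "i \<in> {..<n}"
      then have i: "i < n" by simp
      consider "i < r" | "r \<le> i" "i < r + ?s" | "r + ?s \<le> i" by linarith
      then show "(z i - ?y i) * (x i - ?y i) \<le> (z i - ?y i) * (x' i - ?y i)"
      proof cases
        case 2
        then have "0 \<le> z i - ?y i" using yt_le_z[OF t] Y_block[OF t ss_le, of i] by simp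
        moreover have "x i \<le> x' i" using pooled_topD(2)[OF x] 2 i by (simp add: x'_def)
        ultimately show ?thesis by (intro mult_left_mono) auto
      qed (use Y_tail[OF t _ i, of ?s] in \<open>auto simp: x'_def\<close>)
    qed
    ultimately show "F (W t ?s) + \<gamma> * (\<Sum>i<n. (z i - ?y i) * (x i - ?y i)) \<le> F a"
      using gamma_pos by (smt (verit) mult_left_mono)
  qed
qed

lemma yt_nonneg: "t \<in> {1..r} \<Longrightarrow> i < n \<Longrightarrow> 0 \<le> yt t i"
  by (rule opt_pooled_nonneg[OF Y_opt[OF _ ss_le]])

lemma yt_sorted: "t \<in> {1..r} \<Longrightarrow> i \<le> j \<Longrightarrow> j < r - t \<Longrightarrow> yt t j \<le> yt t i"
  by (rule opt_pooled_sorted[OF Y_opt[OF _ ss_le]]) auto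

text \<open>Passing from \<open>t\<close> to \<open>t + 1\<close>. If the new candidate increased from \<open>p\<close> to \<open>q\<close>, the two positions just
  before the old block, exchanging these entries would give a competitor for \<open>t\<close> that is at least
  as good and whose entry \<open>q\<close> lies below the block, while that of the old candidate does not.\<close>

lemma t_step:
  assumes t: "1 \<le> t" "Suc t < r" and le: "yt t (r - 1) \<le> yt t (r - Suc t)"
  shows "yt (Suc t) (r - 1) \<le> yt (Suc t) (r - Suc (Suc t))"
proof (rule ccontr)
  assume neg: "\<not> ?thesis"
  let ?y = "yt t" and ?y' = "yt (Suc t)"
  define p q where "p = r - Suc (Suc t)" and "q = r - Suc t"
  have pq: "p < q" "q < r - 1" "q < r - t" "q = r - Suc t" using t by (auto simp: p_def q_def)
  let ?x = "?y' \<circ> Transposition.transpose p q"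
  have t1: "t \<in> {1..r}" "Suc t \<in> {1..r}" using t by auto
  have y': "?y' \<in> pooled_top (Suc t)" by (rule yt_pooled_top[OF t1(2)])
  have y'q: "?y' q = ?y' (r - 1)" using Y_block[OF t1(2) ss_le, of q] pq by auto
  have less: "?y' p < ?y' q" using neg y'q by (simp add: p_def)
  have xi: "?x i = ?y' i" if "q < i" for i
    using that pq(1) by (auto simp: Transposition.transpose_def)
  have y't: "?y' \<in> pooled_top t" using y' pooled_top_antimono[of t "Suc t"] by auto
  have x: "?x \<in> pooled_top t"
  proof -
    have xy: "?x i = ?y' i" if "r - t \<le> i" for i using that pq by (intro xi) simp
    have xr: "?x (r - 1) = ?y' (r - 1)" using pq by (intro xi) simp
    have "?x i = ?x (r - 1)" if "r - t \<le> i" "i < r" for i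
      using pooled_topD(1)[OF y't that] xy[of i] xr that by simp
    moreover have "?x i \<le> ?x (r - 1)" if "r \<le> i" "i < n" for i
      using pooled_topD(2)[OF y't that] xy[of i] xr that by simp
    ultimately show ?thesis by (rule pooled_topI)
  qed
  have "?y q < ?y (r - 1)"
  proof (rule no_crossing[OF yt_opt[OF t1(1)] yt_opt[OF t1(2)] x])
    show "G ?x \<le> G ?y'" using pq by (intro G_swap) auto
    show "sqdist ?x z \<le> sqdist ?y' z"
      using pq r_le less by (intro sqdist_swap z_antimono) auto
    show "q < n" "r - 1 < n" using pq r_le by auto
    show "?x q < ?x (r - 1)" using xi[of "r - 1"] pq less y'q by simp
    fix c :: real assume c: "0 \<le> c" "c \<le> 1" and eq: "(1 - c) * ?x q + c * ?y q = (1 - c) * ?x (r - 1) + c * ?y (r - 1)"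
    show "(\<lambda>i. (1 - c) * ?x i + c * ?y i) \<in> pooled_top (Suc t)"
      using pooled_top_SucI[OF pooled_top_segment[OF x yt_pooled_top[OF t1(1)] c]] eq pq(4) by simp
  qed
  then show False using le pq(4) by simp
qed

lemma yt_block: "t \<in> {1..r} \<Longrightarrow> yt t (r - t) = yt t (r - 1)"
  using Y_block[of t "ss t" "r - t"] ss_le[of t] by auto

lemma t_gap_above:
  assumes "ts \<le> t" "t < r"
  shows "yt t (r - t) \<le> yt t (r - t - 1)"
proof -
  have "yt t (r - 1) \<le> yt t (r - Suc t)"
    using assms
  proof (induction t rule: dec_induct)
    case base
    then have "yt ts (r - ts) < yt ts (r - Suc ts)" using ts_gap assms by simp
    then show ?case using yt_block[of ts] ts_range by simp
  next
    case (step t)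
    have "1 \<le> t" "Suc t < r" using step ts_range by auto
    from t_step[OF this step.IH] show ?case using step by simp
  qed
  then show ?thesis using yt_block[of t] assms ts_range by simp
qed

text \<open>In case of a tie the candidate for \<open>t\<close> is already constant on the larger block. Being sorted, its
  next entry is not below the block, and before \<open>ts\<close> it is not above: the tie persists up to \<open>ts\<close>.\<close>

lemma t_tie:
  assumes t: "1 \<le> t" "t < ts" and eq: "yt t (r - t - 1) = yt t (r - t)" and "i < n"
  shows "yt t i = yt ts i"
proof -
  have tr: "t \<in> {1..r}" using t ts_range by auto
  have "t \<le> k \<Longrightarrow> k \<le> ts \<Longrightarrow> \<forall>i<n. yt k i = yt t i" for k
  proof (induction k rule: dec_induct)
    case (step k)
    then have IH: "\<And>i. i < n \<Longrightarrow> yt k i = yt t i" by auto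
    have k: "k \<in> {1..r}" "Suc k \<in> {1..r}" "1 \<le> k" "k < ts" using step t ts_range by auto
    have "yt k (r - k - 1) \<le> yt k (r - k)" using ts_min k by blast
    moreover have "yt k (r - k) \<le> yt k (r - k - 1)"
    proof -
      have "yt k (r - k) = yt t (r - 1)" using yt_block[OF k(1)] IH[of "r - 1"] r_le r_pos by simp
      also have "\<dots> = yt t (r - t - 1)" using eq yt_block[OF tr] by simp
      also have "\<dots> \<le> yt t (r - k - 1)" using step k ts_range by (intro yt_sorted[OF tr]) auto
      also have "\<dots> = yt k (r - k - 1)" using IH[of "r - k - 1"] r_le k by simp
      finally show ?thesis .
    qed
    ultimately have "yt k (r - Suc k) = yt k (r - 1)" using yt_block[OF k(1)] by simp
    then have "yt k \<in> pooled_top (Suc k)" using pooled_top_SucI yt_pooled_top[OF k(1)] by blast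
    then have "\<forall>i<n. yt (Suc k) i = yt k i"
      using opt_subset_eq[OF yt_opt[OF k(1)] yt_opt[OF k(2)]] pooled_top_antimono[of k "Suc k"] by auto
    then show ?case using IH by simp
  qed simp
  from this[of ts] show ?thesis using t assms(4) by simp
qed

text \<open>The competitor is pooled one entry at a time. As long as \<open>t < ts\<close>, it and the candidate \<open>yt t\<close> lie on
  different sides of the hyperplane on which the entry before the block equals the block, so
  the segment between them contains a point with a larger block that is not worse. Both
  vectors are sorted before the block, so the point is again sorted and the argument can be repeated.\<close>

theorem yt_ts_optimal:
  assumes sorted: "\<And>i j. i \<le> j \<Longrightarrow> j < r \<Longrightarrow> x j \<le> x i"
    and top: "\<And>i. r \<le> i \<Longrightarrow> i < n \<Longrightarrow> x i \<le> x (r - 1)"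
    and feas: "feasible x a"
  shows "obj (yt ts) (W ts (ss ts)) \<le> obj x a"
proof -
  have "\<exists>u b. u \<in> pooled_top t \<and> feasible u b \<and> obj u b \<le> obj x a \<and>
      (\<forall>i j. i \<le> j \<and> j \<le> r - t \<longrightarrow> u j \<le> u i)" if "1 \<le> t" "t \<le> ts" for t
    using that
  proof (induction t rule: dec_induct)
    case base
    have "x i = x (r - 1)" if "r - 1 \<le> i" "i < r" for i
      using that by (intro arg_cong[of _ _ x]) simp
    then have "x \<in> pooled_top 1" using top by (intro pooled_topI)
    then show ?case using feas sorted r_pos by (intro exI[of _ x] exI[of _ a]) auto
  next
    case (step t)
    let ?y = "yt t"
    have t: "t \<in> {1..r}" "t < r" using step ts_range by auto
    have "t \<le> ts" using step.prems by simp
    from step.IH[OF this] obtain u b where u: "u \<in> pooled_top t" "feasible u b" "obj u b \<le> obj x a"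
      and us: "\<And>i j. i \<le> j \<Longrightarrow> j \<le> r - t \<Longrightarrow> u j \<le> u i" by blast
    have y: "?y \<in> pooled_top t" by (rule yt_pooled_top[OF t(1)])
    have "u (r - t) = u (r - 1)" using t by (intro pooled_topD[OF u(1)]) auto
    then have "u (r - 1) \<le> u (r - Suc t)" using us[of "r - Suc t" "r - t"] by simp
    moreover have "?y (r - Suc t) \<le> ?y (r - 1)"
      using ts_min[of t] step yt_block[OF t(1)] by simp
    moreover have "r - 1 < n" "r - Suc t < n" using r_le r_pos by auto
    ultimately obtain c d where c: "0 \<le> c" "c \<le> 1"
      and eq: "(1 - c) * u (r - 1) + c * ?y (r - 1) = (1 - c) * u (r - Suc t) + c * ?y (r - Suc t)"
      and d: "feasible (\<lambda>i. (1 - c) * u i + c * ?y i) d"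
      "obj (\<lambda>i. (1 - c) * u i + c * ?y i) d \<le> obj u b"
      using crossing[OF yt_opt[OF t(1)] u(1,2)] by blast
    let ?v = "\<lambda>i. (1 - c) * u i + c * ?y i"
    have "?v \<in> pooled_top (Suc t)"
      using pooled_top_SucI[OF pooled_top_segment[OF u(1) y c]] eq by simp
    moreover have "?v j \<le> ?v i" if "i \<le> j" "j \<le> r - Suc t" for i j
      using us[of i j] yt_sorted[OF t(1), of i j] that t c
      by (intro add_mono mult_left_mono) auto
    moreover have "obj ?v d \<le> obj x a" using d(2) u(3) by simp
    ultimately show ?case using d(1) by (intro exI[of _ ?v] exI[of _ d] conjI) auto
  qed
  from this[of ts] obtain u b where u: "u \<in> pooled_top ts" "feasible u b" "obj u b \<le> obj x a"
    using ts_range by auto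
  have "0 \<le> \<gamma> / 2 * sqdist (yt ts) u" using gamma_pos sqdist_nonneg by simp
  then show ?thesis using opt_sharp[OF yt_opt u(1,2)] u(3) ts_range by auto
qed

lemma yt_ts_antimono:
  assumes "i \<le> j" "j < n"
  shows "yt ts j \<le> yt ts i"
proof -
  have ts: "ts \<in> {1..r}" using ts_range by simp
  have le_block: "yt ts j \<le> yt ts (r - 1)" if "r - ts \<le> j" "j < n" for j
    using pooled_topD[OF yt_pooled_top[OF ts], of j] that by (cases "j < r") auto
  have block_le: "yt ts (r - 1) \<le> yt ts i" if "i < r + ss ts"
  proof (cases "i < r - ts")
    case True
    then have "ts < r" by simp
    then have "yt ts (r - 1) \<le> yt ts (r - ts - 1)" using ts_gap yt_block[OF ts] by simp
    also have "\<dots> \<le> yt ts i" using True by (intro yt_sorted[OF ts]) auto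
    finally show ?thesis .
  next
    case False
    then show ?thesis using Y_block[OF ts ss_le, of i] that by simp
  qed
  consider "j < r - ts" | "r - ts \<le> j" "i < r + ss ts" | "r + ss ts \<le> i" by linarith
  then show ?thesis
  proof cases
    case 1 then show ?thesis using yt_sorted[OF ts assms(1)] by simp
  next
    case 2 then show ?thesis using le_block[of j] block_le assms by simp
  next
    case 3 then show ?thesis using Y_tail[OF ts] z_antimono assms by simp
  qed
qed

end

section \<open>Symmetric gauges and their duals\<close>

definition head_vec :: "nat \<Rightarrow> nat \<Rightarrow> (nat \<Rightarrow> real) \<Rightarrow> real vec" where
  "head_vec n r x = vec n (\<lambda>i. if i < r then x i else 0)"

lemma head_vec_carrier [simp]: "head_vec n r x \<in> carrier_vec n"
  by (simp add: head_vec_def)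

lemma scalar_prod_head_vec:
  "a \<bullet> head_vec n r x = (\<Sum>i<n. a $ i * (if i < r then x i else 0))"
  by (auto simp: scalar_prod_def head_vec_def lessThan_atLeast0 intro!: sum.cong)

locale symmetric_gauge =
  fixes n :: nat and g :: "real vec \<Rightarrow> real"
  assumes sym_gauge: "sym_gauge n g"
begin

lemma
  assumes "x \<in> carrier_vec n"
  shows g_nonneg: "0 \<le> g x" and g_zero_iff: "g x = 0 \<longleftrightarrow> x = 0\<^sub>v n"
    and g_smult: "g (c \<cdot>\<^sub>v x) = \<bar>c\<bar> * g x"
    and g_abs: "g (map_vec abs x) = g x"
    and g_permute: "p permutes {0..<n} \<Longrightarrow> g (vec n (\<lambda>i. x $ p i)) = g x"
    and g_triangle: "y \<in> carrier_vec n \<Longrightarrow> g (x + y) \<le> g x + g y"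
  using sym_gauge assms unfolding sym_gauge_def by blast+

lemma g_zero [simp]: "g (0\<^sub>v n) = 0"
  using g_zero_iff by simp

lemma g_unit_pos: "i < n \<Longrightarrow> 0 < g (unit_vec n i)"
  using g_nonneg[of "unit_vec n i"] g_zero_iff[of "unit_vec n i"]
  by (metis index_unit_vec(1) index_zero_vec(1) less_eq_real_def unit_vec_carrier zero_neq_one)

text \<open>Flipping the signs of all other entries does not change \<open>g\<close>, and the average of the two vectors is
  a multiple of a unit vector.\<close>

lemma coordinate_le_g:
  assumes x: "x \<in> carrier_vec n" and i: "i < n"
  shows "\<bar>x $ i\<bar> * g (unit_vec n i) \<le> g x"
proof -
  define x' where "x' = vec n (\<lambda>j. if j = i then x $ j else - x $ j)"
  have x': "x' \<in> carrier_vec n" by (simp add: x'_def)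
  have "map_vec abs x' = map_vec abs x"
    using x by (intro eq_vecI) (auto simp: x'_def)
  then have "g x' = g x" using g_abs x x' by metis
  moreover have "x + x' = (2 * x $ i) \<cdot>\<^sub>v unit_vec n i"
    using x i by (intro eq_vecI) (auto simp: x'_def unit_vec_def)
  ultimately have "\<bar>2 * x $ i\<bar> * g (unit_vec n i) \<le> 2 * g x"
    using g_triangle[OF x x'] g_smult[of "unit_vec n i" "2 * x $ i"] by simp
  then show ?thesis by (simp add: abs_mult)
qed

text \<open>A crude bound for the entries of vectors in the unit ball of \<open>g\<close>; it makes the suprema finite.\<close>

definition coord_bound :: real where
  "coord_bound = (\<Sum>i<n. 1 / g (unit_vec n i))"

lemma coordinate_bound:
  assumes x: "x \<in> carrier_vec n" "g x \<le> 1" and i: "i < n"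
  shows "\<bar>x $ i\<bar> \<le> coord_bound"
proof -
  have "\<bar>x $ i\<bar> \<le> 1 / g (unit_vec n i)"
    using coordinate_le_g[OF x(1) i] x(2) g_unit_pos[OF i] by (simp add: field_simps)
  also have "\<dots> \<le> coord_bound"
    unfolding coord_bound_def using g_unit_pos i
    by (intro member_le_sum) (auto simp: less_imp_le)
  finally show ?thesis .
qed

lemma dual_bdd_above:
  assumes "y \<in> carrier_vec n"
  shows "bdd_above {x \<bullet> y | x. x \<in> carrier_vec n \<and> g x \<le> 1}"
proof (rule bdd_aboveI)
  fix c assume "c \<in> {x \<bullet> y | x. x \<in> carrier_vec n \<and> g x \<le> 1}"
  then obtain x where x: "x \<in> carrier_vec n" "g x \<le> 1" "c = x \<bullet> y" by auto
  have "c \<le> (\<Sum>i = 0..<n. \<bar>x $ i\<bar> * \<bar>y $ i\<bar>)"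
    using x assms unfolding scalar_prod_def
    by (auto intro!: sum_mono simp: abs_mult[symmetric])
  also have "\<dots> \<le> (\<Sum>i = 0..<n. coord_bound * \<bar>y $ i\<bar>)"
    using coordinate_bound[OF x(1,2)] by (intro sum_mono mult_right_mono) auto
  finally show "c \<le> (\<Sum>i = 0..<n. coord_bound * \<bar>y $ i\<bar>)" .
qed

lemma dual_upper:
  assumes "y \<in> carrier_vec n" "x \<in> carrier_vec n" "g x \<le> 1"
  shows "x \<bullet> y \<le> dual_norm n g y"
  unfolding dual_norm_def using assms by (intro cSup_upper dual_bdd_above) auto

lemma dual_least:
  assumes "\<And>x. x \<in> carrier_vec n \<Longrightarrow> g x \<le> 1 \<Longrightarrow> x \<bullet> y \<le> B"
  shows "dual_norm n g y \<le> B"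
  unfolding dual_norm_def using assms by (intro cSup_least) (auto intro: exI[of _ "0\<^sub>v n"])

lemma dual_nonneg: "y \<in> carrier_vec n \<Longrightarrow> 0 \<le> dual_norm n g y"
  using dual_upper[of y "0\<^sub>v n"] by simp

lemma holder:
  assumes x: "x \<in> carrier_vec n" and y: "y \<in> carrier_vec n"
  shows "x \<bullet> y \<le> g x * dual_norm n g y"
proof (cases "g x = 0")
  case True
  then show ?thesis using x y g_zero_iff by simp
next
  case False
  then have pos: "0 < g x" using g_nonneg[OF x] by simp
  have "((1 / g x) \<cdot>\<^sub>v x) \<bullet> y \<le> dual_norm n g y"
    using x pos by (intro dual_upper[OF y]) (simp_all add: g_smult)
  then show ?thesis using pos x y by (simp add: field_simps)
qed

text \<open>The gauge of the vector problem. It takes vectors as functions, so that all truncated dual gauges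
  become restrictions of \<open>G r\<close> (\<open>G_extend_vec\<close>).\<close>

definition G :: "nat \<Rightarrow> (nat \<Rightarrow> real) \<Rightarrow> real" where
  "G r x = dual_norm n g (head_vec n r x)"

lemma G_upper: "a \<in> carrier_vec n \<Longrightarrow> g a \<le> 1 \<Longrightarrow> (\<Sum>i<n. a $ i * (if i < r then x i else 0)) \<le> G r x"
  unfolding G_def by (metis dual_upper scalar_prod_head_vec head_vec_carrier)

lemma G_least:
  "(\<And>a. a \<in> carrier_vec n \<Longrightarrow> g a \<le> 1 \<Longrightarrow> (\<Sum>i<n. a $ i * (if i < r then x i else 0)) \<le> B) \<Longrightarrow> G r x \<le> B"
  unfolding G_def by (rule dual_least) (simp add: scalar_prod_head_vec)

lemma G_cong: "(\<And>i. i < r \<Longrightarrow> x i = y i) \<Longrightarrow> G r x = G r y"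
  unfolding G_def head_vec_def by (intro arg_cong[of _ _ "dual_norm n g"] eq_vecI) auto

lemma G_convex:
  assumes "0 \<le> c" "c \<le> 1"
  shows "G r (\<lambda>i. (1 - c) * x i + c * y i) \<le> (1 - c) * G r x + c * G r y"
proof (rule G_least)
  fix a :: "real vec" assume a: "a \<in> carrier_vec n" "g a \<le> 1"
  have "(\<Sum>i<n. a $ i * (if i < r then (1 - c) * x i + c * y i else 0))
      = (1 - c) * (\<Sum>i<n. a $ i * (if i < r then x i else 0))
        + c * (\<Sum>i<n. a $ i * (if i < r then y i else 0))"
    unfolding sum_distrib_left sum.distrib[symmetric] by (intro sum.cong) (auto simp: algebra_simps)
  also have "\<dots> \<le> (1 - c) * G r x + c * G r y"
    using G_upper[OF a] assms by (intro add_mono mult_left_mono) auto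
  finally show "(\<Sum>i<n. a $ i * (if i < r then (1 - c) * x i + c * y i else 0)) \<le> \<dots>" .
qed

lemma G_abs: "G r (\<lambda>i. \<bar>x i\<bar>) \<le> G r x"
proof (rule G_least)
  fix a :: "real vec" assume a: "a \<in> carrier_vec n" "g a \<le> 1"
  define b where "b = vec n (\<lambda>i. if x i < 0 then - a $ i else a $ i)"
  have b: "b \<in> carrier_vec n" by (simp add: b_def)
  have "map_vec abs b = map_vec abs a" using a by (intro eq_vecI) (auto simp: b_def)
  then have "g b = g a" using g_abs a b by metis
  then have "(\<Sum>i<n. b $ i * (if i < r then x i else 0)) \<le> G r x" using G_upper[OF b] a by simp
  moreover have "(\<Sum>i<n. b $ i * (if i < r then x i else 0)) = (\<Sum>i<n. a $ i * (if i < r then \<bar>x i\<bar> else 0))"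
    by (intro sum.cong) (auto simp: b_def)
  ultimately show "(\<Sum>i<n. a $ i * (if i < r then \<bar>x i\<bar> else 0)) \<le> G r x" by simp
qed

lemma G_permute:
  assumes p: "p permutes {..<n}" and pr: "\<And>i. i < n \<Longrightarrow> p i < r \<longleftrightarrow> i < r"
  shows "G r (x \<circ> p) \<le> G r x"
proof (rule G_least)
  fix a :: "real vec" assume a: "a \<in> carrier_vec n" "g a \<le> 1"
  define q where "q = inv_into UNIV p"
  have q: "q permutes {..<n}" unfolding q_def using p by (rule permutes_inv)
  define b where "b = vec n (\<lambda>i. a $ q i)"
  have b: "b \<in> carrier_vec n" by (simp add: b_def)
  have "g b = g a" unfolding b_def using q a by (intro g_permute) (auto simp: lessThan_atLeast0)
  then have "(\<Sum>i<n. b $ i * (if i < r then x i else 0)) \<le> G r x" using G_upper[OF b] a by simp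
  moreover have "(\<Sum>i<n. b $ i * (if i < r then x i else 0))
      = (\<Sum>i<n. b $ p i * (if p i < r then x (p i) else 0))"
    by (rule sum.permute[OF p, unfolded o_def])
  moreover have "\<dots> = (\<Sum>i<n. a $ i * (if i < r then (x \<circ> p) i else 0))"
    using permutes_inverses(2)[OF p] permutes_in_image[OF p]
    by (intro sum.cong) (auto simp: b_def q_def pr)
  ultimately show "(\<Sum>i<n. a $ i * (if i < r then (x \<circ> p) i else 0)) \<le> G r x" by simp
qed

lemma G_swap:
  assumes "i < r" "j < r" "r \<le> n"
  shows "G r (x \<circ> Transposition.transpose i j) \<le> G r x"
  using assms by (intro G_permute permutes_swap_id) (auto simp: Transposition.transpose_def)

end

section \<open>The spectral theorem for real symmetric matrices\<close>

text \<open>Stated for an arbitrary finite index set \<open>A\<close>, so that it applies to vectors and, with pairs as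
  indices, to matrices.\<close>

lemma bessel:
  fixes e :: "'i \<Rightarrow> 'a \<Rightarrow> real"
  assumes fin: "finite A" "finite I"
    and orth: "\<And>i j. i \<in> I \<Longrightarrow> j \<in> I \<Longrightarrow> (\<Sum>a\<in>A. e i a * e j a) = (if i = j then 1 else 0)"
  shows "(\<Sum>i\<in>I. (\<Sum>a\<in>A. e i a * x a)\<^sup>2) \<le> (\<Sum>a\<in>A. (x a)\<^sup>2)"
proof -
  define c where "c i = (\<Sum>a\<in>A. e i a * x a)" for i
  have 1: "(\<Sum>a\<in>A. x a * (\<Sum>i\<in>I. c i * e i a)) = (\<Sum>i\<in>I. (c i)\<^sup>2)"
  proof -
    have "(\<Sum>a\<in>A. x a * (\<Sum>i\<in>I. c i * e i a)) = (\<Sum>a\<in>A. \<Sum>i\<in>I. c i * (e i a * x a))"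
      by (simp add: sum_distrib_left mult_ac)
    also have "\<dots> = (\<Sum>i\<in>I. \<Sum>a\<in>A. c i * (e i a * x a))" by (rule sum.swap)
    also have "\<dots> = (\<Sum>i\<in>I. (c i)\<^sup>2)"
      by (simp add: sum_distrib_left[symmetric] c_def[symmetric] power2_eq_square)
    finally show ?thesis .
  qed
  have 2: "(\<Sum>a\<in>A. (\<Sum>i\<in>I. c i * e i a)\<^sup>2) = (\<Sum>i\<in>I. (c i)\<^sup>2)"
  proof -
    have "(\<Sum>a\<in>A. (\<Sum>i\<in>I. c i * e i a)\<^sup>2) = (\<Sum>a\<in>A. \<Sum>i\<in>I. \<Sum>j\<in>I. c i * c j * (e i a * e j a))"
      by (simp add: power2_eq_square sum_product mult_ac)
    also have "\<dots> = (\<Sum>i\<in>I. \<Sum>a\<in>A. \<Sum>j\<in>I. c i * c j * (e i a * e j a))" by (rule sum.swap)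
    also have "\<dots> = (\<Sum>i\<in>I. \<Sum>j\<in>I. \<Sum>a\<in>A. c i * c j * (e i a * e j a))"
      by (intro sum.cong refl sum.swap)
    also have "\<dots> = (\<Sum>i\<in>I. \<Sum>j\<in>I. c i * c j * (if i = j then 1 else 0))"
      by (simp add: sum_distrib_left[symmetric] orth)
    also have "\<dots> = (\<Sum>i\<in>I. (c i)\<^sup>2)"
      using fin by (simp add: power2_eq_square mult_delta_right)
    finally show ?thesis .
  qed
  have "0 \<le> (\<Sum>a\<in>A. (x a - (\<Sum>i\<in>I. c i * e i a))\<^sup>2)" by (intro sum_nonneg) auto
  also have "\<dots> = (\<Sum>a\<in>A. (x a)\<^sup>2) + (\<Sum>a\<in>A. (\<Sum>i\<in>I. c i * e i a)\<^sup>2)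
      - 2 * (\<Sum>a\<in>A. x a * (\<Sum>i\<in>I. c i * e i a))"
    unfolding sum_distrib_left[of 2] sum.distrib[symmetric] sum_subtractf[symmetric]
    by (intro sum.cong refl) (simp add: power2_eq_square algebra_simps)
  finally show ?thesis unfolding 1 2 by (simp add: c_def)
qed

text \<open>For the real and imaginary parts \<open>x\<close>, \<open>y\<close> of an eigenvector, symmetry gives $y^T S x = x^T S y$,
  which reads $\mathrm{Im}(e) (|x|^2 + |y|^2) = 0$.\<close>

lemma symmetric_eigenvalue_real:
  fixes S :: "nat \<Rightarrow> nat \<Rightarrow> real"
  assumes sym: "\<And>a b. S a b = S b a"
    and ev: "\<And>a. a < n \<Longrightarrow> (\<Sum>b<n. of_real (S a b) * v b) = e * v a"
    and nz: "\<exists>a<n. v a \<noteq> (0::complex)"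
  shows "Im e = 0"
proof -
  let ?x = "\<lambda>a. Re (v a)" and ?y = "\<lambda>a. Im (v a)"
  have x: "(\<Sum>b<n. S a b * ?x b) = Re e * ?x a - Im e * ?y a" if "a < n" for a
    using arg_cong[OF ev[OF that], of Re] by (simp add: Re_sum)
  have y: "(\<Sum>b<n. S a b * ?y b) = Re e * ?y a + Im e * ?x a" if "a < n" for a
    using arg_cong[OF ev[OF that], of Im] by (simp add: Im_sum)
  have "(\<Sum>a<n. ?y a * (\<Sum>b<n. S a b * ?x b)) = (\<Sum>a<n. \<Sum>b<n. ?y a * (S a b * ?x b))"
    by (simp add: sum_distrib_left)
  also have "\<dots> = (\<Sum>b<n. \<Sum>a<n. ?y a * (S a b * ?x b))" by (rule sum.swap)
  also have "\<dots> = (\<Sum>b<n. ?x b * (\<Sum>a<n. S b a * ?y a))"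
    unfolding sum_distrib_left by (intro sum.cong refl) (metis sym mult.commute mult.assoc)
  finally have "(\<Sum>a<n. ?y a * (Re e * ?x a - Im e * ?y a)) = (\<Sum>a<n. ?x a * (Re e * ?y a + Im e * ?x a))"
    by (simp add: x y)
  then have "(\<Sum>a<n. ?x a * (Re e * ?y a + Im e * ?x a) - ?y a * (Re e * ?x a - Im e * ?y a)) = 0"
    by (simp add: sum_subtractf)
  also have "(\<Sum>a<n. ?x a * (Re e * ?y a + Im e * ?x a) - ?y a * (Re e * ?x a - Im e * ?y a))
     = Im e * (\<Sum>a<n. (?x a)\<^sup>2 + (?y a)\<^sup>2)"
    unfolding sum_distrib_left by (intro sum.cong refl) (simp add: power2_eq_square algebra_simps)
  finally have "Im e * (\<Sum>a<n. (?x a)\<^sup>2 + (?y a)\<^sup>2) = 0" .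
  moreover have "0 < (\<Sum>a<n. (?x a)\<^sup>2 + (?y a)\<^sup>2)"
  proof -
    obtain a where a: "a < n" "v a \<noteq> 0" using nz by auto
    then have "?x a \<noteq> 0 \<or> ?y a \<noteq> 0" using complex_eq_iff by auto
    then have "0 < (?x a)\<^sup>2 + (?y a)\<^sup>2" by (simp add: sum_power2_gt_zero_iff)
    then show ?thesis using a by (intro sum_pos2[of _ a]) auto
  qed
  ultimately show ?thesis by simp
qed

lemma sum_diagonal_mult_commute:
  fixes A B :: "'a::comm_ring_1 mat"
  assumes "A \<in> carrier_mat n n" "B \<in> carrier_mat n n"
  shows "(\<Sum>i<n. (A * B) $$ (i, i)) = (\<Sum>i<n. (B * A) $$ (i, i))"
proof -
  have "(\<Sum>i<n. (A * B) $$ (i, i)) = (\<Sum>i<n. \<Sum>k<n. A $$ (i, k) * B $$ (k, i))"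
    using assms by (intro sum.cong) (auto simp: scalar_prod_def lessThan_atLeast0)
  also have "\<dots> = (\<Sum>k<n. \<Sum>i<n. A $$ (i, k) * B $$ (k, i))" by (rule sum.swap)
  also have "\<dots> = (\<Sum>i<n. (B * A) $$ (i, i))"
    using assms by (intro sum.cong) (auto simp: scalar_prod_def lessThan_atLeast0 mult_ac)
  finally show ?thesis .
qed

text \<open>The trace is the sum of the \<open>n\<close> complex eigenvalues, so they cannot all be equal to \<open>c\<close>. All of
  them are real, and the real or the imaginary part of a complex eigenvector is a real eigenvector.\<close>

lemma symmetric_eigenvector:
  fixes S :: "nat \<Rightarrow> nat \<Rightarrow> real"
  assumes sym: "\<And>a b. S a b = S b a" and tr: "(\<Sum>a<n. S a a) \<noteq> real n * c"
  obtains \<mu> v where "\<mu> \<noteq> c" "\<exists>a<n. v a \<noteq> 0" "\<And>a. a < n \<Longrightarrow> (\<Sum>b<n. S a b * v b) = \<mu> * v a"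
proof -
  define C where "C = mat n n (\<lambda>(a, b). complex_of_real (S a b))"
  have C: "C \<in> carrier_mat n n" by (simp add: C_def)
  obtain es where es: "char_poly C = (\<Prod>e\<leftarrow>es. [:- e, 1:])" "length es = n"
    using char_poly_factorized[OF C] by auto
  obtain B P Q where "schur_decomposition C es = (B, P, Q)" by (cases "schur_decomposition C es")
  from schur_decomposition[OF C es(1) this]
  have wit: "similar_mat_wit C B P Q" and dB: "diag_mat B = es" by auto
  note w = similar_mat_witD[OF carrier_matD(1)[OF C, symmetric] wit]
  have "(\<Sum>a<n. C $$ (a, a)) = (\<Sum>a<n. (P * (B * Q)) $$ (a, a))" using w by simp
  also have "\<dots> = (\<Sum>a<n. (B * Q * P) $$ (a, a))" using w by (intro sum_diagonal_mult_commute) auto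
  also have "B * Q * P = B" using w by simp
  also have "(\<Sum>a<n. B $$ (a, a)) = sum_list es"
    using w(5) by (simp add: dB[symmetric] diag_mat_def sum_list_sum_nth lessThan_atLeast0)
  finally have trace: "sum_list es = of_real (\<Sum>a<n. S a a)" by (simp add: C_def)
  have "\<exists>e\<in>set es. e \<noteq> of_real c"
  proof (rule ccontr)
    assume "\<not> ?thesis"
    then have "es = replicate n (of_real c)" using es(2) by (metis replicate_eqI)
    then have "sum_list es = of_real (real n * c)" by (simp add: sum_list_replicate)
    then show False using trace tr by (metis of_real_eq_iff)
  qed
  then obtain e where e: "e \<in> set es" "e \<noteq> of_real c" by auto
  have "poly (char_poly C) e = 0" using e(1) by (simp add: es(1) poly_prod_list_zero_iff)
  then have "eigenvalue C e" using eigenvalue_root_char_poly[OF C] by simp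
  then obtain u where u: "u \<in> carrier_vec n" "u \<noteq> 0\<^sub>v n" "C *\<^sub>v u = e \<cdot>\<^sub>v u"
    using C unfolding eigenvalue_def eigenvector_def by auto
  have ev: "(\<Sum>b<n. of_real (S a b) * u $ b) = e * u $ a" if "a < n" for a
  proof -
    have "(C *\<^sub>v u) $ a = (\<Sum>b<n. of_real (S a b) * u $ b)"
      using that u(1) C by (auto simp: scalar_prod_def C_def lessThan_atLeast0 intro!: sum.cong)
    then show ?thesis using u that by simp
  qed
  have nz: "\<exists>a<n. u $ a \<noteq> 0" using u(1,2) by (metis carrier_vecD eq_vecI index_zero_vec)
  have Im: "Im e = 0" by (rule symmetric_eigenvalue_real[of S n "\<lambda>a. u $ a", OF sym ev nz])
  have re: "(\<Sum>b<n. S a b * Re (u $ b)) = Re e * Re (u $ a)" if "a < n" for a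
    using arg_cong[OF ev[OF that], of Re] Im by (simp add: Re_sum)
  have im: "(\<Sum>b<n. S a b * Im (u $ b)) = Re e * Im (u $ a)" if "a < n" for a
    using arg_cong[OF ev[OF that], of Im] Im by (simp add: Im_sum)
  have ec: "Re e \<noteq> c" using e(2) Im by (simp add: complex_eq_iff)
  obtain a where a: "a < n" "u $ a \<noteq> 0" using nz by auto
  show ?thesis
  proof (cases "Re (u $ a) = 0")
    case False
    then show ?thesis using that[of "Re e" "\<lambda>a. Re (u $ a)"] ec re a by auto
  next
    case True
    then have "Im (u $ a) \<noteq> 0" using a(2) complex_eq_iff by auto
    then show ?thesis using that[of "Re e" "\<lambda>a. Im (u $ a)"] ec im a by auto
  qed
qed

text \<open>Given \<open>k\<close> orthonormal eigenvectors, shift their eigenvalues to a common value \<open>c\<close> by adding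
  multiples of the projections $p_i p_i^T$. With \<open>c\<close> chosen to violate the trace condition, the
  shifted matrix has an eigenvalue different from \<open>c\<close>. Its eigenvector is orthogonal to the given
  ones, hence an eigenvector of the original matrix as well.\<close>

lemma symmetric_orthonormal_eigenvectors:
  fixes S :: "nat \<Rightarrow> nat \<Rightarrow> real"
  assumes sym: "\<And>a b. S a b = S b a" and "k \<le> n"
  shows "\<exists>p l. (\<forall>i<k. \<forall>j<k. (\<Sum>a<n. p i a * p j a) = (if i = j then 1 else 0)) \<and>
    (\<forall>i<k. \<forall>a<n. (\<Sum>b<n. S a b * p i b) = l i * p i a)"
  using assms(2)
proof (induction k)
  case (Suc k)
  then have "k \<le> n" by simp
  from Suc.IH[OF this] obtain p l
    where "\<forall>i<k. \<forall>j<k. (\<Sum>a<n. p i a * p j a) = (if i = j then 1 else 0)"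
      and "\<forall>i<k. \<forall>a<n. (\<Sum>b<n. S a b * p i b) = l i * p i a" by blast
  then have orth: "\<And>i j. i < k \<Longrightarrow> j < k \<Longrightarrow> (\<Sum>a<n. p i a * p j a) = (if i = j then 1 else 0)"
    and eig: "\<And>i a. i < k \<Longrightarrow> a < n \<Longrightarrow> (\<Sum>b<n. S a b * p i b) = l i * p i a" by blast+
  \<comment> \<open>The trace of \<open>T\<close> equals \<open>n * c\<close> for exactly one value of \<open>c\<close>; this is that value plus one.\<close>
  define c where "c = ((\<Sum>a<n. S a a) - (\<Sum>i<k. l i)) / real (n - k) + 1"
  define T where "T a b = S a b + (\<Sum>i<k. (c - l i) * p i a * p i b)" for a b
  have "(\<Sum>a<n. T a a) = (\<Sum>a<n. S a a) + (\<Sum>a<n. \<Sum>i<k. (c - l i) * (p i a * p i a))"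
    by (simp add: T_def sum.distrib mult.assoc)
  also have "(\<Sum>a<n. \<Sum>i<k. (c - l i) * (p i a * p i a)) = (\<Sum>i<k. \<Sum>a<n. (c - l i) * (p i a * p i a))"
    by (rule sum.swap)
  also have "\<dots> = (\<Sum>i<k. c - l i)" by (simp add: sum_distrib_left[symmetric] orth)
  finally have "(\<Sum>a<n. T a a) - real n * c = (\<Sum>a<n. S a a) - (\<Sum>i<k. l i) - real (n - k) * c"
    using Suc.prems by (simp add: sum_subtractf of_nat_diff algebra_simps)
  also have "\<dots> = - real (n - k)" using Suc.prems by (simp add: c_def field_simps)
  finally have "(\<Sum>a<n. T a a) \<noteq> real n * c" using Suc.prems by auto
  moreover have "T a b = T b a" for a b unfolding T_def by (simp add: sym[of a b] mult_ac)
  ultimately obtain \<mu> v where mu: "\<mu> \<noteq> c" and nz: "\<exists>a<n. v a \<noteq> 0"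
    and v: "\<And>a. a < n \<Longrightarrow> (\<Sum>b<n. T a b * v b) = \<mu> * v a"
    using symmetric_eigenvector[of T n c] by blast
  define d where "d i = (\<Sum>b<n. p i b * v b)" for i
  have Tv: "(\<Sum>b<n. T a b * v b) = (\<Sum>b<n. S a b * v b) + (\<Sum>i<k. (c - l i) * p i a * d i)" for a
  proof -
    have "(\<Sum>b<n. T a b * v b) = (\<Sum>b<n. S a b * v b) + (\<Sum>b<n. \<Sum>i<k. (c - l i) * p i a * (p i b * v b))"
      by (simp add: T_def distrib_right sum.distrib sum_distrib_right mult.assoc)
    also have "(\<Sum>b<n. \<Sum>i<k. (c - l i) * p i a * (p i b * v b)) = (\<Sum>i<k. \<Sum>b<n. (c - l i) * p i a * (p i b * v b))"
      by (rule sum.swap)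
    finally show ?thesis by (simp add: sum_distrib_left[symmetric] d_def)
  qed
  have d0: "d j = 0" if j: "j < k" for j
  proof -
    have "\<mu> * d j = (\<Sum>a<n. p j a * (\<Sum>b<n. T a b * v b))"
      unfolding d_def sum_distrib_left[of \<mu>]
      by (intro sum.cong refl) (simp add: v mult.left_commute)
    also have "\<dots> = (\<Sum>a<n. p j a * (\<Sum>b<n. S a b * v b)) + (\<Sum>a<n. \<Sum>i<k. (c - l i) * d i * (p j a * p i a))"
      by (simp only: Tv distrib_left sum.distrib) (simp add: sum_distrib_left mult_ac)
    also have "(\<Sum>a<n. \<Sum>i<k. (c - l i) * d i * (p j a * p i a)) = (\<Sum>i<k. \<Sum>a<n. (c - l i) * d i * (p j a * p i a))"
      by (rule sum.swap)
    also have "\<dots> = (\<Sum>i<k. (c - l i) * d i * (if j = i then 1 else 0))"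
      using j by (simp add: sum_distrib_left[symmetric] orth)
    also have "\<dots> = (c - l j) * d j" using j by (simp add: mult_delta_right)
    also have "(\<Sum>a<n. p j a * (\<Sum>b<n. S a b * v b)) = (\<Sum>a<n. \<Sum>b<n. p j a * S a b * v b)"
      by (simp add: sum_distrib_left mult.assoc)
    also have "\<dots> = (\<Sum>b<n. \<Sum>a<n. p j a * S a b * v b)" by (rule sum.swap)
    also have "\<dots> = (\<Sum>b<n. (\<Sum>a<n. S b a * p j a) * v b)"
      unfolding sum_distrib_right by (intro sum.cong refl) (metis sym mult.commute)
    also have "\<dots> = l j * d j" by (simp add: eig[OF j] d_def sum_distrib_left mult.assoc)
    finally have "(\<mu> - c) * d j = 0" by (simp add: algebra_simps)
    then show ?thesis using mu by simp
  qed
  have Sv: "(\<Sum>b<n. S a b * v b) = \<mu> * v a" if "a < n" for a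
    using Tv[of a] v[OF that] d0 by simp
  define N where "N = sqrt (\<Sum>a<n. v a * v a)"
  have "0 < (\<Sum>a<n. v a * v a)"
  proof -
    obtain a where a: "a < n" "v a \<noteq> 0" using nz by auto
    then have "0 < v a * v a" using not_real_square_gt_zero by blast
    then show ?thesis using a by (intro sum_pos2[of _ a]) auto
  qed
  then have N: "N \<noteq> 0" "(\<Sum>a<n. v a * v a) = N * N" by (auto simp: N_def)
  define p' where "p' = p(k := \<lambda>a. v a / N)"
  define l' where "l' = l(k := \<mu>)"
  have "(\<Sum>a<n. p i a * (v a / N)) = 0" if "i < k" for i
    using d0[OF that] by (simp add: d_def sum_divide_distrib[symmetric])
  moreover have "(\<Sum>a<n. v a / N * (v a / N)) = 1"
    using N by (simp add: sum_divide_distrib[symmetric])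
  ultimately have "\<forall>i<Suc k. \<forall>j<Suc k. (\<Sum>a<n. p' i a * p' j a) = (if i = j then 1 else 0)"
    using orth by (auto simp: p'_def less_Suc_eq mult.commute)
  moreover have "\<forall>i<Suc k. \<forall>a<n. (\<Sum>b<n. S a b * p' i b) = l' i * p' i a"
    using eig Sv by (auto simp: p'_def l'_def less_Suc_eq sum_divide_distrib[symmetric])
  ultimately show ?case by blast
qed auto

section \<open>Singular values\<close>

lemma proots_linear_factors: "proots (\<Prod>a\<leftarrow>as. [:- a, 1:] :: real poly) = mset as"
proof (induction as)
  case (Cons a as)
  have "(\<Prod>a\<leftarrow>as. [:- a, 1:]) \<noteq> (0 :: real poly)" by (auto simp: prod_list_zero_iff)
  then have "proots ([:- a, 1:] * (\<Prod>a\<leftarrow>as. [:- a, 1:])) = proots [:- a, 1:] + proots (\<Prod>a\<leftarrow>as. [:- a, 1:])"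
    by (intro proots_mult) auto
  then show ?case using Cons by simp
qed simp

text \<open>A one-sided inverse of a square matrix is two-sided.\<close>

lemma orthonormal_complete:
  fixes p :: "nat \<Rightarrow> nat \<Rightarrow> real"
  assumes orth: "\<And>i j. i < n \<Longrightarrow> j < n \<Longrightarrow> (\<Sum>a<n. p i a * p j a) = (if i = j then 1 else 0)"
    and "a < n" "b < n"
  shows "(\<Sum>i<n. p i a * p i b) = (if a = b then 1 else 0)"
proof -
  define P where "P = mat n n (\<lambda>(a, i). p i a)"
  define Q where "Q = mat n n (\<lambda>(i, a). p i a)"
  have c: "P \<in> carrier_mat n n" "Q \<in> carrier_mat n n" by (auto simp: P_def Q_def)
  have "Q * P = 1\<^sub>m n"
    by (rule eq_matI) (auto simp: P_def Q_def scalar_prod_def orth lessThan_atLeast0[symmetric])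
  then have "P * Q = 1\<^sub>m n" using mat_mult_left_right_inverse[OF c(2,1)] by simp
  then have "(P * Q) $$ (a, b) = (if a = b then 1 else 0)" using assms by simp
  then show ?thesis using assms by (simp add: P_def Q_def scalar_prod_def lessThan_atLeast0)
qed

lemma proots_char_poly_orthonormal:
  fixes p :: "nat \<Rightarrow> nat \<Rightarrow> real"
  assumes orth: "\<And>i j. i < n \<Longrightarrow> j < n \<Longrightarrow> (\<Sum>a<n. p i a * p j a) = (if i = j then 1 else 0)"
    and S: "S \<in> carrier_mat n n"
    and eig: "\<And>i a. i < n \<Longrightarrow> a < n \<Longrightarrow> (\<Sum>b<n. S $$ (a, b) * p i b) = l i * p i a"
  shows "proots (char_poly S) = mset (map l [0..<n])"
proof -
  define P where "P = mat n n (\<lambda>(a, i). p i a)"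
  define Q where "Q = mat n n (\<lambda>(i, a). p i a)"
  define D where "D = mat n n (\<lambda>(i, j). if i = j then l i else 0)"
  have c: "P \<in> carrier_mat n n" "Q \<in> carrier_mat n n" "D \<in> carrier_mat n n"
    by (auto simp: P_def Q_def D_def)
  have QP: "Q * P = 1\<^sub>m n"
    by (rule eq_matI) (auto simp: P_def Q_def scalar_prod_def orth lessThan_atLeast0[symmetric])
  have PQ: "P * Q = 1\<^sub>m n" using mat_mult_left_right_inverse[OF c(2,1) QP] .
  have "S * P = P * D"
  proof (rule eq_matI)
    fix a i assume "a < dim_row (P * D)" "i < dim_col (P * D)"
    then have ai: "a < n" "i < n" using c by auto
    have "(S * P) $$ (a, i) = l i * p i a"
      using ai S eig[of i a] by (simp add: P_def scalar_prod_def lessThan_atLeast0)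
    moreover have "(P * D) $$ (a, i) = l i * p i a"
      using ai by (simp add: P_def D_def scalar_prod_def mult_delta_right mult.commute)
    ultimately show "(S * P) $$ (a, i) = (P * D) $$ (a, i)" by simp
  qed (use c S in auto)
  then have "P * D * Q = S * P * Q" by simp
  also have "\<dots> = S * (P * Q)" using S c by (intro assoc_mult_mat) auto
  finally have "S = P * D * Q" using PQ S by simp
  then have "similar_mat_wit S D P Q" using PQ QP S c by (intro similar_mat_witI) auto
  then have "char_poly S = char_poly D"
    by (intro char_poly_similar) (auto simp: similar_mat_def)
  also have "\<dots> = (\<Prod>a\<leftarrow>diag_mat D. [:- a, 1:])"
    by (rule char_poly_upper_triangular[OF c(3)]) (auto simp: D_def)
  also have "diag_mat D = map l [0..<n]" by (auto simp: diag_mat_def D_def)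
  finally show ?thesis by (simp only: proots_linear_factors)
qed

text \<open>The Gram matrix of the rows, whose eigenvalues are the squared singular values.\<close>

definition row_gram :: "nat \<Rightarrow> real mat \<Rightarrow> nat \<Rightarrow> nat \<Rightarrow> real" where
  "row_gram m X a b = (\<Sum>k<m. X $$ (a, k) * X $$ (b, k))"

lemma row_gram_sym: "row_gram m X a b = row_gram m X b a"
  by (simp add: row_gram_def mult.commute)

lemma gram_index:
  assumes "X \<in> carrier_mat n m" "a < n" "b < n"
  shows "(X * transpose_mat X) $$ (a, b) = row_gram m X a b"
  using assms by (simp add: row_gram_def scalar_prod_def lessThan_atLeast0)

lemma
  fixes p :: "nat \<Rightarrow> nat \<Rightarrow> real"
  assumes X: "X \<in> carrier_mat n m"
    and orth: "\<And>i j. i < n \<Longrightarrow> j < n \<Longrightarrow> (\<Sum>a<n. p i a * p j a) = (if i = j then 1 else 0)"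
    and eig: "\<And>i a. i < n \<Longrightarrow> a < n \<Longrightarrow> (\<Sum>b<n. row_gram m X a b * p i b) = l i * p i a"
  shows mset_sing_vals: "mset (list_of_vec (sing_vals X)) = mset (map (\<lambda>i. sqrt (l i)) [0..<n])"
    and sorted_sing_vals: "sorted (rev (list_of_vec (sing_vals X)))"
    and sing_vals_carrier: "sing_vals X \<in> carrier_vec n"
proof -
  have "proots (char_poly (X * transpose_mat X)) = mset (map l [0..<n])"
  proof (rule proots_char_poly_orthonormal[OF orth])
    show "(\<Sum>b<n. (X * transpose_mat X) $$ (a, b) * p i b) = l i * p i a" if "i < n" "a < n" for i a
      using eig[OF that] gram_index[OF X that(2)] by simp
  qed (use X in auto)
  then have e: "list_of_vec (sing_vals X) = rev (sorted_list_of_multiset (mset (map (\<lambda>i. sqrt (l i)) [0..<n])))"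
    by (simp add: sing_vals_def list_vec comp_def multiset.map_comp)
  show m: "mset (list_of_vec (sing_vals X)) = mset (map (\<lambda>i. sqrt (l i)) [0..<n])"
    unfolding e by simp
  show "sorted (rev (list_of_vec (sing_vals X)))" unfolding e by simp
  have "length (list_of_vec (sing_vals X)) = n" using arg_cong[OF m, of size] by simp
  then show "sing_vals X \<in> carrier_vec n" by (intro carrier_vecI) simp
qed

text \<open>The eigenvalues of $X X^T$ are nonnegative as $p^T X X^T p = |X^T p|^2$. The eigenvectors are
  reordered along the permutation that sorts the singular values.\<close>

lemma left_singular_vectors:
  assumes X: "X \<in> carrier_mat n m"
  obtains a where
    "\<And>i j. i < n \<Longrightarrow> j < n \<Longrightarrow> (\<Sum>k<n. a i k * a j k) = (if i = j then 1 else 0 :: real)"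
    "\<And>i k. i < n \<Longrightarrow> k < n \<Longrightarrow> (\<Sum>b<n. row_gram m X k b * a i b) = (sing_vals X $ i)\<^sup>2 * a i k"
    "sing_vals X \<in> carrier_vec n"
    "\<And>i j. i \<le> j \<Longrightarrow> j < n \<Longrightarrow> sing_vals X $ j \<le> sing_vals X $ i"
    "\<And>i. i < n \<Longrightarrow> 0 \<le> sing_vals X $ i"
proof -
  obtain p l where orth: "\<And>i j. i < n \<Longrightarrow> j < n \<Longrightarrow> (\<Sum>a<n. p i a * p j a) = (if i = j then 1 else 0 :: real)"
    and eig: "\<And>i a. i < n \<Longrightarrow> a < n \<Longrightarrow> (\<Sum>b<n. row_gram m X a b * p i b) = l i * p i a"
    using symmetric_orthonormal_eigenvectors[of "row_gram m X" n n, OF row_gram_sym] by blast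
  have l0: "0 \<le> l i" if i: "i < n" for i
  proof -
    have "l i = (\<Sum>a<n. l i * (p i a * p i a))"
      using orth[OF i i] by (simp add: sum_distrib_left[symmetric])
    also have "\<dots> = (\<Sum>a<n. p i a * (\<Sum>b<n. row_gram m X a b * p i b))"
      using eig[OF i] by (intro sum.cong) (auto simp: mult_ac)
    also have "\<dots> = (\<Sum>a<n. \<Sum>b<n. \<Sum>k<m. (X $$ (a, k) * p i a) * (X $$ (b, k) * p i b))"
      by (simp add: row_gram_def sum_distrib_left sum_distrib_right mult_ac)
    also have "\<dots> = (\<Sum>a<n. \<Sum>k<m. \<Sum>b<n. (X $$ (a, k) * p i a) * (X $$ (b, k) * p i b))"
      by (intro sum.cong refl sum.swap)
    also have "\<dots> = (\<Sum>k<m. \<Sum>a<n. \<Sum>b<n. (X $$ (a, k) * p i a) * (X $$ (b, k) * p i b))"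
      by (rule sum.swap)
    also have "\<dots> = (\<Sum>k<m. (\<Sum>a<n. X $$ (a, k) * p i a)\<^sup>2)"
      by (simp add: power2_eq_square sum_product)
    finally show ?thesis by (simp add: sum_nonneg)
  qed
  let ?s = "list_of_vec (sing_vals X)"
  have m: "mset ?s = mset (map (\<lambda>i. sqrt (l i)) [0..<n])" by (rule mset_sing_vals[OF X orth eig])
  have c: "sing_vals X \<in> carrier_vec n" by (rule sing_vals_carrier[OF X orth eig])
  obtain q where q: "q permutes {..<n}" "permute_list q (map (\<lambda>i. sqrt (l i)) [0..<n]) = ?s"
    using mset_eq_permutation[OF m] by auto
  have qn: "q i < n" if "i < n" for i using permutes_in_image[OF q(1), of i] that by simp
  have s: "sing_vals X $ i = sqrt (l (q i))" if "i < n" for i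
  proof -
    have "sing_vals X $ i = ?s ! i" using that c by (simp add: list_of_vec_index)
    also have "\<dots> = sqrt (l (q i))" using that qn unfolding q(2)[symmetric]
      by (subst permute_list_nth) (use q(1) in auto)
    finally show ?thesis .
  qed
  have inj: "q i = q j \<longleftrightarrow> i = j" for i j using permutes_inj[OF q(1)] by (auto dest: injD)
  show ?thesis
  proof (rule that[of "\<lambda>i. p (q i)"])
    show "(\<Sum>k<n. p (q i) k * p (q j) k) = (if i = j then 1 else 0)" if "i < n" "j < n" for i j
      using orth[OF qn qn] that inj by simp
    show "(\<Sum>b<n. row_gram m X k b * p (q i) b) = (sing_vals X $ i)\<^sup>2 * p (q i) k" if "i < n" "k < n" for i k
      using eig[OF qn that(2)] that s l0[OF qn] by simp
    show "sing_vals X \<in> carrier_vec n" by (rule c)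
    show "0 \<le> sing_vals X $ i" if "i < n" for i using s[OF that] l0[OF qn[OF that]] by simp
    show "sing_vals X $ j \<le> sing_vals X $ i" if "i \<le> j" "j < n" for i j
    proof -
      have "sorted_wrt (\<ge>) ?s"
        using sorted_sing_vals[OF X orth eig] by (simp add: sorted_wrt_rev)
      then have "?s ! j \<le> ?s ! i" using that c
        by (cases "i = j") (auto simp: sorted_wrt_iff_nth_less)
      then show ?thesis using that c by (simp add: list_of_vec_index)
    qed
  qed
qed

section \<open>The von Neumann trace inequality\<close>

text \<open>Summation by parts writes the difference of the two sides as a combination of the differences of
  partial sums with the nonnegative weights \<open>x k - x (k + 1)\<close> and \<open>x (n - 1)\<close>.\<close>

lemma abel_sum_le:
  fixes x c d :: "nat \<Rightarrow> real"
  assumes dec: "\<And>i j. i \<le> j \<Longrightarrow> j < n \<Longrightarrow> x j \<le> x i"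
    and nonneg: "\<And>i. i < n \<Longrightarrow> 0 \<le> x i"
    and part: "\<And>k. k \<le> n \<Longrightarrow> (\<Sum>i<k. c i) \<le> (\<Sum>i<k. d i)"
  shows "(\<Sum>i<n. x i * c i) \<le> (\<Sum>i<n. x i * d i)"
proof -
  define e where "e i = d i - c i" for i
  have E: "0 \<le> (\<Sum>i<k. e i)" if "k \<le> n" for k
    using part[OF that] by (simp add: e_def sum_subtractf)
  have step: "Suc k \<le> n \<Longrightarrow> x k * (\<Sum>i<Suc k. e i) \<le> (\<Sum>i<Suc k. x i * e i)" for k
  proof (induction k)
    case (Suc k)
    have "x (Suc k) * (\<Sum>i<Suc k. e i) \<le> x k * (\<Sum>i<Suc k. e i)"
      using Suc.prems by (intro mult_right_mono dec E) auto
    also have "\<dots> \<le> (\<Sum>i<Suc k. x i * e i)" using Suc by simp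
    finally show ?case by (simp add: distrib_left)
  qed simp
  have "0 \<le> (\<Sum>i<n. x i * e i)"
  proof (cases n)
    case (Suc k)
    then have "0 \<le> x k * (\<Sum>i<Suc k. e i)" using nonneg[of k] E[of n] by simp
    then show ?thesis using step[of k] Suc by simp
  qed simp
  then show ?thesis by (simp add: e_def right_diff_distrib sum_subtractf)
qed

text \<open>By summation by parts in both variables only indicator vectors of initial segments need to be
  compared, and a \<open>k\<close> by \<open>l\<close> block of \<open>W\<close> has sum at most \<open>min k l\<close>.\<close>

lemma substochastic_sum_le:
  fixes W :: "nat \<Rightarrow> nat \<Rightarrow> real"
  assumes W: "\<And>i j. 0 \<le> W i j"
    and row: "\<And>i. i < n \<Longrightarrow> (\<Sum>j<n. W i j) \<le> 1" and col: "\<And>j. j < n \<Longrightarrow> (\<Sum>i<n. W i j) \<le> 1"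
    and x: "\<And>i j. i \<le> j \<Longrightarrow> j < n \<Longrightarrow> x j \<le> x i" "\<And>i. i < n \<Longrightarrow> 0 \<le> x i"
    and y: "\<And>i j. i \<le> j \<Longrightarrow> j < n \<Longrightarrow> y j \<le> y i" "\<And>i. i < n \<Longrightarrow> 0 \<le> y i"
  shows "(\<Sum>i<n. x i * (\<Sum>j<n. W i j * y j)) \<le> (\<Sum>i<n. x i * y i)"
proof (rule abel_sum_le[OF x])
  fix k assume k: "k \<le> n"
  have "(\<Sum>i<k. \<Sum>j<n. W i j * y j) = (\<Sum>j<n. y j * (\<Sum>i<k. W i j))"
    by (subst sum.swap) (simp add: sum_distrib_left mult.commute)
  also have "\<dots> \<le> (\<Sum>j<n. y j * (if j < k then 1 else 0))"
  proof (rule abel_sum_le[OF y])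
    fix l assume l: "l \<le> n"
    have "(\<Sum>i<k. W i j) \<le> 1" if "j < n" for j
      using col[OF that] sum_mono2[of "{..<n}" "{..<k}" "\<lambda>i. W i j"] W k by force
    then have "(\<Sum>j<l. \<Sum>i<k. W i j) \<le> (\<Sum>j<l. 1)" using l by (intro sum_mono) auto
    moreover have "(\<Sum>j<l. \<Sum>i<k. W i j) \<le> (\<Sum>i<k. 1)"
    proof (subst sum.swap, intro sum_mono)
      fix i assume "i \<in> {..<k}"
      then show "(\<Sum>j<l. W i j) \<le> 1"
        using row[of i] sum_mono2[of "{..<n}" "{..<l}" "W i"] W k l by force
    qed
    moreover have "(\<Sum>j<l. if j < k then 1 else 0 :: real) = real (min l k)"
    proof -
      have "{..<l} \<inter> {j. j < k} = {..<min l k}" by auto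
      then show ?thesis by (simp add: sum.If_cases)
    qed
    ultimately show "(\<Sum>j<l. \<Sum>i<k. W i j) \<le> (\<Sum>j<l. if j < k then 1 else 0)" by simp
  qed
  also have "\<dots> = (\<Sum>i<k. y i)"
  proof -
    have "{..<n} \<inter> {j. j < k} = {..<k}" using k by auto
    then show ?thesis by (simp add: mult_delta_right if_distrib sum.If_cases)
  qed
  finally show "(\<Sum>i<k. \<Sum>j<n. W i j * y j) \<le> (\<Sum>i<k. y i)" .
qed

text \<open>The bilinear form $p^T X q$.\<close>

definition pairing :: "nat \<Rightarrow> nat \<Rightarrow> real mat \<Rightarrow> (nat \<Rightarrow> real) \<Rightarrow> (nat \<Rightarrow> real) \<Rightarrow> real" where
  "pairing n m X p q = (\<Sum>a<n. \<Sum>b<m. X $$ (a, b) * (p a * q b))"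

lemma mat_inner_sum:
  assumes "X \<in> carrier_mat n m" "Y \<in> carrier_mat n m"
  shows "mat_inner X Y = (\<Sum>a<n. \<Sum>b<m. X $$ (a, b) * Y $$ (a, b))"
proof -
  have "mat_inner X Y = (\<Sum>b<m. \<Sum>a<n. X $$ (a, b) * Y $$ (a, b))"
    using assms unfolding mat_inner_def mat_trace_def
    by (intro sum.cong) (auto simp: scalar_prod_def lessThan_atLeast0)
  also have "\<dots> = (\<Sum>a<n. \<Sum>b<m. X $$ (a, b) * Y $$ (a, b))" by (rule sum.swap)
  finally show ?thesis .
qed

lemma sum_outer_carrier [simp]: "sum_outer n m x u v \<in> carrier_mat n m"
  by (simp add: sum_outer_def)

lemma mat_inner_sum_outer:
  assumes X: "X \<in> carrier_mat n m"
  shows "mat_inner X (sum_outer n m x u v) = (\<Sum>i<n. x $ i * pairing n m X (\<lambda>a. u i $ a) (\<lambda>b. v i $ b))"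
proof -
  have "mat_inner X (sum_outer n m x u v)
      = (\<Sum>a<n. \<Sum>b<m. \<Sum>i<n. x $ i * (X $$ (a, b) * (u i $ a * v i $ b)))"
    unfolding mat_inner_sum[OF X sum_outer_carrier]
    by (intro sum.cong refl) (simp add: sum_outer_def sum_distrib_left mult_ac)
  also have "\<dots> = (\<Sum>a<n. \<Sum>i<n. \<Sum>b<m. x $ i * (X $$ (a, b) * (u i $ a * v i $ b)))"
    by (intro sum.cong refl sum.swap)
  also have "\<dots> = (\<Sum>i<n. \<Sum>a<n. \<Sum>b<m. x $ i * (X $$ (a, b) * (u i $ a * v i $ b)))"
    by (rule sum.swap)
  finally show ?thesis by (simp add: pairing_def sum_distrib_left)
qed

lemma orthonormal_sum:
  assumes "orthonormal_family d k u" "i < k" "j < k"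
  shows "(\<Sum>a<d. u i $ a * u j $ a) = (if i = j then 1 else 0)"
  using assms unfolding orthonormal_family_def scalar_prod_def lessThan_atLeast0
  by (metis carrier_vecD)

text \<open>A singular value decomposition without normalization of the right singular vectors: \<open>c i\<close> is
  $X^T a_i$, of length \<open>sing_vals X $ i\<close>. No choice is needed when a singular value vanishes.\<close>

lemma singular_system:
  assumes X: "X \<in> carrier_mat n m"
  obtains a c where
    "\<And>i j. i < n \<Longrightarrow> j < n \<Longrightarrow> (\<Sum>k<n. a i k * a j k) = (if i = j then 1 else 0 :: real)"
    "\<And>i j. i < n \<Longrightarrow> j < n \<Longrightarrow>
      (\<Sum>b<m. c i b * c j b) = (sing_vals X $ j)\<^sup>2 * (if i = j then 1 else 0)"
    "\<And>k b. k < n \<Longrightarrow> b < m \<Longrightarrow> X $$ (k, b) = (\<Sum>i<n. a i k * c i b)"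
proof -
  obtain a where orth: "\<And>i j. i < n \<Longrightarrow> j < n \<Longrightarrow> (\<Sum>k<n. a i k * a j k) = (if i = j then 1 else 0 :: real)"
    and eig: "\<And>i k. i < n \<Longrightarrow> k < n \<Longrightarrow> (\<Sum>b<n. row_gram m X k b * a i b) = (sing_vals X $ i)\<^sup>2 * a i k"
    using left_singular_vectors[OF X] by metis
  define c where "c i b = (\<Sum>k<n. a i k * X $$ (k, b))" for i b
  have "(\<Sum>b<m. c i b * c j b) = (sing_vals X $ j)\<^sup>2 * (if i = j then 1 else 0)"
    if ij: "i < n" "j < n" for i j
  proof -
    have "(\<Sum>b<m. c i b * c j b) = (\<Sum>b<m. \<Sum>k<n. \<Sum>l<n. a i k * (X $$ (k, b) * X $$ (l, b) * a j l))"
      by (simp add: c_def sum_product mult_ac)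
    also have "\<dots> = (\<Sum>k<n. \<Sum>b<m. \<Sum>l<n. a i k * (X $$ (k, b) * X $$ (l, b) * a j l))"
      by (rule sum.swap)
    also have "\<dots> = (\<Sum>k<n. \<Sum>l<n. \<Sum>b<m. a i k * (X $$ (k, b) * X $$ (l, b) * a j l))"
      by (intro sum.cong refl sum.swap)
    also have "\<dots> = (\<Sum>k<n. a i k * (\<Sum>l<n. row_gram m X k l * a j l))"
      by (simp add: row_gram_def sum_distrib_left sum_distrib_right)
    also have "\<dots> = (\<Sum>k<n. (sing_vals X $ j)\<^sup>2 * (a i k * a j k))"
      using eig[OF ij(2)] by (intro sum.cong) auto
    finally show ?thesis by (simp add: sum_distrib_left[symmetric] orth[OF ij])
  qed
  moreover have "X $$ (k, b) = (\<Sum>i<n. a i k * c i b)" if "k < n" "b < m" for k b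
  proof -
    have "(\<Sum>i<n. a i k * c i b) = (\<Sum>i<n. \<Sum>l<n. X $$ (l, b) * (a i k * a i l))"
      by (simp add: c_def sum_distrib_left mult_ac)
    also have "\<dots> = (\<Sum>l<n. \<Sum>i<n. X $$ (l, b) * (a i k * a i l))" by (rule sum.swap)
    also have "\<dots> = (\<Sum>l<n. X $$ (l, b) * (if k = l then 1 else 0))"
      unfolding sum_distrib_left[symmetric]
      using orthonormal_complete[OF orth] that by (intro sum.cong refl arg_cong2[of _ _ _ _ "(*)"]) auto
    finally show ?thesis using that by (simp add: mult_delta_right)
  qed
  ultimately show ?thesis using that[OF orth] by blast
qed

lemma sing_vals_props:
  assumes "X \<in> carrier_mat n m"
  shows "sing_vals X \<in> carrier_vec n"
    and "i \<le> j \<Longrightarrow> j < n \<Longrightarrow> sing_vals X $ j \<le> sing_vals X $ i"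
    and "i < n \<Longrightarrow> 0 \<le> sing_vals X $ i"
  using left_singular_vectors[OF assms] by metis+

text \<open>Expanding $u_j$ in the left singular vectors of \<open>X\<close> turns the left-hand side into
  $\sum_{i,j} \sigma_i y_j p_{ij} q_{ij}$, where $p$ and $q$ contain the inner products of the left and
  of the normalized right vectors. Since $p_{ij} q_{ij} \le (p_{ij}^2 + q_{ij}^2)/2$ and the latter matrix is
  doubly substochastic by the Bessel inequality, the sum is at most the diagonal one.\<close>

theorem von_neumann_trace_inequality:
  assumes X: "X \<in> carrier_mat n m"
    and u: "orthonormal_family n n u" and v: "orthonormal_family m n v"
    and y: "\<And>i j. i \<le> j \<Longrightarrow> j < n \<Longrightarrow> y $ j \<le> y $ i" "\<And>i. i < n \<Longrightarrow> 0 \<le> y $ i"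
  shows "mat_inner X (sum_outer n m y u v) \<le> (\<Sum>i<n. sing_vals X $ i * y $ i)"
proof -
  obtain a c where orth: "\<And>i j. i < n \<Longrightarrow> j < n \<Longrightarrow> (\<Sum>k<n. a i k * a j k) = (if i = j then 1 else 0 :: real)"
    and c_orth': "\<And>i j. i < n \<Longrightarrow> j < n \<Longrightarrow>
      (\<Sum>b<m. c i b * c j b) = (sing_vals X $ j)\<^sup>2 * (if i = j then 1 else 0)"
    and X_eq: "\<And>k b. k < n \<Longrightarrow> b < m \<Longrightarrow> X $$ (k, b) = (\<Sum>i<n. a i k * c i b)"
    using singular_system[OF X] by blast
  note dec = sing_vals_props(2)[OF X] and nonneg = sing_vals_props(3)[OF X]
  define s where "s i = sing_vals X $ i" for i
  have c_orth: "(\<Sum>b<m. c i b * c j b) = (s j)\<^sup>2 * (if i = j then 1 else 0)" if "i < n" "j < n" for i j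
    using c_orth'[OF that] by (simp add: s_def)
  define I where "I = {i. i < n \<and> s i \<noteq> 0}"
  have fI: "finite I" by (simp add: I_def)
  define b where "b i k = c i k / s i" for i k
  have b_orth: "(\<Sum>k<m. b i k * b j k) = (if i = j then 1 else 0)" if "i \<in> I" "j \<in> I" for i j
  proof -
    have "(\<Sum>k<m. b i k * b j k) = (\<Sum>k<m. c i k * c j k) / (s i * s j)"
      by (simp add: b_def sum_divide_distrib)
    then show ?thesis using that c_orth[of i j] by (auto simp: I_def power2_eq_square)
  qed
  have c_zero: "c i k = 0" if "i < n" "s i = 0" "k < m" for i k
  proof -
    have "(\<Sum>b<m. c i b * c i b) = 0" using c_orth[of i i] that by simp
    then have "\<forall>b\<in>{..<m}. c i b * c i b = 0" by (subst (asm) sum_nonneg_eq_0_iff) auto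
    then show ?thesis using that by auto
  qed
  define p where "p i j = (\<Sum>k<n. a i k * u j $ k)" for i j
  define q where "q i j = (\<Sum>k<m. b i k * v j $ k)" for i j
  have pair: "pairing n m X (\<lambda>a. u j $ a) (\<lambda>b. v j $ b) = (\<Sum>i<n. p i j * (s i * q i j))" if j: "j < n" for j
  proof -
    have "p i j * (s i * q i j) = p i j * (\<Sum>k<m. c i k * v j $ k)" if "i < n" for i
      using c_zero[OF that] by (cases "s i = 0") (auto simp: q_def b_def sum_distrib_left)
    then have "(\<Sum>i<n. p i j * (s i * q i j)) = (\<Sum>i<n. p i j * (\<Sum>k<m. c i k * v j $ k))"
      by (intro sum.cong) auto
    also have "\<dots> = (\<Sum>i<n. \<Sum>l<n. \<Sum>k<m. a i l * c i k * (u j $ l * v j $ k))"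
      by (simp add: p_def sum_product mult_ac)
    also have "\<dots> = (\<Sum>l<n. \<Sum>i<n. \<Sum>k<m. a i l * c i k * (u j $ l * v j $ k))"
      by (rule sum.swap)
    also have "\<dots> = (\<Sum>l<n. \<Sum>k<m. \<Sum>i<n. a i l * c i k * (u j $ l * v j $ k))"
      by (intro sum.cong refl sum.swap)
    also have "\<dots> = pairing n m X (\<lambda>a. u j $ a) (\<lambda>b. v j $ b)"
      unfolding pairing_def by (intro sum.cong refl) (simp add: X_eq sum_distrib_right)
    finally show ?thesis by simp
  qed
  define W where "W i j = (if s i = 0 then 0 else ((p i j)\<^sup>2 + (q i j)\<^sup>2) / 2)" for i j
  have "mat_inner X (sum_outer n m y u v) = (\<Sum>j<n. \<Sum>i<n. y $ j * (p i j * (s i * q i j)))"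
    unfolding mat_inner_sum_outer[OF X] by (simp add: pair sum_distrib_left)
  also have "\<dots> \<le> (\<Sum>j<n. \<Sum>i<n. y $ j * (s i * W i j))"
  proof (intro sum_mono mult_left_mono)
    fix i j assume "i \<in> {..<n}" "j \<in> {..<n}"
    have "p i j * q i j \<le> ((p i j)\<^sup>2 + (q i j)\<^sup>2) / 2"
      using sum_squares_bound[of "p i j" "q i j"] by simp
    then have "s i * (p i j * q i j) \<le> s i * (((p i j)\<^sup>2 + (q i j)\<^sup>2) / 2)"
      using nonneg[of i] \<open>i \<in> _\<close> by (intro mult_left_mono) (auto simp: s_def)
    then show "p i j * (s i * q i j) \<le> s i * W i j"
      by (cases "s i = 0") (simp_all add: W_def mult_ac)
    show "0 \<le> y $ j" using y \<open>j \<in> _\<close> by simp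
  qed
  also have "\<dots> = (\<Sum>i<n. \<Sum>j<n. y $ j * (s i * W i j))" by (rule sum.swap)
  also have "\<dots> = (\<Sum>i<n. s i * (\<Sum>j<n. W i j * y $ j))" by (simp add: sum_distrib_left mult_ac)
  also have "\<dots> \<le> (\<Sum>i<n. s i * y $ i)"
  proof (rule substochastic_sum_le)
    show "0 \<le> W i j" for i j by (simp add: W_def)
    have u_orth: "\<And>i j. i \<in> {..<n} \<Longrightarrow> j \<in> {..<n} \<Longrightarrow> (\<Sum>k<n. u i $ k * u j $ k) = (if i = j then 1 else 0)"
      using orthonormal_sum[OF u] by simp
    have v_orth: "\<And>i j. i \<in> {..<n} \<Longrightarrow> j \<in> {..<n} \<Longrightarrow> (\<Sum>k<m. v i $ k * v j $ k) = (if i = j then 1 else 0)"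
      using orthonormal_sum[OF v] by simp
    show "(\<Sum>j<n. W i j) \<le> 1" if i: "i < n" for i
    proof (cases "s i = 0")
      case False
      have "(\<Sum>j<n. (p i j)\<^sup>2) \<le> (\<Sum>k<n. (a i k)\<^sup>2)"
        using bessel[of "{..<n}" "{..<n}" "\<lambda>j k. u j $ k" "a i"] u_orth by (simp add: p_def mult.commute)
      moreover have "(\<Sum>k<n. (a i k)\<^sup>2) = 1" using orth[OF i i] by (simp add: power2_eq_square)
      moreover have "(\<Sum>j<n. (q i j)\<^sup>2) \<le> (\<Sum>k<m. (b i k)\<^sup>2)"
        using bessel[of "{..<m}" "{..<n}" "\<lambda>j k. v j $ k" "b i"] v_orth by (simp add: q_def mult.commute)
      moreover have "(\<Sum>k<m. (b i k)\<^sup>2) = 1" using b_orth[of i i] i False by (simp add: power2_eq_square I_def)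
      ultimately show ?thesis using False by (simp add: W_def sum_divide_distrib[symmetric] sum.distrib)
    qed (simp add: W_def)
    show "(\<Sum>i<n. W i j) \<le> 1" if j: "j < n" for j
    proof -
      have "(\<Sum>i<n. W i j) = (\<Sum>i\<in>I. W i j)"
        by (rule sum.mono_neutral_right) (auto simp: I_def W_def)
      also have "\<dots> = ((\<Sum>i\<in>I. (p i j)\<^sup>2) + (\<Sum>i\<in>I. (q i j)\<^sup>2)) / 2"
        unfolding sum.distrib[symmetric] sum_divide_distrib by (intro sum.cong) (auto simp: I_def W_def)
      finally have e: "(\<Sum>i<n. W i j) = \<dots>" .
      have "(\<Sum>i\<in>I. (p i j)\<^sup>2) \<le> (\<Sum>k<n. (u j $ k)\<^sup>2)"
        unfolding p_def using orth by (intro bessel fI) (auto simp: I_def)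
      moreover have "(\<Sum>k<n. (u j $ k)\<^sup>2) = 1" using u_orth[of j j] j by (simp add: power2_eq_square)
      moreover have "(\<Sum>i\<in>I. (q i j)\<^sup>2) \<le> (\<Sum>k<m. (v j $ k)\<^sup>2)"
        unfolding q_def using b_orth by (intro bessel fI) auto
      moreover have "(\<Sum>k<m. (v j $ k)\<^sup>2) = 1" using v_orth[of j j] j by (simp add: power2_eq_square)
      ultimately show ?thesis unfolding e by simp
    qed
  qed (use dec nonneg y in \<open>auto simp: s_def\<close>)
  finally show ?thesis by (simp add: s_def)
qed

section \<open>Rank and singular values\<close>

lemma (in vec_space) card_le_rank:
  assumes A: "A \<in> carrier_mat n nc" and U: "U \<subseteq> span (set (cols A))" "lin_indpt U"
  shows "card U \<le> rank A"
proof -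
  have c: "set (cols A) \<subseteq> carrier_vec n" using cols_dim A by blast
  have sub: "submodule class_ring (span (set (cols A))) V" by (rule span_is_submodule) (simp add: c)
  interpret W: vectorspace class_ring "span_vs (set (cols A))"
    using c by (intro span_is_subspace[THEN subspace_is_vs]) simp
  have "W.fin_dim" by (rule fin_dim_span_cols[OF A])
  moreover have "W.lin_indpt U" using span_li_not_depend(2)[OF U(1) sub] U(2) by simp
  ultimately show ?thesis unfolding rank_def using U(1) by (intro W.li_le_dim) auto
qed

lemma orthonormal_lin_indpt:
  fixes a :: "nat \<Rightarrow> real vec"
  assumes I: "finite I" and c: "\<And>i. i \<in> I \<Longrightarrow> a i \<in> carrier_vec n"
    and orth: "\<And>i j. i \<in> I \<Longrightarrow> j \<in> I \<Longrightarrow> (\<Sum>k<n. a i $ k * a j $ k) = (if i = j then 1 else 0)"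
  shows "module.lin_indpt class_ring (module_vec TYPE(real) n) (a ` I)" and "card (a ` I) = card I"
proof -
  interpret vec_space "TYPE(real)" n .
  have inj: "inj_on a I"
  proof (rule inj_onI)
    fix i j assume "i \<in> I" "j \<in> I" "a i = a j"
    then show "i = j" using orth[of i j] orth[of i i] by (auto split: if_splits)
  qed
  then show "card (a ` I) = card I" by (rule card_image)
  show "lin_indpt (a ` I)"
  proof (rule finite_lin_indpt2)
    show "finite (a ` I)" using I by simp
    show "a ` I \<subseteq> carrier_vec n" using c by auto
    fix f assume lc: "lincomb f (a ` I) = 0\<^sub>v n"
    show "\<forall>v\<in>a ` I. f v = 0"
    proof
      fix v assume "v \<in> a ` I"
      then obtain j where j: "j \<in> I" "v = a j" by auto
      have "(\<Sum>i\<in>I. f (a i) * a i $ k) = 0" if "k < n" for k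
      proof -
        have "lincomb f (a ` I) $ k = (\<Sum>x\<in>a ` I. f x * x $ k)"
          using that c by (intro lincomb_index) auto
        then show ?thesis using lc that by (simp add: sum.reindex[OF inj])
      qed
      then have "0 = (\<Sum>k<n. (\<Sum>i\<in>I. f (a i) * a i $ k) * a j $ k)" by simp
      also have "\<dots> = (\<Sum>k<n. \<Sum>i\<in>I. f (a i) * (a i $ k * a j $ k))"
        by (simp add: sum_distrib_right mult.assoc)
      also have "\<dots> = (\<Sum>i\<in>I. \<Sum>k<n. f (a i) * (a i $ k * a j $ k))" by (rule sum.swap)
      also have "\<dots> = (\<Sum>i\<in>I. f (a i) * (if i = j then 1 else 0))"
        using j orth by (intro sum.cong refl) (simp add: sum_distrib_left[symmetric])
      also have "\<dots> = f (a j)" using I j by (simp add: mult_delta_right)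
      finally show "f v = 0" using j by (simp add: class_ring_simps)
    qed
  qed
qed

text \<open>The left singular vectors with nonzero singular value are orthonormal and lie in the column space.\<close>

lemma sing_vals_zero_beyond_rank:
  assumes X: "X \<in> carrier_mat n m" and rank: "vec_space.rank n X \<le> r" and i: "r \<le> i" "i < n"
  shows "sing_vals X $ i = 0"
proof (rule ccontr)
  assume nz: "sing_vals X $ i \<noteq> 0"
  interpret vec_space "TYPE(real)" n .
  obtain a c where orth: "\<And>i j. i < n \<Longrightarrow> j < n \<Longrightarrow> (\<Sum>k<n. a i k * a j k) = (if i = j then 1 else 0 :: real)"
    and c_orth: "\<And>i j. i < n \<Longrightarrow> j < n \<Longrightarrow>
      (\<Sum>b<m. c i b * c j b) = (sing_vals X $ j)\<^sup>2 * (if i = j then 1 else 0)"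
    and X_eq: "\<And>k b. k < n \<Longrightarrow> b < m \<Longrightarrow> X $$ (k, b) = (\<Sum>i<n. a i k * c i b)"
    using singular_system[OF X] by blast
  let ?a = "\<lambda>j. vec n (a j)"
  have pos: "sing_vals X $ j \<noteq> 0" if "j \<le> i" for j
    using sing_vals_props(2)[OF X that i(2)] sing_vals_props(3)[OF X i(2)] nz by simp
  have "?a j \<in> span (set (cols X))" if j: "j \<le> i" for j
  proof -
    have jn: "j < n" using j i by simp
    let ?w = "vec m (\<lambda>b. c j b / (sing_vals X $ j)\<^sup>2)"
    have "X *\<^sub>v ?w = ?a j"
    proof (rule eq_vecI)
      fix k assume "k < dim_vec (?a j)"
      then have k: "k < n" by simp
      have "(X *\<^sub>v ?w) $ k = (\<Sum>b<m. X $$ (k, b) * (c j b / (sing_vals X $ j)\<^sup>2))"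
        using k X by (simp add: scalar_prod_def lessThan_atLeast0)
      also have "\<dots> = (\<Sum>b<m. \<Sum>l<n. a l k * (c l b * c j b) / (sing_vals X $ j)\<^sup>2)"
        using k by (simp add: X_eq sum_distrib_right sum_divide_distrib mult.assoc)
      also have "\<dots> = (\<Sum>l<n. \<Sum>b<m. a l k * (c l b * c j b) / (sing_vals X $ j)\<^sup>2)" by (rule sum.swap)
      also have "\<dots> = (\<Sum>l<n. a l k * ((sing_vals X $ j)\<^sup>2 * (if l = j then 1 else 0)) / (sing_vals X $ j)\<^sup>2)"
        using jn by (simp add: sum_distrib_left[symmetric] sum_divide_distrib[symmetric] c_orth)
      also have "\<dots> = (\<Sum>l<n. if l = j then a l k else 0)"
        using pos[OF j] by (intro sum.cong) auto
      also have "\<dots> = a j k" using jn by simp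
      finally show "(X *\<^sub>v ?w) $ k = ?a j $ k" using k by simp
    qed (use X in auto)
    then have "?a j \<in> col_space X" using X by (auto simp: col_space_eq[OF X])
    then show ?thesis by (simp add: col_space_def)
  qed
  then have "?a ` {..i} \<subseteq> span (set (cols X))" by auto
  moreover have "lin_indpt (?a ` {..i})" "card (?a ` {..i}) = card {..i}"
    using orth i by (intro orthonormal_lin_indpt[where n = n]; simp)+
  ultimately have "Suc i \<le> rank X" using card_le_rank[OF X, of "?a ` {..i}"] by simp
  then show False using rank i by simp
qed

text \<open>The columns are combinations of $u_1, \dots, u_r$.\<close>

lemma rank_sum_outer_le:
  assumes u: "orthonormal_family n n u" and r: "r \<le> n"
    and x: "\<And>i. r \<le> i \<Longrightarrow> i < n \<Longrightarrow> x $ i = 0"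
  shows "vec_space.rank n (sum_outer n m x u v) \<le> r"
proof -
  interpret vec_space "TYPE(real)" n .
  let ?X = "sum_outer n m x u v"
  define A where "A = mat n r (\<lambda>(a, i). u i $ a)"
  have A: "A \<in> carrier_mat n r" by (simp add: A_def)
  have "col ?X b \<in> span (set (cols A))" if b: "b < m" for b
  proof -
    have "A *\<^sub>v vec r (\<lambda>i. x $ i * v i $ b) = col ?X b"
    proof (rule eq_vecI)
      fix a assume "a < dim_vec (col ?X b)"
      then have a: "a < n" by (simp add: sum_outer_def)
      have "(\<Sum>i<n. x $ i * u i $ a * v i $ b) = (\<Sum>i<r. x $ i * u i $ a * v i $ b)"
        using r x by (intro sum.mono_neutral_right) auto
      then show "(A *\<^sub>v vec r (\<lambda>i. x $ i * v i $ b)) $ a = col ?X b $ a"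
        using a b by (simp add: A_def sum_outer_def scalar_prod_def lessThan_atLeast0 mult_ac)
    qed (simp_all add: A_def sum_outer_def)
    moreover have "col ?X b \<in> carrier_vec n" by (auto simp: sum_outer_def intro!: carrier_vecI)
    ultimately have "col ?X b \<in> col_space A" using A
      by (auto simp: col_space_eq[OF A] intro!: bexI[of _ "vec r (\<lambda>i. x $ i * v i $ b)"])
    then show ?thesis by (simp add: col_space_def)
  qed
  then have cols: "set (cols ?X) \<subseteq> span (set (cols A))" by (auto simp: cols_def sum_outer_def)
  obtain S where S: "maximal S (\<lambda>T. T \<subseteq> set (cols ?X) \<and> lin_indpt T)"
    using maximal_exists_superset[of "set (cols ?X)" "\<lambda>T. T \<subseteq> set (cols ?X) \<and> lin_indpt T" "{}"]
    by (auto simp: lin_dep_def)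
  have "rank ?X = card S" by (rule rank_card_indpt[OF sum_outer_carrier S])
  also have "\<dots> \<le> rank A" using S cols by (intro card_le_rank[OF A]) (auto simp: maximal_def)
  also have "\<dots> \<le> r" by (rule rank_le_nc[OF A])
  finally show ?thesis .
qed

lemma pairing_sum_outer:
  assumes u: "orthonormal_family n n u" and v: "orthonormal_family m n v" and i: "i < n"
  shows "pairing n m (sum_outer n m x u v) (\<lambda>a. u i $ a) (\<lambda>b. v i $ b) = x $ i"
proof -
  have "pairing n m (sum_outer n m x u v) (\<lambda>a. u i $ a) (\<lambda>b. v i $ b)
     = (\<Sum>a<n. \<Sum>b<m. \<Sum>j<n. x $ j * ((u j $ a * u i $ a) * (v j $ b * v i $ b)))"
    unfolding pairing_def
    by (intro sum.cong refl) (simp add: sum_outer_def sum_distrib_right sum_distrib_left mult_ac)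
  also have "\<dots> = (\<Sum>a<n. \<Sum>j<n. \<Sum>b<m. x $ j * ((u j $ a * u i $ a) * (v j $ b * v i $ b)))"
    by (intro sum.cong refl sum.swap)
  also have "\<dots> = (\<Sum>j<n. \<Sum>a<n. \<Sum>b<m. x $ j * ((u j $ a * u i $ a) * (v j $ b * v i $ b)))"
    by (rule sum.swap)
  also have "\<dots> = (\<Sum>j<n. x $ j * ((\<Sum>a<n. u j $ a * u i $ a) * (\<Sum>b<m. v j $ b * v i $ b)))"
    by (simp only: sum_product) (simp only: sum_distrib_left)
  also have "\<dots> = (\<Sum>j<n. if j = i then x $ j else 0)"
    using orthonormal_sum[OF u _ i] orthonormal_sum[OF v _ i] by (intro sum.cong) auto
  finally show ?thesis using i by simp
qed

text \<open>The vectors $u_i$ are eigenvectors of $X X^T$ with eigenvalues $x_i^2$, so the singular values are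
  the $|x_i|$ in some order, which a symmetric gauge does not see.\<close>

lemma (in symmetric_gauge) gauge_norm_sum_outer:
  assumes u: "orthonormal_family n n u" and v: "orthonormal_family m n v" and x: "x \<in> carrier_vec n"
  shows "gauge_norm g (sum_outer n m x u v) = g x"
proof -
  let ?X = "sum_outer n m x u v"
  have eig: "(\<Sum>b<n. row_gram m ?X a b * u i $ b) = (x $ i)\<^sup>2 * u i $ a" if ia: "i < n" "a < n" for i a
  proof -
    have "(\<Sum>b<n. row_gram m ?X a b * u i $ b) = (\<Sum>b<n. \<Sum>k<m. ?X $$ (a, k) * (?X $$ (b, k) * u i $ b))"
      by (simp add: row_gram_def sum_distrib_right mult.assoc)
    also have "\<dots> = (\<Sum>k<m. ?X $$ (a, k) * (\<Sum>b<n. ?X $$ (b, k) * u i $ b))"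
      by (subst sum.swap) (simp add: sum_distrib_left)
    also have "\<dots> = (\<Sum>k<m. ?X $$ (a, k) * (x $ i * v i $ k))"
    proof (intro sum.cong refl arg_cong2[of _ _ _ _ "(*)"])
      fix k assume "k \<in> {..<m}"
      then have "(\<Sum>b<n. ?X $$ (b, k) * u i $ b) = (\<Sum>b<n. \<Sum>j<n. x $ j * v j $ k * (u j $ b * u i $ b))"
        by (intro sum.cong refl) (simp add: sum_outer_def sum_distrib_right sum_distrib_left mult_ac)
      also have "\<dots> = (\<Sum>j<n. x $ j * v j $ k * (\<Sum>b<n. u j $ b * u i $ b))"
        by (subst sum.swap) (simp add: sum_distrib_left)
      also have "\<dots> = (\<Sum>j<n. if j = i then x $ j * v j $ k else 0)"
        using orthonormal_sum[OF u _ ia(1)] by (intro sum.cong) auto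
      finally show "(\<Sum>b<n. ?X $$ (b, k) * u i $ b) = x $ i * v i $ k" using ia by simp
    qed
    also have "\<dots> = (\<Sum>k<m. \<Sum>j<n. x $ i * x $ j * u j $ a * (v j $ k * v i $ k))"
      using ia by (intro sum.cong refl) (simp add: sum_outer_def sum_distrib_right sum_distrib_left mult_ac)
    also have "\<dots> = (\<Sum>j<n. x $ i * x $ j * u j $ a * (\<Sum>k<m. v j $ k * v i $ k))"
      by (subst sum.swap) (simp add: sum_distrib_left)
    also have "\<dots> = (\<Sum>j<n. if j = i then x $ i * x $ j * u j $ a else 0)"
      using orthonormal_sum[OF v _ ia(1)] by (intro sum.cong) auto
    finally show ?thesis using ia by (simp add: power2_eq_square)
  qed
  note facts = sum_outer_carrier[of n m x u v] orthonormal_sum[OF u] eig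
  let ?s = "list_of_vec (sing_vals ?X)"
  have m: "mset ?s = mset (map (\<lambda>i. sqrt ((x $ i)\<^sup>2)) [0..<n])" by (rule mset_sing_vals[OF facts])
  have c: "sing_vals ?X \<in> carrier_vec n" by (rule sing_vals_carrier[OF facts])
  obtain q where q: "q permutes {..<n}" "permute_list q (map (\<lambda>i. sqrt ((x $ i)\<^sup>2)) [0..<n]) = ?s"
    using mset_eq_permutation[OF m] by auto
  have "sing_vals ?X = vec n (\<lambda>i. map_vec abs x $ q i)"
  proof (rule eq_vecI)
    fix i assume "i < dim_vec (vec n (\<lambda>i. map_vec abs x $ q i))"
    then have i: "i < n" "q i < n" using permutes_in_image[OF q(1), of i] by auto
    have "sing_vals ?X $ i = ?s ! i" using i c by (simp add: list_of_vec_index)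
    also have "\<dots> = \<bar>x $ q i\<bar>" using i unfolding q(2)[symmetric]
      by (subst permute_list_nth) (use q(1) in auto)
    finally show "sing_vals ?X $ i = vec n (\<lambda>i. map_vec abs x $ q i) $ i" using i x by simp
  qed (use c in auto)
  then show ?thesis
    using g_permute[of "map_vec abs x" q] g_abs[OF x] x q(1) unfolding gauge_norm_def
    by (simp add: lessThan_atLeast0)
qed

section \<open>The rank constrained dual norm\<close>

lemma frob_norm_sq:
  assumes "A \<in> carrier_mat n m"
  shows "(frob_norm A)\<^sup>2 = (\<Sum>a<n. \<Sum>b<m. (A $$ (a, b))\<^sup>2)"
  using mat_inner_sum[OF assms assms] unfolding frob_norm_def
  by (simp add: power2_eq_square sum_nonneg)

lemma frob_norm_midpoint:
  assumes A: "A \<in> carrier_mat n m" and B: "B \<in> carrier_mat n m" and C: "C \<in> carrier_mat n m"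
  shows "(frob_norm ((1/2) \<cdot>\<^sub>m (A + B) - C))\<^sup>2
    = (frob_norm (A - C))\<^sup>2 / 2 + (frob_norm (B - C))\<^sup>2 / 2 - (frob_norm (A - B))\<^sup>2 / 4"
proof -
  have c: "(1/2) \<cdot>\<^sub>m (A + B) - C \<in> carrier_mat n m" "A - C \<in> carrier_mat n m"
    "B - C \<in> carrier_mat n m" "A - B \<in> carrier_mat n m"
    using minus_carrier_mat[OF C] minus_carrier_mat[OF B] by blast+
  show ?thesis
    unfolding c[THEN frob_norm_sq] sum_divide_distrib sum.distrib[symmetric] sum_subtractf[symmetric]
    using A B C by (intro sum.cong refl) (simp add: power2_eq_square field_simps)
qed

lemma frob_norm_sq_sum_outer:
  assumes u: "orthonormal_family n n u" and v: "orthonormal_family m n v"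
  shows "(frob_norm (sum_outer n m x u v))\<^sup>2 = (\<Sum>i<n. (x $ i)\<^sup>2)"
proof -
  let ?X = "sum_outer n m x u v"
  have "mat_inner ?X ?X = (\<Sum>i<n. (x $ i)\<^sup>2)"
    unfolding mat_inner_sum_outer[OF sum_outer_carrier]
    by (simp add: pairing_sum_outer[OF u v] power2_eq_square)
  then show ?thesis by (simp add: frob_norm_def sum_nonneg)
qed

lemma sum_pairing_sq_le_frob:
  assumes u: "orthonormal_family n n u" and v: "orthonormal_family m n v" and A: "A \<in> carrier_mat n m"
  shows "(\<Sum>i<n. (pairing n m A (\<lambda>a. u i $ a) (\<lambda>b. v i $ b))\<^sup>2) \<le> (frob_norm A)\<^sup>2"
proof -
  let ?e = "\<lambda>i (a, b). u i $ a * v i $ b"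
  have orth: "(\<Sum>c\<in>{..<n} \<times> {..<m}. ?e i c * ?e j c) = (if i = j then 1 else 0)"
    if "i \<in> {..<n}" "j \<in> {..<n}" for i j
  proof -
    have "(\<Sum>c\<in>{..<n} \<times> {..<m}. ?e i c * ?e j c)
        = (\<Sum>a<n. \<Sum>b<m. (u i $ a * u j $ a) * (v i $ b * v j $ b))"
      by (simp add: sum.cartesian_product case_prod_beta mult_ac)
    also have "\<dots> = (\<Sum>a<n. u i $ a * u j $ a) * (\<Sum>b<m. v i $ b * v j $ b)"
      by (simp only: sum_product)
    finally show ?thesis using that orthonormal_sum[OF u, of i j] orthonormal_sum[OF v, of i j] by simp
  qed
  have "(\<Sum>i<n. (\<Sum>c\<in>{..<n} \<times> {..<m}. ?e i c * A $$ c)\<^sup>2) \<le> (\<Sum>c\<in>{..<n} \<times> {..<m}. (A $$ c)\<^sup>2)"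
    by (rule bessel[OF _ _ orth]) auto
  moreover have "(\<Sum>c\<in>{..<n} \<times> {..<m}. (A $$ c)\<^sup>2) = (frob_norm A)\<^sup>2"
    by (simp add: frob_norm_sq[OF A] sum.cartesian_product case_prod_beta)
  moreover have "(\<Sum>c\<in>{..<n} \<times> {..<m}. ?e i c * A $$ c) = pairing n m A (\<lambda>a. u i $ a) (\<lambda>b. v i $ b)" for i
    by (simp add: pairing_def sum.cartesian_product case_prod_beta mult_ac)
  ultimately show ?thesis by simp
qed

lemma pairing_diff:
  assumes "A \<in> carrier_mat n m" "B \<in> carrier_mat n m"
  shows "pairing n m (A - B) p q = pairing n m A p q - pairing n m B p q"
  using assms unfolding pairing_def sum_subtractf[symmetric]
  by (intro sum.cong refl) (simp add: left_diff_distrib)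

lemma sum_outer_diff:
  assumes "x \<in> carrier_vec n" "y \<in> carrier_vec n"
  shows "sum_outer n m x u v - sum_outer n m y u v = sum_outer n m (x - y) u v"
  using assms by (intro eq_matI) (auto simp: sum_outer_def sum_subtractf[symmetric] left_diff_distrib intro!: sum.cong)

context symmetric_gauge
begin

definition dual_set :: "nat \<Rightarrow> nat \<Rightarrow> real mat \<Rightarrow> real set" where
  "dual_set m r Y = {mat_inner X Y | X. X \<in> carrier_mat n m \<and> vec_space.rank n X \<le> r \<and> gauge_norm g X \<le> 1}"

lemma rank_dual_norm_Sup: "rank_dual_norm n m g r Y = Sup (dual_set m r Y)"
  by (simp add: rank_dual_norm_def dual_set_def)

text \<open>The left singular vectors have entries of modulus at most 1, and the rows \<open>c i\<close> have length
  \<open>sing_vals X $ i\<close>.\<close>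

lemma entry_bound:
  assumes X: "X \<in> carrier_mat n m" and g1: "gauge_norm g X \<le> 1" and kb: "k < n" "b < m"
  shows "\<bar>X $$ (k, b)\<bar> \<le> real n * coord_bound"
proof -
  obtain a c where orth: "\<And>i j. i < n \<Longrightarrow> j < n \<Longrightarrow> (\<Sum>k<n. a i k * a j k) = (if i = j then 1 else 0 :: real)"
    and c_orth: "\<And>i j. i < n \<Longrightarrow> j < n \<Longrightarrow>
      (\<Sum>b<m. c i b * c j b) = (sing_vals X $ j)\<^sup>2 * (if i = j then 1 else 0)"
    and X_eq: "\<And>k b. k < n \<Longrightarrow> b < m \<Longrightarrow> X $$ (k, b) = (\<Sum>i<n. a i k * c i b)"
    using singular_system[OF X] by blast
  have "\<bar>a i k * c i b\<bar> \<le> coord_bound" if i: "i < n" for i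
  proof -
    have "(a i k)\<^sup>2 \<le> (\<Sum>k<n. (a i k)\<^sup>2)" using kb by (intro member_le_sum) auto
    then have "(a i k)\<^sup>2 \<le> 1\<^sup>2" using orth[OF i i] by (simp add: power2_eq_square)
    then have 1: "\<bar>a i k\<bar> \<le> 1" by (simp only: abs_le_square_iff[symmetric] abs_one)
    have "(c i b)\<^sup>2 \<le> (\<Sum>b<m. (c i b)\<^sup>2)" using kb by (intro member_le_sum) auto
    then have "(c i b)\<^sup>2 \<le> (sing_vals X $ i)\<^sup>2" using c_orth[OF i i] by (simp add: power2_eq_square)
    then have "\<bar>c i b\<bar> \<le> \<bar>sing_vals X $ i\<bar>" by (simp only: abs_le_square_iff)
    also have "\<dots> \<le> coord_bound"
      using coordinate_bound[OF sing_vals_props(1)[OF X] _ i] g1 by (simp add: gauge_norm_def)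
    finally have "\<bar>a i k\<bar> * \<bar>c i b\<bar> \<le> 1 * coord_bound" using 1 by (intro mult_mono) auto
    then show ?thesis by (simp add: abs_mult)
  qed
  then have "(\<Sum>i<n. \<bar>a i k * c i b\<bar>) \<le> (\<Sum>i<n. coord_bound)" by (intro sum_mono) auto
  moreover have "\<bar>X $$ (k, b)\<bar> \<le> (\<Sum>i<n. \<bar>a i k * c i b\<bar>)" unfolding X_eq[OF kb] by (rule sum_abs)
  ultimately show ?thesis by simp
qed

lemma dual_set_bdd:
  assumes Y: "Y \<in> carrier_mat n m"
  shows "bdd_above (dual_set m r Y)"
proof (rule bdd_aboveI)
  fix e assume "e \<in> dual_set m r Y"
  then obtain X where X: "X \<in> carrier_mat n m" "gauge_norm g X \<le> 1" "e = mat_inner X Y"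
    by (auto simp: dual_set_def)
  have "e = (\<Sum>a<n. \<Sum>b<m. X $$ (a, b) * Y $$ (a, b))" using X Y by (simp add: mat_inner_sum)
  also have "\<dots> \<le> (\<Sum>a<n. \<Sum>b<m. real n * coord_bound * \<bar>Y $$ (a, b)\<bar>)"
  proof (intro sum_mono)
    fix a b assume "a \<in> {..<n}" "b \<in> {..<m}"
    then have "\<bar>X $$ (a, b)\<bar> * \<bar>Y $$ (a, b)\<bar> \<le> real n * coord_bound * \<bar>Y $$ (a, b)\<bar>"
      using entry_bound[OF X(1,2)] by (intro mult_right_mono) auto
    then show "X $$ (a, b) * Y $$ (a, b) \<le> real n * coord_bound * \<bar>Y $$ (a, b)\<bar>"
      by (metis abs_ge_self abs_mult order_trans)
  qed
  finally show "e \<le> (\<Sum>a<n. \<Sum>b<m. real n * coord_bound * \<bar>Y $$ (a, b)\<bar>)" .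
qed

lemma rank_dual_norm_upper:
  assumes "Y \<in> carrier_mat n m" "X \<in> carrier_mat n m" "vec_space.rank n X \<le> r" "gauge_norm g X \<le> 1"
  shows "mat_inner X Y \<le> rank_dual_norm n m g r Y"
  unfolding rank_dual_norm_Sup using assms by (intro cSup_upper dual_set_bdd) (auto simp: dual_set_def)

text \<open>The truncation is the average of \<open>a\<close> and of \<open>a\<close> with the signs of the other entries flipped.\<close>

lemma g_truncate_le:
  assumes a: "a \<in> carrier_vec n"
  shows "g (head_vec n r (\<lambda>i. a $ i)) \<le> g a"
proof -
  let ?h = "head_vec n r (\<lambda>i. a $ i)"
  define b where "b = vec n (\<lambda>j. if j < r then a $ j else - a $ j)"
  have b: "b \<in> carrier_vec n" by (simp add: b_def)
  have "map_vec abs b = map_vec abs a" using a by (intro eq_vecI) (auto simp: b_def)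
  then have "g b = g a" using g_abs a b by metis
  moreover have "a + b = 2 \<cdot>\<^sub>v ?h" using a by (intro eq_vecI) (auto simp: b_def head_vec_def)
  ultimately have "\<bar>2\<bar> * g ?h \<le> 2 * g a"
    using g_triangle[OF a b] g_smult[of ?h 2] by simp
  then show ?thesis by simp
qed

context
  fixes m r :: nat and u v :: "nat \<Rightarrow> real vec"
  assumes r: "r \<le> n" and u: "orthonormal_family n n u" and v: "orthonormal_family m n v"
begin

text \<open>Test the supremum with the matrices that are diagonal in the given frames and supported on the
  first \<open>r\<close> positions. Here \<open>Y\<close> itself need not be diagonal in these frames.\<close>

lemma G_le_rank_dual_norm:
  assumes Y: "Y \<in> carrier_mat n m"
  shows "G r (\<lambda>i. pairing n m Y (\<lambda>a. u i $ a) (\<lambda>b. v i $ b)) \<le> rank_dual_norm n m g r Y"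
proof (rule G_least)
  fix a :: "real vec" assume a: "a \<in> carrier_vec n" "g a \<le> 1"
  let ?h = "head_vec n r (\<lambda>i. a $ i)" and ?c = "\<lambda>i. pairing n m Y (\<lambda>a. u i $ a) (\<lambda>b. v i $ b)"
  let ?X = "sum_outer n m ?h u v"
  have "mat_inner ?X Y \<le> rank_dual_norm n m g r Y"
  proof (rule rank_dual_norm_upper[OF Y])
    show "vec_space.rank n ?X \<le> r" by (rule rank_sum_outer_le[OF u r]) (simp add: head_vec_def)
    show "gauge_norm g ?X \<le> 1"
      using gauge_norm_sum_outer[OF u v, of ?h] g_truncate_le[OF a(1), of r] a(2) by simp
  qed simp
  moreover have "mat_inner ?X Y = mat_inner Y ?X"
    using Y by (simp add: mat_inner_sum[of _ n m] mult.commute)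
  moreover have "mat_inner Y ?X = (\<Sum>i<n. a $ i * (if i < r then ?c i else 0))"
    unfolding mat_inner_sum_outer[OF Y] by (intro sum.cong) (auto simp: head_vec_def)
  ultimately show "(\<Sum>i<n. a $ i * (if i < r then ?c i else 0)) \<le> rank_dual_norm n m g r Y" by simp
qed

lemma dual_set_nonempty: "dual_set m r Y \<noteq> {}"
proof -
  let ?X = "sum_outer n m (0\<^sub>v n) u v"
  have "vec_space.rank n ?X \<le> r" by (rule rank_sum_outer_le[OF u r]) simp
  moreover have "gauge_norm g ?X \<le> 1" using gauge_norm_sum_outer[OF u v, of "0\<^sub>v n"] by simp
  ultimately have "mat_inner ?X Y \<in> dual_set m r Y" by (auto simp: dual_set_def)
  then show ?thesis by blast
qed

text \<open>The trace inequality together with the vanishing of all but \<open>r\<close> singular values of \<open>X\<close>.\<close>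

lemma rank_dual_norm_sum_outer_le:
  assumes y: "\<And>i j. i \<le> j \<Longrightarrow> j < n \<Longrightarrow> y $ j \<le> y $ i" "\<And>i. i < n \<Longrightarrow> 0 \<le> y $ i"
  shows "rank_dual_norm n m g r (sum_outer n m y u v) \<le> G r (\<lambda>i. y $ i)"
  unfolding rank_dual_norm_Sup
proof (rule cSup_least[OF dual_set_nonempty])
  fix e assume "e \<in> dual_set m r (sum_outer n m y u v)"
  then obtain X where X: "X \<in> carrier_mat n m" "vec_space.rank n X \<le> r" "gauge_norm g X \<le> 1"
    and e: "e = mat_inner X (sum_outer n m y u v)" by (auto simp: dual_set_def)
  have "e \<le> (\<Sum>i<n. sing_vals X $ i * y $ i)" unfolding e by (rule von_neumann_trace_inequality[OF X(1) u v y])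
  also have "\<dots> = (\<Sum>i<n. sing_vals X $ i * (if i < r then y $ i else 0))"
    using sing_vals_zero_beyond_rank[OF X(1,2)] by (intro sum.cong) auto
  also have "\<dots> \<le> G r (\<lambda>i. y $ i)"
    using X(3) sing_vals_props(1)[OF X(1)] by (intro G_upper) (auto simp: gauge_norm_def)
  finally show "e \<le> G r (\<lambda>i. y $ i)" .
qed

lemma rank_dual_norm_midpoint:
  assumes Y: "Y \<in> carrier_mat n m" "Y' \<in> carrier_mat n m"
  shows "rank_dual_norm n m g r ((1/2) \<cdot>\<^sub>m (Y + Y'))
    \<le> (rank_dual_norm n m g r Y + rank_dual_norm n m g r Y') / 2"
  unfolding rank_dual_norm_Sup[of m r "(1/2) \<cdot>\<^sub>m (Y + Y')"]
proof (rule cSup_least[OF dual_set_nonempty])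
  fix e assume "e \<in> dual_set m r ((1/2) \<cdot>\<^sub>m (Y + Y'))"
  then obtain X where X: "X \<in> carrier_mat n m" "vec_space.rank n X \<le> r" "gauge_norm g X \<le> 1"
    and e: "e = mat_inner X ((1/2) \<cdot>\<^sub>m (Y + Y'))" by (auto simp: dual_set_def)
  have "e = (\<Sum>a<n. \<Sum>b<m. (X $$ (a, b) * Y $$ (a, b) + X $$ (a, b) * Y' $$ (a, b)) / 2)"
    unfolding e using X Y
    by (subst mat_inner_sum[of _ n m]) (auto simp: distrib_left add_divide_distrib sum.distrib)
  also have "\<dots> = (mat_inner X Y + mat_inner X Y') / 2"
    by (simp only: mat_inner_sum[OF X(1) Y(1)] mat_inner_sum[OF X(1) Y(2)]
        sum.distrib[symmetric] sum_divide_distrib)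
  also have "\<dots> \<le> (rank_dual_norm n m g r Y + rank_dual_norm n m g r Y') / 2"
    using rank_dual_norm_upper[OF Y(1) X] rank_dual_norm_upper[OF Y(2) X] by simp
  finally show "e \<le> \<dots>" .
qed

end

end

text \<open>A permutation matrix is doubly stochastic. As row sums are exactly 1, the vector \<open>x\<close> may be shifted
  by its smallest entry to make it nonnegative.\<close>

lemma rearrangement:
  fixes x z :: "nat \<Rightarrow> real"
  assumes z: "\<And>i j. i \<le> j \<Longrightarrow> j < n \<Longrightarrow> z j \<le> z i" "\<And>i. i < n \<Longrightarrow> 0 \<le> z i"
    and p: "p permutes {..<n}" and x: "\<And>i j. i \<le> j \<Longrightarrow> j < n \<Longrightarrow> x (p j) \<le> x (p i)"
  shows "(\<Sum>i<n. z i * x i) \<le> (\<Sum>i<n. z i * x (p i))"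
proof -
  define q where "q = inv_into UNIV p"
  have q: "q permutes {..<n}" unfolding q_def by (rule permutes_inv[OF p])
  have pq: "p (q i) = i" "q (p i) = i" for i using permutes_inverses[OF p] by (auto simp: q_def)
  have qn: "q i < n \<longleftrightarrow> i < n" for i using permutes_in_image[OF q, of i] by simp
  have pn: "p i < n \<longleftrightarrow> i < n" for i using permutes_in_image[OF p, of i] by simp
  define c where "c = x (p (n - 1))"
  define W where "W i j = (if j = q i then 1 else 0 :: real)" for i j
  have "(\<Sum>i<n. z i * (\<Sum>j<n. W i j * (x (p j) - c))) \<le> (\<Sum>i<n. z i * (x (p i) - c))"
  proof (rule substochastic_sum_le[OF _ _ _ z])
    show "(\<Sum>j<n. W i j) \<le> 1" if "i < n" for i by (simp add: W_def)
    have "W i j = (if i = p j then 1 else 0)" for i j using pq by (metis W_def)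
    then show "(\<Sum>i<n. W i j) \<le> 1" if "j < n" for j by simp
    show "0 \<le> x (p i) - c" if "i < n" for i using x[of i "n - 1"] that by (simp add: c_def)
  qed (use x in \<open>auto simp: W_def\<close>)
  moreover have "(\<Sum>i<n. z i * (\<Sum>j<n. W i j * (x (p j) - c))) = (\<Sum>i<n. z i * (x i - c))"
    by (intro sum.cong refl) (simp add: W_def mult_delta_left qn pq)
  ultimately show ?thesis by (simp add: right_diff_distrib sum_subtractf)
qed

lemma ex_sorting_permutation:
  fixes x :: "nat \<Rightarrow> real"
  obtains p where "p permutes {..<n}" "\<And>i j. i \<le> j \<Longrightarrow> j < n \<Longrightarrow> x (p j) \<le> x (p i)"
proof -
  let ?xs = "map x [0..<n]"
  have "mset (rev (sort ?xs)) = mset ?xs" by simp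
  then obtain p where p: "p permutes {..<n}" "permute_list p ?xs = rev (sort ?xs)"
    using mset_eq_permutation[of "rev (sort ?xs)" ?xs] by auto
  have pn: "p i < n" if "i < n" for i using permutes_in_image[OF p(1), of i] that by simp
  have x: "x (p i) = rev (sort ?xs) ! i" if "i < n" for i
    using that pn[OF that] unfolding p(2)[symmetric] by (subst permute_list_nth) (use p(1) in auto)
  have "sorted_wrt (\<ge>) (rev (sort ?xs))" by (simp add: sorted_wrt_rev)
  then have "x (p j) \<le> x (p i)" if "i \<le> j" "j < n" for i j
    using that x[of i] x[of j] by (cases "i = j") (auto simp: sorted_wrt_iff_nth_less)
  then show ?thesis using that p(1) by blast
qed

section \<open>Subgradients of the scalar function\<close>

lemma ereal_finite:
  assumes "proper_closed_convex f" "f v \<noteq> \<infinity>"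
  shows "f v = ereal (real_of_ereal (f v))"
  using assms by (cases "f v") (auto simp: proper_closed_convex_def proper_fun_def)

lemma proper_convex_on:
  assumes f: "proper_closed_convex f"
  shows "convex_on {v. f v \<noteq> \<infinity>} (\<lambda>v. real_of_ereal (f v))"
proof -
  have le: "f ((1 - c) * a + c * b) \<le> ereal ((1 - c) * real_of_ereal (f a) + c * real_of_ereal (f b))"
    if "f a \<noteq> \<infinity>" "f b \<noteq> \<infinity>" "0 \<le> c" "c \<le> 1" for a b c
  proof -
    have "(a, real_of_ereal (f a)) \<in> ereal_epigraph f" "(b, real_of_ereal (f b)) \<in> ereal_epigraph f"
      using ereal_finite[OF f] that by (auto simp: ereal_epigraph_def)
    then have "(1 - c) *\<^sub>R (a, real_of_ereal (f a)) + c *\<^sub>R (b, real_of_ereal (f b)) \<in> ereal_epigraph f"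
      using f that unfolding proper_closed_convex_def convex_alt by blast
    then show ?thesis by (simp add: ereal_epigraph_def)
  qed
  have fin: "f ((1 - c) * a + c * b) \<noteq> \<infinity>"
    if "f a \<noteq> \<infinity>" "f b \<noteq> \<infinity>" "0 \<le> c" "c \<le> 1" for a b c
    using le[OF that] by auto
  show ?thesis
  proof (rule convex_onI)
    show "convex {v. f v \<noteq> \<infinity>}" using fin by (auto simp: convex_alt)
    fix c a b :: real assume "0 < c" "c < 1" "a \<in> {v. f v \<noteq> \<infinity>}" "b \<in> {v. f v \<noteq> \<infinity>}"
    then have ab: "f a \<noteq> \<infinity>" "f b \<noteq> \<infinity>" "0 \<le> c" "c \<le> 1" by auto
    have "ereal (real_of_ereal (f ((1 - c) * a + c * b)))
        \<le> ereal ((1 - c) * real_of_ereal (f a) + c * real_of_ereal (f b))"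
      using le[OF ab] ereal_finite[OF f fin[OF ab]] by simp
    then show "real_of_ereal (f ((1 - c) *\<^sub>R a + c *\<^sub>R b))
        \<le> (1 - c) * real_of_ereal (f a) + c * real_of_ereal (f b)" by simp
  qed
qed

lemma subdiff_finite:
  assumes f: "proper_closed_convex f" and "\<mu> \<in> subdiff f w"
  shows "f w \<noteq> \<infinity>"
proof -
  obtain x where "f x \<noteq> \<infinity>" using f by (auto simp: proper_closed_convex_def proper_fun_def)
  moreover have "f w + ereal (\<mu> * (x - w)) \<le> f x" using assms by (simp add: subdiff_def)
  ultimately show ?thesis by auto
qed

lemma subdiff_real:
  assumes f: "proper_closed_convex f" and mu: "\<mu> \<in> subdiff f w" and v: "f v \<noteq> \<infinity>"
  shows "real_of_ereal (f w) + \<mu> * (v - w) \<le> real_of_ereal (f v)"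
proof -
  have "f w + ereal (\<mu> * (v - w)) \<le> f v" using mu by (simp add: subdiff_def)
  then show ?thesis
    using ereal_finite[OF f v] ereal_finite[OF f subdiff_finite[OF f mu]]
    by (metis ereal_less_eq(3) plus_ereal.simps(1))
qed

lemma minimizer_iff_zero_subdiff: "minimizer f w \<longleftrightarrow> 0 \<in> subdiff f w"
  unfolding minimizer_def is_arg_min_def subdiff_def by (auto simp: not_less zero_ereal_def[symmetric])

text \<open>Complementary slackness makes both \<open>w\<close> and \<open>w'\<close> minimizers of \<open>f\<close> on the half-line above \<open>c\<close>. The larger
  one is not on its boundary, so its multiplier is 0; then \<open>f w = f w'\<close> and the other slope, which
  cannot be positive, is 0 too.\<close>

lemma multipliers_vanish:
  assumes f: "proper_closed_convex f"
    and 1: "\<mu> \<in> subdiff f w" "0 \<le> \<mu>" "c \<le> w" "\<mu> * (w - c) = 0"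
    and 2: "\<mu>' \<in> subdiff f w'" "0 \<le> \<mu>'" "c \<le> w'" "\<mu>' * (w' - c) = 0"
    and less: "w < w'"
  shows "\<mu> = 0" "\<mu>' = 0"
proof -
  show mu': "\<mu>' = 0" using 2 1 less by auto
  have "real_of_ereal (f w') \<le> real_of_ereal (f w)"
    using subdiff_real[OF f 2(1) subdiff_finite[OF f 1(1)]] mu' by simp
  moreover have "real_of_ereal (f w) + \<mu> * (w' - w) \<le> real_of_ereal (f w')"
    by (rule subdiff_real[OF f 1(1) subdiff_finite[OF f 2(1)]])
  ultimately have "\<mu> * (w' - w) \<le> 0" by simp
  then show "\<mu> = 0" using 1(2) less by (simp add: mult_le_0_iff)
qed

section \<open>From the three cases to the vector problem\<close>

locale lowrank_prox =
  fixes n m r :: nat and Z :: "real mat" and u v :: "nat \<Rightarrow> real vec" and \<gamma> :: real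
    and g :: "real vec \<Rightarrow> real" and f :: "real \<Rightarrow> ereal"
  assumes Z: "Z \<in> carrier_mat n m" and svd: "is_svd n m Z u v"
    and gamma: "0 < \<gamma>" and r: "1 \<le> r" "r \<le> n"
    and sg: "sym_gauge n g" and f: "proper_closed_convex f"
begin

sublocale symmetric_gauge n g by unfold_locales (rule sg)

abbreviation "\<sigma> \<equiv> sing_vals Z"
abbreviation "F a \<equiv> real_of_ereal (f a)"

sublocale prox: gauge_prox n r "\<lambda>i. \<sigma> $ i" "G r" "\<lambda>v. real_of_ereal (f v)" "{v. f v \<noteq> \<infinity>}" \<gamma>
proof unfold_locales
  show "convex_on {v. f v \<noteq> \<infinity>} (\<lambda>v. real_of_ereal (f v))" by (rule proper_convex_on[OF f])
qed (use r gamma sing_vals_props[OF Z] G_convex G_abs G_swap in \<open>auto intro: G_cong\<close>)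

lemma u: "orthonormal_family n n u" and v: "orthonormal_family m n v" and Z_eq: "Z = sum_outer n m \<sigma> u v"
  using svd by (auto simp: is_svd_def)

text \<open>The optimality system of the shortened problem with multiplier \<open>\<mu>\<close>. Stating the
  inclusion of (C3) as an inequality covers all three cases without constructing a subgradient
  of the truncated dual gauge in (C1) and (C2).\<close>

definition kkt :: "nat \<Rightarrow> nat \<Rightarrow> real vec \<Rightarrow> real \<Rightarrow> real \<Rightarrow> bool" where
  "kkt t s y w \<mu> \<longleftrightarrow> y \<in> carrier_vec (r - t + 1) \<and> \<mu> \<in> subdiff f w \<and> 0 \<le> \<mu> \<and>
     trunc_dual_gauge n g r s t y \<le> w \<and> \<mu> * (w - trunc_dual_gauge n g r s t y) = 0 \<and>
     (\<forall>x\<in>carrier_vec (r - t + 1). \<gamma> * ((trunc_sv r s t \<sigma> - y) \<bullet> (x - y))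
        \<le> \<mu> * (trunc_dual_gauge n g r s t x - trunc_dual_gauge n g r s t y))"

lemma trunc_sv_carrier [simp]: "trunc_sv r s t \<sigma> \<in> carrier_vec (r - t + 1)"
  by (simp add: trunc_sv_def)

lemma trunc_pad_carrier [simp]: "trunc_pad n r t c x \<in> carrier_vec n"
  by (simp add: trunc_pad_def)

lemma sum_split_three:
  fixes h :: "nat \<Rightarrow> real"
  assumes "a \<le> b" "b \<le> d"
  shows "(\<Sum>i<d. h i) = (\<Sum>i<a. h i) + (\<Sum>i=a..<b. h i) + (\<Sum>i=b..<d. h i)"
  using assms by (metis atLeast0LessThan le0 order_trans sum.atLeastLessThan_concat)

text \<open>The scalings of the truncated gauge and of the truncated dual gauge are dual to each other: the
  block contributes $t \cdot (\sqrt{t+s}/t) \cdot (1/\sqrt{t+s}) = 1$ times the last product.\<close>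

lemma trunc_pad_prod:
  assumes t: "1 \<le> t" "t \<le> r" and x: "x \<in> carrier_vec (r - t + 1)" and y: "y \<in> carrier_vec (r - t + 1)"
  shows "trunc_pad n r t (sqrt (real (t + s)) / real t) x \<bullet> trunc_pad n r t (1 / sqrt (real (t + s))) y = x \<bullet> y"
proof -
  let ?c = "sqrt (real (t + s)) / real t" and ?d = "1 / sqrt (real (t + s))"
  have "trunc_pad n r t ?c x \<bullet> trunc_pad n r t ?d y
      = (\<Sum>i<n. if i < r - t then x $ i * y $ i else if i < r then ?c * x $ (r - t) * (?d * y $ (r - t)) else 0)"
    by (auto simp: scalar_prod_def trunc_pad_def lessThan_atLeast0 intro!: sum.cong)
  also have "\<dots> = (\<Sum>i<r - t. x $ i * y $ i) + (\<Sum>i=r - t..<r. ?c * x $ (r - t) * (?d * y $ (r - t)))"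
    using r by (subst sum_split_three[of "r - t" r n]) (auto intro!: sum.neutral)
  also have "(\<Sum>i=r - t..<r. ?c * x $ (r - t) * (?d * y $ (r - t))) = x $ (r - t) * y $ (r - t)"
    using t by simp
  also have "(\<Sum>i<r - t. x $ i * y $ i) + x $ (r - t) * y $ (r - t) = x \<bullet> y"
    using y by (simp add: scalar_prod_def lessThan_atLeast0[symmetric])
  finally show ?thesis .
qed

text \<open>In (C1) the multiplier is 0, as \<open>w\<close> minimizes \<open>f\<close>. In (C2) it is the given \<open>\<mu>\<close>, and the variational
  inequality at \<open>y = 0\<close> is the Hoelder inequality for the truncated gauge. In (C3) it is the
  subgradient inequality multiplied by \<open>\<mu>\<close>.\<close>

lemma kkt_of_cases:
  assumes t: "1 \<le> t" "t \<le> r"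
    and "case_C1 n g f r s t (trunc_sv r s t \<sigma>) y w \<or>
      case_C2 n g f \<gamma> r s t (trunc_sv r s t \<sigma>) y w \<or>
      case_C3 n g f \<gamma> r s t (trunc_sv r s t \<sigma>) y w"
  obtains \<mu> where "kkt t s y w \<mu>"
  using assms(3)
proof (elim disjE)
  let ?z = "trunc_sv r s t \<sigma>" and ?T = "trunc_dual_gauge n g r s t"
  assume "case_C1 n g f r s t ?z y w"
  moreover have "(?z - ?z) \<bullet> (x - ?z) = 0" if "x \<in> carrier_vec (r - t + 1)" for x
  proof -
    have "?z - ?z = 0\<^sub>v (r - t + 1)" by (rule minus_cancel_vec) (rule trunc_sv_carrier)
    moreover have "x - ?z \<in> carrier_vec (r - t + 1)"
      using that by (rule minus_carrier_vec) (rule trunc_sv_carrier)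
    ultimately show ?thesis by (simp only: scalar_prod_left_zero)
  qed
  ultimately have "kkt t s y w 0"
    unfolding case_C1_def kkt_def minimizer_iff_zero_subdiff
    using trunc_sv_carrier[of s t] by simp
  then show ?thesis by (rule that)
next
  let ?z = "trunc_sv r s t \<sigma>" and ?T = "trunc_dual_gauge n g r s t"
  assume "case_C2 n g f \<gamma> r s t ?z y w"
  then obtain \<mu> where y: "y = 0\<^sub>v (r - t + 1)" and w: "w = 0" and mu: "\<mu> \<in> subdiff f 0"
    and le: "trunc_gauge n g r s t ?z \<le> \<mu> / \<gamma>" by (auto simp: case_C2_def)
  have "trunc_pad n r t c y = 0\<^sub>v n" for c
    by (intro eq_vecI) (auto simp: trunc_pad_def y)
  then have T0: "?T y = 0"
    using dual_nonneg[of "0\<^sub>v n"] dual_least[of "0\<^sub>v n" 0] by (simp add: trunc_dual_gauge_def)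
  have "0 \<le> trunc_gauge n g r s t ?z" unfolding trunc_gauge_def by (intro g_nonneg) simp
  then have "0 \<le> \<mu> / \<gamma>" using le by linarith
  then have mu0: "0 \<le> \<mu>" using gamma by (simp add: zero_le_divide_iff)
  have "\<gamma> * ((?z - y) \<bullet> (x - y)) \<le> \<mu> * (?T x - ?T y)" if x: "x \<in> carrier_vec (r - t + 1)" for x
  proof -
    have "?z \<bullet> x \<le> trunc_gauge n g r s t ?z * ?T x"
      using holder[of "trunc_pad n r t (sqrt (real (t + s)) / real t) ?z" "trunc_pad n r t (1 / sqrt (real (t + s))) x"]
      by (simp only: trunc_pad_prod[OF t trunc_sv_carrier x] trunc_pad_carrier trunc_gauge_def trunc_dual_gauge_def)
    also have "\<dots> \<le> \<mu> / \<gamma> * ?T x"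
      using le dual_nonneg by (intro mult_right_mono) (auto simp: trunc_dual_gauge_def)
    finally have "\<gamma> * (?z \<bullet> x) \<le> \<mu> * ?T x" using gamma by (simp add: field_simps)
    moreover have "?z - y = ?z" "x - y = x"
      using x trunc_sv_carrier[of s t] by (auto simp: y intro!: eq_vecI)
    ultimately show ?thesis using T0 by simp
  qed
  then have "kkt t s y w \<mu>" using T0 mu mu0 w y by (simp add: kkt_def)
  then show ?thesis by (rule that)
next
  let ?z = "trunc_sv r s t \<sigma>" and ?T = "trunc_dual_gauge n g r s t"
  assume "case_C3 n g f \<gamma> r s t ?z y w"
  then obtain \<mu> p where y: "y \<in> carrier_vec (r - t + 1)" and mu: "\<mu> \<in> subdiff f w" "0 \<le> \<mu>"
    and p: "p \<in> carrier_vec (r - t + 1)" and eq: "\<gamma> \<cdot>\<^sub>v (?z - y) = \<mu> \<cdot>\<^sub>v p" and w: "w = ?T y"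
    and sub: "\<And>x. x \<in> carrier_vec (r - t + 1) \<Longrightarrow> ?T y + p \<bullet> (x - y) \<le> ?T x"
    by (auto simp: case_C3_def vec_subdiff_def)
  have "\<gamma> * ((?z - y) \<bullet> (x - y)) \<le> \<mu> * (?T x - ?T y)" if x: "x \<in> carrier_vec (r - t + 1)" for x
  proof -
    have "\<gamma> * ((?z - y) \<bullet> (x - y)) = (\<gamma> \<cdot>\<^sub>v (?z - y)) \<bullet> (x - y)"
      by (intro smult_scalar_prod_distrib[symmetric, of _ "r - t + 1"] minus_carrier_vec x y trunc_sv_carrier)
    also have "\<dots> = \<mu> * (p \<bullet> (x - y))"
      unfolding eq by (intro smult_scalar_prod_distrib[of _ "r - t + 1"] minus_carrier_vec x y p)
    also have "\<dots> \<le> \<mu> * (?T x - ?T y)" using sub[OF x] mu by (intro mult_left_mono) auto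
    finally show ?thesis .
  qed
  then have "kkt t s y w \<mu>" using mu w y by (simp add: kkt_def)
  then show ?thesis by (rule that)
qed

text \<open>Testing the variational inequality with $x = \tilde z$ gives $|\tilde z - \tilde y|^2 \le 0$.\<close>

lemma kkt_zero_multiplier:
  assumes k: "kkt t s y w 0"
  shows "case_C1 n g f r s t (trunc_sv r s t \<sigma>) y w"
proof -
  let ?z = "trunc_sv r s t \<sigma>"
  have y: "y \<in> carrier_vec (r - t + 1)" using k by (simp add: kkt_def)
  have "\<gamma> * ((?z - y) \<bullet> (?z - y)) \<le> 0" using k trunc_sv_carrier[of s t] unfolding kkt_def by force
  then have "(?z - y) \<bullet> (?z - y) \<le> 0" using gamma by (simp add: mult_le_0_iff)
  then have sum: "(\<Sum>i<r - t + 1. (?z $ i - y $ i)\<^sup>2) \<le> 0"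
    using y by (simp add: scalar_prod_def lessThan_atLeast0 power2_eq_square)
  have "y $ i = ?z $ i" if "i < r - t + 1" for i
  proof -
    have "(?z $ i - y $ i)\<^sup>2 \<le> (\<Sum>i<r - t + 1. (?z $ i - y $ i)\<^sup>2)"
      using that by (intro member_le_sum) auto
    from order_trans[OF this sum] show ?thesis by simp
  qed
  then have "y = ?z" using y trunc_sv_carrier[of s t] by (intro eq_vecI) auto
  then show ?thesis using k by (simp add: case_C1_def kkt_def minimizer_iff_zero_subdiff)
qed

lemma G_extend_vec:
  assumes t: "1 \<le> t" "t \<le> r" and s: "s \<le> n - r"
  shows "G r (\<lambda>i. extend_vec n r s t \<sigma> y $ i) = trunc_dual_gauge n g r s t y"
proof -
  have "head_vec n r (\<lambda>i. extend_vec n r s t \<sigma> y $ i) = trunc_pad n r t (1 / sqrt (real (t + s))) y"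
    using t by (intro eq_vecI) (auto simp: head_vec_def extend_vec_def trunc_pad_def)
  then show ?thesis by (simp add: G_def trunc_dual_gauge_def)
qed

text \<open>On the block both \<open>x\<close> and the candidate are constant, so the inner product with
  \<open>\<sigma>\<close> minus the candidate only sees the block sum of \<open>\<sigma>\<close>. With \<open>q\<close> the square root of the block
  length, the shortened vector \<open>x'\<close> stores \<open>q\<close> times the block value of \<open>x\<close>, and the shortened
  inner product is the full one. Behind the block the candidate equals \<open>\<sigma>\<close>.\<close>

lemma kkt_imp_opt:
  assumes t: "1 \<le> t" "t \<le> r" and s: "s \<le> n - r" and k: "kkt t s y w \<mu>"
  shows "prox.opt (prox.pooled t s) (\<lambda>i. extend_vec n r s t \<sigma> y $ i) w"
proof -
  let ?z = "trunc_sv r s t \<sigma>" and ?T = "trunc_dual_gauge n g r s t"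
  let ?Y = "\<lambda>i. extend_vec n r s t \<sigma> y $ i"
  define q where "q = sqrt (real (t + s))"
  have q: "q > 0" "q * q = real (t + s)" using t by (auto simp: q_def)
  have y: "y \<in> carrier_vec (r - t + 1)" using k by (simp add: kkt_def)
  have GY: "G r ?Y = ?T y" by (rule G_extend_vec[OF t s])
  have Y1: "?Y i = y $ i" if "i < r - t" for i
    using that r by (simp add: extend_vec_def)
  have Y2: "?Y i = y $ (r - t) / q" if "r - t \<le> i" "i < r + s" for i
    using that r s by (simp add: extend_vec_def q_def)
  have Y3: "?Y i = \<sigma> $ i" if "r + s \<le> i" "i < n" for i
    using that by (auto simp: extend_vec_def)
  show ?thesis
    unfolding prox.opt_def
  proof (intro conjI ballI allI impI)
    have "?Y i = ?Y (r - 1)" if "r - t \<le> i \<and> i < r + s" for i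
      using Y2[of i] Y2[of "r - 1"] that t by simp
    then show "?Y \<in> prox.pooled t s" unfolding prox.pooled_def by blast
    show "prox.feasible ?Y w"
      using k subdiff_finite[OF f] GY by (auto simp: prox.feasible_def kkt_def)
    fix x a assume x: "x \<in> prox.pooled t s" and feas: "prox.feasible x a"
    define x' where "x' = vec (r - t + 1) (\<lambda>i. if i < r - t then x i else q * x (r - 1))"
    have x': "x' \<in> carrier_vec (r - t + 1)" by (simp add: x'_def)
    have "G r x = G r (\<lambda>i. extend_vec n r s t \<sigma> x' $ i)"
    proof (rule G_cong)
      fix i assume i: "i < r"
      show "x i = extend_vec n r s t \<sigma> x' $ i"
      proof (cases "i < r - t")
        case True then show ?thesis using r i by (simp add: extend_vec_def x'_def)
      next
        case False
        then have "x i = x (r - 1)" using prox.pooledD[OF x, of i] i by simp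
        then show ?thesis using False r i q(1) by (simp add: extend_vec_def x'_def q_def)
      qed
    qed
    then have Gx: "G r x = ?T x'" using G_extend_vec[OF t s] by simp
    have fa: "f a \<noteq> \<infinity>" and Ga: "G r x \<le> a" using feas by (auto simp: prox.feasible_def)
    have rs: "r - t \<le> r + s" "r + s \<le> n" using s r by auto
    have "(\<Sum>i<n. (\<sigma> $ i - ?Y i) * (x i - ?Y i))
        = (\<Sum>i<r - t. (\<sigma> $ i - ?Y i) * (x i - ?Y i)) + (\<Sum>i=r - t..<r + s. (\<sigma> $ i - ?Y i) * (x i - ?Y i))"
      unfolding sum_split_three[OF rs] using Y3 by simp
    also have "(\<Sum>i<r - t. (\<sigma> $ i - ?Y i) * (x i - ?Y i)) = (\<Sum>i<r - t. (?z $ i - y $ i) * (x' $ i - y $ i))"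
      by (intro sum.cong refl) (simp add: Y1 trunc_sv_def x'_def)
    also have "(\<Sum>i=r - t..<r + s. (\<sigma> $ i - ?Y i) * (x i - ?Y i))
        = (?z $ (r - t) - y $ (r - t)) * (x' $ (r - t) - y $ (r - t))"
    proof -
      let ?b = "x (r - 1)" and ?e = "y $ (r - t) / q"
      have "(\<Sum>i=r - t..<r + s. (\<sigma> $ i - ?Y i) * (x i - ?Y i)) = (\<Sum>i=r - t..<r + s. (\<sigma> $ i - ?e) * (?b - ?e))"
      proof (intro sum.cong refl)
        fix i assume "i \<in> {r - t..<r + s}"
        then show "(\<sigma> $ i - ?Y i) * (x i - ?Y i) = (\<sigma> $ i - ?e) * (?b - ?e)"
          using Y2[of i] prox.pooledD[OF x, of i] by simp
      qed
      also have "\<dots> = ((\<Sum>i=r - t..<r + s. \<sigma> $ i) - real (t + s) * ?e) * (?b - ?e)"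
        using t by (simp add: sum_distrib_right[symmetric] sum_subtractf)
      also have "\<dots> = (((\<Sum>i=r - t..<r + s. \<sigma> $ i) / q - q * ?e) * q) * (?b - ?e)"
      proof -
        have eq: "S - (q * q) * e = (S / q - q * e) * q" for S e
          using q(1) by (simp add: field_simps)
        show ?thesis unfolding q(2)[symmetric] by (simp only: eq)
      qed
      also have "\<dots> = ((\<Sum>i=r - t..<r + s. \<sigma> $ i) / q - q * ?e) * (q * ?b - q * ?e)"
        by (simp add: algebra_simps)
      also have "q * ?e = y $ (r - t)" using q by simp
      finally show ?thesis by (simp add: trunc_sv_def x'_def q_def)
    qed
    also have "(\<Sum>i<r - t. (?z $ i - y $ i) * (x' $ i - y $ i)) + (?z $ (r - t) - y $ (r - t)) * (x' $ (r - t) - y $ (r - t))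
        = (?z - y) \<bullet> (x' - y)"
      using y x' trunc_sv_carrier[of s t] by (simp add: scalar_prod_def lessThan_atLeast0[symmetric])
    finally have prod: "(\<Sum>i<n. (\<sigma> $ i - ?Y i) * (x i - ?Y i)) = (?z - y) \<bullet> (x' - y)" .
    have "\<gamma> * ((?z - y) \<bullet> (x' - y)) \<le> \<mu> * (?T x' - ?T y)" using k x' by (simp add: kkt_def)
    also have "\<dots> \<le> \<mu> * (a - w)"
    proof -
      have "\<mu> * ?T y = \<mu> * w" using k by (auto simp: kkt_def)
      moreover have "\<mu> * ?T x' \<le> \<mu> * a" using k Ga Gx by (intro mult_left_mono) (auto simp: kkt_def)
      ultimately show ?thesis unfolding right_diff_distrib by linarith
    qed
    also have "\<dots> \<le> F a - F w" using subdiff_real[OF f _ fa, of \<mu> w] k by (simp add: kkt_def)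
    finally show "F w + \<gamma> * (\<Sum>i<n. (\<sigma> $ i - ?Y i) * (x i - ?Y i)) \<le> F a" unfolding prod by simp
  qed
qed

end

section \<open>The solution of the matrix problem\<close>

lemma Min_first:
  fixes N :: nat
  assumes M: "M = Min ({s. s < N \<and> P s} \<union> {N})"
  shows "M \<le> N" "s < M \<Longrightarrow> \<not> P s" "M < N \<Longrightarrow> P M"
proof -
  let ?S = "{s. s < N \<and> P s} \<union> {N}"
  have fin: "finite ?S" by simp
  show le: "M \<le> N" unfolding M using fin by (intro Min_le) auto
  show "M < N \<Longrightarrow> P M" using Min_in[OF fin] unfolding M[symmetric] by auto
  show "\<not> P s" if "s < M"
  proof
    assume "P s"
    then have "s \<in> ?S" using that le by simp
    then have "M \<le> s" unfolding M using fin by (intro Min_le)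
    then show False using that by simp
  qed
qed

locale lowrank_search = lowrank_prox +
  fixes yt :: "nat \<Rightarrow> nat \<Rightarrow> real vec" and w :: "nat \<Rightarrow> nat \<Rightarrow> real"
  assumes kkt_ex: "\<And>t s. t \<in> {1..r} \<Longrightarrow> s \<le> n - r \<Longrightarrow> \<exists>\<mu>. kkt t s (yt t s) (w t s) \<mu>"
begin

abbreviation y :: "nat \<Rightarrow> nat \<Rightarrow> real vec" where
  "y \<equiv> \<lambda>t s. extend_vec n r s t \<sigma> (yt t s)"
abbreviation ss :: "nat \<Rightarrow> nat" where "ss \<equiv> s_star n r y"
abbreviation ts :: nat where "ts \<equiv> t_star n r y"

lemma ts_eq:
  "ts = Min ({t. t < r \<and> (1 \<le> t \<and> y t (ss t) $ (r - t - 1) > y t (ss t) $ (r - t))} \<union> {r})"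
  unfolding t_star_def by (intro arg_cong[of _ _ Min]) auto

sublocale search: nested_search n r "\<lambda>i. \<sigma> $ i" "G r" "\<lambda>v. real_of_ereal (f v)" "{v. f v \<noteq> \<infinity>}" \<gamma>
  "\<lambda>t s i. y t s $ i" w ss ts
proof unfold_locales
  show "prox.opt (prox.pooled t s) (\<lambda>i. y t s $ i) (w t s)" if "t \<in> {1..r}" "s \<le> n - r" for t s
    using kkt_ex[OF that] kkt_imp_opt that by auto
  show "y t s $ i = \<sigma> $ i" if "t \<in> {1..r}" "r + s \<le> i" "i < n" for t s i
    using that by (auto simp: extend_vec_def)
  note S = Min_first[OF s_star_def[of n r y]]
  show "ss t \<le> n - r" for t by (rule S(1))
  show "y t s $ (r + s - 1) \<le> y t s $ (r + s)" if "s < ss t" for t s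
    using S(2)[OF that] by simp
  show "y t (ss t) $ (r + ss t) < y t (ss t) $ (r + ss t - 1)" if "ss t < n - r" for t
    using S(3)[OF that] by simp
  note T = Min_first[OF ts_eq]
  show "1 \<le> ts" using T(1,3) r by (cases "ts < r") auto
  show "ts \<le> r" by (rule T(1))
  show "y t (ss t) $ (r - t - 1) \<le> y t (ss t) $ (r - t)" if "1 \<le> t" "t < ts" for t
    using T(2)[OF that(2)] that(1) by simp
  show "y ts (ss ts) $ (r - ts) < y ts (ss ts) $ (r - ts - 1)" if "ts < r"
    using T(3)[OF that] by simp
qed

text \<open>Equal vectors have equal gauges, so both values of \<open>w\<close> come with multipliers for the same
  half-line. If they differ, both multipliers vanish, and a vanishing multiplier means (C1).\<close>

lemma equal_w_or_C1:
  assumes t: "t \<in> {1..r}" "s \<le> n - r" and t': "t' \<in> {1..r}" "s' \<le> n - r"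
    and eq: "y t s = y t' s'"
  shows "w t s = w t' s' \<or>
    case_C1 n g f r s t (trunc_sv r s t \<sigma>) (yt t s) (w t s) \<and>
    case_C1 n g f r s' t' (trunc_sv r s' t' \<sigma>) (yt t' s') (w t' s')"
proof -
  obtain \<mu> where k: "kkt t s (yt t s) (w t s) \<mu>" using kkt_ex[OF t] by blast
  obtain \<mu>' where k': "kkt t' s' (yt t' s') (w t' s') \<mu>'" using kkt_ex[OF t'] by blast
  define c where "c = trunc_dual_gauge n g r s t (yt t s)"
  have c: "c = trunc_dual_gauge n g r s' t' (yt t' s')"
    using G_extend_vec[of t s "yt t s"] G_extend_vec[of t' s' "yt t' s'"] t t' eq by (simp add: c_def)
  have 1: "\<mu> \<in> subdiff f (w t s)" "0 \<le> \<mu>" "c \<le> w t s" "\<mu> * (w t s - c) = 0"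
    using k unfolding kkt_def c_def by blast+
  have 2: "\<mu>' \<in> subdiff f (w t' s')" "0 \<le> \<mu>'" "c \<le> w t' s'" "\<mu>' * (w t' s' - c) = 0"
    using k' unfolding kkt_def c by blast+
  have "w t s = w t' s' \<or> \<mu> = 0 \<and> \<mu>' = 0"
    using multipliers_vanish[OF f 1 2] multipliers_vanish[OF f 2 1] by linarith
  then show ?thesis using kkt_zero_multiplier k k' by blast
qed

lemma y_eqI: "(\<And>i. i < n \<Longrightarrow> y t s $ i = y t' s' $ i) \<Longrightarrow> y t s = y t' s'"
  by (intro eq_vecI) (auto simp: extend_vec_def)

abbreviation ystar :: "real vec" where "ystar \<equiv> y ts (ss ts)"
abbreviation wstar :: real where "wstar \<equiv> w ts (ss ts)"
abbreviation Ystar :: "real mat" where "Ystar \<equiv> sum_outer n m ystar u v"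

lemma ystar_carrier: "ystar \<in> carrier_vec n"
  by (simp add: extend_vec_def)

lemma ts_in: "ts \<in> {1..r}" using search.ts_range by simp

lemma wstar_feasible: "f wstar \<noteq> \<infinity>" "G r (\<lambda>i. ystar $ i) \<le> wstar"
  using search.yt_opt[OF ts_in] by (auto simp: prox.opt_def prox.feasible_def)

lemma Ystar_feasible: "rank_dual_norm n m g r Ystar \<le> wstar"
  using rank_dual_norm_sum_outer_le[OF r(2) u v search.yt_ts_antimono search.yt_nonneg[OF ts_in]]
    wstar_feasible(2) by simp

lemma frob_Ystar: "(frob_norm (Ystar - Z))\<^sup>2 = prox.sqdist (\<lambda>i. ystar $ i) (\<lambda>i. \<sigma> $ i)"
proof -
  have "Ystar - Z = sum_outer n m (ystar - \<sigma>) u v"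
    using sum_outer_diff[OF ystar_carrier sing_vals_props(1)[OF Z], of m u v] Z_eq by simp
  then show ?thesis
    using frob_norm_sq_sum_outer[OF u v] sing_vals_props(1)[OF Z] by (simp add: prox.sqdist_def)
qed

text \<open>The numbers \<open>c i\<close> are the diagonal of \<open>Y\<close> in the singular frames of \<open>Z\<close>. Sorting them amounts to
  permuting the frames, so their gauge is still bounded by the rank constrained dual norm of \<open>Y\<close>;
  neither passing to the diagonal nor sorting increases the distance to \<open>Z\<close>.\<close>

lemma objective_ge:
  assumes Y: "Y \<in> carrier_mat n m" and a: "rank_dual_norm n m g r Y \<le> a" "f a \<noteq> \<infinity>"
  shows "F wstar + \<gamma> / 2 * (frob_norm (Ystar - Z))\<^sup>2 \<le> F a + \<gamma> / 2 * (frob_norm (Y - Z))\<^sup>2"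
proof -
  let ?z = "\<lambda>i. \<sigma> $ i"
  define c where "c i = pairing n m Y (\<lambda>a. u i $ a) (\<lambda>b. v i $ b)" for i
  obtain p where p: "p permutes {..<n}" and sorted: "\<And>i j. i \<le> j \<Longrightarrow> j < n \<Longrightarrow> c (p j) \<le> c (p i)"
    using ex_sorting_permutation[of n c] by blast
  have pn: "p i < n \<longleftrightarrow> i < n" for i using permutes_in_image[OF p, of i] by simp
  have inj: "p i = p j \<longleftrightarrow> i = j" for i j using permutes_inj[OF p] by (auto dest: injD)
  have u': "orthonormal_family n n (\<lambda>i. u (p i))" and v': "orthonormal_family m n (\<lambda>i. v (p i))"
    using u v pn inj by (auto simp: orthonormal_family_def)
  let ?x = "\<lambda>i. c (p i)"
  have "G r ?x \<le> a" using G_le_rank_dual_norm[OF r(2) u' v' Y] a(1) by (simp add: c_def)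
  then have feas: "prox.feasible ?x a" using a(2) by (simp add: prox.feasible_def)
  have "prox.sqdist ?x ?z \<le> prox.sqdist c ?z"
  proof -
    have "(\<Sum>i<n. (c i)\<^sup>2) = (\<Sum>i<n. (c (p i))\<^sup>2)"
      by (rule sum.permute[OF p, unfolded o_def])
    moreover have "(\<Sum>i<n. \<sigma> $ i * c i) \<le> (\<Sum>i<n. \<sigma> $ i * c (p i))"
      using sing_vals_props(2,3)[OF Z] by (intro rearrangement p sorted) auto
    moreover have "prox.sqdist x ?z = (\<Sum>i<n. (x i)\<^sup>2) - 2 * (\<Sum>i<n. \<sigma> $ i * x i) + (\<Sum>i<n. (\<sigma> $ i)\<^sup>2)" for x
      unfolding prox.sqdist_def sum_distrib_left sum.distrib[symmetric] sum_subtractf[symmetric]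
      by (intro sum.cong refl) (simp add: power2_eq_square algebra_simps)
    ultimately show ?thesis by simp
  qed
  also have "\<dots> \<le> (frob_norm (Y - Z))\<^sup>2"
  proof -
    have "pairing n m (Y - Z) (\<lambda>a. u i $ a) (\<lambda>b. v i $ b) = c i - \<sigma> $ i" if "i < n" for i
      unfolding pairing_diff[OF Y Z] using pairing_sum_outer[OF u v that, of \<sigma>] Z_eq by (simp add: c_def)
    then have "prox.sqdist c ?z = (\<Sum>i<n. (pairing n m (Y - Z) (\<lambda>a. u i $ a) (\<lambda>b. v i $ b))\<^sup>2)"
      unfolding prox.sqdist_def by (intro sum.cong) auto
    also have "\<dots> \<le> (frob_norm (Y - Z))\<^sup>2" using Y Z by (intro sum_pairing_sq_le_frob u v) auto
    finally show ?thesis .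
  qed
  finally have le: "\<gamma> / 2 * prox.sqdist ?x ?z \<le> \<gamma> / 2 * (frob_norm (Y - Z))\<^sup>2"
    using gamma by (intro mult_left_mono) auto
  have "prox.obj (\<lambda>i. ystar $ i) wstar \<le> prox.obj ?x a"
    using r(2) sorted by (intro search.yt_ts_optimal feas) auto
  then show ?thesis using le by (simp add: prox.obj_def frob_Ystar)
qed

lemma solves_iff:
  "solves n m g f \<gamma> r Z Y a \<longleftrightarrow>
    Y \<in> carrier_mat n m \<and> rank_dual_norm n m g r Y \<le> a \<and> f a \<noteq> \<infinity> \<and>
    (\<forall>Y' b. Y' \<in> carrier_mat n m \<longrightarrow> rank_dual_norm n m g r Y' \<le> b \<longrightarrow> f b \<noteq> \<infinity> \<longrightarrow>
      F a + \<gamma> / 2 * (frob_norm (Y - Z))\<^sup>2 \<le> F b + \<gamma> / 2 * (frob_norm (Y' - Z))\<^sup>2)"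
proof -
  define val where "val Y a = f a + ereal (\<gamma> / 2 * (frob_norm (Y - Z))\<^sup>2)" for Y a
  define p where "p Y a = F a + \<gamma> / 2 * (frob_norm (Y - Z))\<^sup>2" for Y a
  define C where "C Y a \<longleftrightarrow> Y \<in> carrier_mat n m \<and> rank_dual_norm n m g r Y \<le> a \<and> f a \<noteq> \<infinity>" for Y a
  have "val Y a = ereal (p Y a)" if "C Y a" for Y a
  proof -
    have "f a = ereal (F a)" using that by (intro ereal_finite[OF f]) (simp add: C_def)
    then show ?thesis unfolding val_def p_def by (metis plus_ereal.simps(1))
  qed
  then have val_less: "val Y' b < val Y a \<longleftrightarrow> \<not> p Y a \<le> p Y' b" if "C Y a" "C Y' b" for Y a Y' b
    using that by auto
  have "solves n m g f \<gamma> r Z Y a \<longleftrightarrow> C Y a \<and> (\<forall>Y' b. C Y' b \<longrightarrow> \<not> val Y' b < val Y a)"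
    unfolding solves_def is_arg_min_def C_def val_def by auto
  also have "\<dots> \<longleftrightarrow> C Y a \<and> (\<forall>Y' b. C Y' b \<longrightarrow> p Y a \<le> p Y' b)" using val_less by blast
  finally show ?thesis unfolding C_def p_def by blast
qed

lemma Ystar_solves: "solves n m g f \<gamma> r Z Ystar wstar"
  unfolding solves_iff using Ystar_feasible wstar_feasible(1) objective_ge by simp

text \<open>The midpoint of two solutions is feasible, and the parallelogram identity makes it strictly better
  unless the matrices agree. If the two values of \<open>w\<close> differed, the multiplier at \<open>wstar\<close> would be
  0: either \<open>wstar\<close> is not on the boundary of the constraint, or \<open>f\<close> does not grow to its right. Then both
  values would be minimizers of \<open>f\<close>.\<close>

lemma solution_unique:
  assumes sol: "solves n m g f \<gamma> r Z Y a" and uniq: "\<And>a b. minimizer f a \<Longrightarrow> minimizer f b \<Longrightarrow> a = b"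
  shows "Y = Ystar \<and> a = wstar"
proof -
  let ?n = "\<lambda>A. (frob_norm A)\<^sup>2"
  have Y: "Y \<in> carrier_mat n m" and ra: "rank_dual_norm n m g r Y \<le> a" and fa: "f a \<noteq> \<infinity>"
    and le: "F a + \<gamma> / 2 * ?n (Y - Z) \<le> F wstar + \<gamma> / 2 * ?n (Ystar - Z)"
    using sol Ystar_feasible wstar_feasible(1) unfolding solves_iff by auto
  have Ys: "Ystar \<in> carrier_mat n m" by simp
  let ?M = "(1/2) \<cdot>\<^sub>m (Y + Ystar)" and ?b = "(1 - 1/2) * a + 1/2 * wstar"
  have M: "?M \<in> carrier_mat n m" using Y by simp
  have "rank_dual_norm n m g r ?M \<le> ?b"
    using rank_dual_norm_midpoint[OF r(2) u v Y Ys] ra Ystar_feasible by simp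
  moreover have "?b \<in> {v. f v \<noteq> \<infinity>}"
    using convexD[OF convex_on_imp_convex[OF proper_convex_on[OF f]], of a wstar "1/2" "1/2"]
      fa wstar_feasible(1) by simp
  ultimately have opt: "F wstar + \<gamma> / 2 * ?n (Ystar - Z) \<le> F ?b + \<gamma> / 2 * ?n (?M - Z)"
    using objective_ge[OF M] by simp
  have conv: "F ?b \<le> (1 - 1/2) * F a + 1/2 * F wstar"
    using convex_onD[OF proper_convex_on[OF f], of "1/2" a wstar] fa wstar_feasible(1) by simp
  have mid: "\<gamma> / 2 * ?n (?M - Z)
      = (\<gamma> / 2 * ?n (Y - Z)) / 2 + (\<gamma> / 2 * ?n (Ystar - Z)) / 2 - \<gamma> / 8 * ?n (Y - Ystar)"
    unfolding frob_norm_midpoint[OF Y Ys Z] by (simp add: field_simps)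
  have "d \<le> 0" if "fw + gs \<le> fb + gm" "fb \<le> (1 - 1/2) * fa + 1/2 * fw" "gm = gy / 2 + gs / 2 - d"
    "fa + gy \<le> fw + gs" for d fw gs fb gm fa gy :: real
    using that by simp
  from this[OF opt conv mid le] have "\<gamma> / 8 * ?n (Y - Ystar) \<le> 0" .
  then have "?n (Y - Ystar) \<le> 0" using gamma by (simp add: mult_le_0_iff)
  then have "?n (Y - Ystar) = 0" by simp
  then have zero: "(\<Sum>i<n. \<Sum>j<m. ((Y - Ystar) $$ (i, j))\<^sup>2) = 0"
    unfolding frob_norm_sq[OF minus_carrier_mat[OF Ys]] .
  have entry: "Y $$ (i, j) = Ystar $$ (i, j)" if "i < n" "j < m" for i j
  proof -
    have "\<forall>i\<in>{..<n}. (\<Sum>j<m. ((Y - Ystar) $$ (i, j))\<^sup>2) = 0"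
      using zero by (subst (asm) sum_nonneg_eq_0_iff) (auto intro: sum_nonneg)
    then have "(\<Sum>j<m. ((Y - Ystar) $$ (i, j))\<^sup>2) = 0" using that by simp
    then have "\<forall>j\<in>{..<m}. ((Y - Ystar) $$ (i, j))\<^sup>2 = 0"
      by (subst (asm) sum_nonneg_eq_0_iff) auto
    then have "(Y - Ystar) $$ (i, j) = 0" using that by simp
    then show ?thesis using that Y Ys by simp
  qed
  have YY: "Y = Ystar" using Y carrier_matD[OF Ys] entry by (intro eq_matI) auto
  then have F1: "F a \<le> F wstar" using le by simp
  have F2: "F wstar \<le> F a" using objective_ge[OF Y ra fa] YY by simp
  obtain \<mu> where k: "kkt ts (ss ts) (yt ts (ss ts)) wstar \<mu>" using kkt_ex[OF ts_in search.ss_le] by blast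
  define c where "c = G r (\<lambda>i. ystar $ i)"
  have c: "c = trunc_dual_gauge n g r (ss ts) ts (yt ts (ss ts))"
    unfolding c_def using ts_in search.ss_le by (intro G_extend_vec) auto
  have mu: "\<mu> \<in> subdiff f wstar" "0 \<le> \<mu>" "\<mu> * (wstar - c) = 0" using k unfolding kkt_def c by blast+
  have ca: "c \<le> a"
  proof -
    have "c = G r (\<lambda>i. pairing n m Ystar (\<lambda>a. u i $ a) (\<lambda>b. v i $ b))"
      unfolding c_def using pairing_sum_outer[OF u v, of _ ystar] r(2) by (intro G_cong) auto
    also have "\<dots> \<le> a" using G_le_rank_dual_norm[OF r(2) u v Ys] ra YY by simp
    finally show ?thesis .
  qed
  have "a = wstar"
  proof (rule ccontr)
    assume ne: "a \<noteq> wstar"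
    have mu0: "\<mu> = 0"
    proof (cases "a < wstar")
      case True then show ?thesis using ca mu by auto
    next
      case False
      have "F wstar + \<mu> * (a - wstar) \<le> F a" by (rule subdiff_real[OF f mu(1) fa])
      then have "\<mu> * (a - wstar) \<le> 0" using F1 by simp
      then show ?thesis using mu(2) False ne by (simp add: mult_le_0_iff)
    qed
    have wmin: "minimizer f wstar" using mu(1) mu0 by (simp add: minimizer_iff_zero_subdiff)
    have "f a = f wstar" using F1 F2 ereal_finite[OF f fa] ereal_finite[OF f wstar_feasible(1)] by simp
    then have "minimizer f a" using wmin by (simp add: minimizer_def is_arg_min_def)
    then show False using uniq[OF _ wmin] ne by simp
  qed
  then show ?thesis using YY by simp
qed

end

theorem theorem1:
  fixes n m r :: nat
    and Z :: "real mat"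
    and u v :: "nat \<Rightarrow> real vec"
    and \<gamma> :: real
    and g :: "real vec \<Rightarrow> real"
    and f :: "real \<Rightarrow> ereal"
    and zt yt y :: "nat \<Rightarrow> nat \<Rightarrow> real vec"
    and w :: "nat \<Rightarrow> nat \<Rightarrow> real"
    and ss :: "nat \<Rightarrow> nat"
    and ts :: nat
  assumes "n \<le> m"
    and "Z \<in> carrier_mat n m"
    and "is_svd n m Z u v"
    and "0 < \<gamma>"
    and "1 \<le> r" and "r \<le> n"
    and "sym_gauge n g"
    and "proper_closed_convex f"
    and zt: "zt = (\<lambda>t s. trunc_sv r s t (sing_vals Z))"
    and cases: "\<forall>t\<in>{1..r}. \<forall>s\<in>{0..n - r}.
          case_C1 n g f r s t (zt t s) (yt t s) (w t s) \<or>
          case_C2 n g f \<gamma> r s t (zt t s) (yt t s) (w t s) \<or>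
          case_C3 n g f \<gamma> r s t (zt t s) (yt t s) (w t s)"
    and y: "y = (\<lambda>t s. extend_vec n r s t (sing_vals Z) (yt t s))"
    and ss: "ss = s_star n r y"
    and ts: "ts = t_star n r y"
  shows "(solves n m g f \<gamma> r Z (sum_outer n m (y ts (ss ts)) u v) (w ts (ss ts))) \<and>
    ((\<forall>a b. minimizer f a \<longrightarrow> minimizer f b \<longrightarrow> a = b) \<longrightarrow>
          (\<forall>Y a. solves n m g f \<gamma> r Z Y a \<longrightarrow>
             Y = sum_outer n m (y ts (ss ts)) u v \<and> a = w ts (ss ts))) \<and>
    (\<forall>t. ts \<le> t \<and> t < r \<longrightarrow> y t (ss t) $ (r - t - 1) \<ge> y t (ss t) $ (r - t)) \<and>
    (\<forall>t. 1 \<le> t \<and> t < ts \<longrightarrow> y t (ss t) $ (r - t - 1) \<le> y t (ss t) $ (r - t)) \<and>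
    (\<forall>t. 1 \<le> t \<and> t < ts \<and> y t (ss t) $ (r - t - 1) = y t (ss t) $ (r - t) \<longrightarrow>
          y t (ss t) = y ts (ss ts) \<and>
          (w t (ss t) = w ts (ss ts) \<or>
           case_C1 n g f r (ss t) t (zt t (ss t)) (yt t (ss t)) (w t (ss t)) \<and>
           case_C1 n g f r (ss ts) ts (zt ts (ss ts)) (yt ts (ss ts)) (w ts (ss ts)))) \<and>
    (\<forall>t\<in>{1..r}. \<forall>s. ss t \<le> s \<and> s < n - r \<longrightarrow>
          y t s $ (r + s - 1) \<ge> y t s $ (r + s)) \<and>
    (\<forall>t\<in>{1..r}. \<forall>s. s < ss t \<longrightarrow> y t s $ (r + s - 1) \<le> y t s $ (r + s)) \<and>
    (\<forall>t\<in>{1..r}. \<forall>s. s < ss t \<and> y t s $ (r + s - 1) = y t s $ (r + s) \<longrightarrow>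
          y t s = y t (ss t) \<and>
          (w t s = w t (ss t) \<or>
           case_C1 n g f r s t (zt t s) (yt t s) (w t s) \<and>
           case_C1 n g f r (ss t) t (zt t (ss t)) (yt t (ss t)) (w t (ss t))))"
proof -
  interpret P: lowrank_prox n m r Z u v \<gamma> g f
    using assms by unfold_locales auto
  interpret L: lowrank_search n m r Z u v \<gamma> g f yt w
  proof unfold_locales
    fix t s assume t: "t \<in> {1..r}" "s \<le> n - r"
    then have t': "1 \<le> t" "t \<le> r" and s': "s \<in> {0..n - r}" by auto
    obtain \<mu> where "P.kkt t s (yt t s) (w t s) \<mu>"
      using P.kkt_of_cases[OF t' cases[unfolded zt, rule_format, OF t(1) s']] .
    then show "\<exists>\<mu>. P.kkt t s (yt t s) (w t s) \<mu>" ..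
  qed
  have y': "y = L.y" by (rule y)
  have ss': "ss = L.ss" unfolding ss y' ..
  have ts': "ts = L.ts" unfolding ts y' ..
  note ss_le = L.search.ss_le
  have I: "L.y t (L.ss t) $ (r - t - 1) \<ge> L.y t (L.ss t) $ (r - t)" if "L.ts \<le> t \<and> t < r" for t
    using L.search.t_gap_above that by blast
  have II: "L.y t (L.ss t) $ (r - t - 1) \<le> L.y t (L.ss t) $ (r - t)" if "1 \<le> t \<and> t < L.ts" for t
    using L.search.ts_min that by blast
  have III: "L.y t (L.ss t) = L.y L.ts (L.ss L.ts)"
    if "1 \<le> t \<and> t < L.ts \<and> L.y t (L.ss t) $ (r - t - 1) = L.y t (L.ss t) $ (r - t)" for t
    using L.search.t_tie that by (intro L.y_eqI) blast
  have IV: "L.y t s $ (r + s - 1) \<ge> L.y t s $ (r + s)"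
    if "t \<in> {1..r}" "L.ss t \<le> s \<and> s < n - r" for t s
  proof -
    have "r + s < n" using that(2) by auto
    then show ?thesis
      using L.search.s_gap_above[OF that(1), of s] L.search.Y_last[OF that(1), of s]
        L.search.Y_tail[OF that(1), of s "r + s"] that(2) by simp
  qed
  have V: "L.y t s $ (r + s - 1) \<le> L.y t s $ (r + s)" if "s < L.ss t" for t s
    using L.search.ss_min that by blast
  have VI: "L.y t s = L.y t (L.ss t)"
    if "t \<in> {1..r}" "s < L.ss t \<and> L.y t s $ (r + s - 1) = L.y t s $ (r + s)" for t s
  proof (rule L.y_eqI)
    fix i assume i: "i < n"
    have "s \<le> n - r" "r + s < n" using that(2) ss_le[of t] by auto
    then have "L.y t s $ (r - 1) = sing_vals Z $ (r + s)"
      using L.search.Y_last[OF that(1), of s] L.search.Y_tail[OF that(1), of s "r + s"] that(2) by simp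
    then show "L.y t s $ i = L.y t (L.ss t) $ i" using L.search.s_tie[OF that(1) _ _ i] that(2) by blast
  qed
  show ?thesis
    unfolding y' ss' ts' zt
  proof (intro conjI)
    show "solves n m g f \<gamma> r Z (sum_outer n m (L.y L.ts (L.ss L.ts)) u v) (w L.ts (L.ss L.ts))"
      by (rule L.Ystar_solves)
    show "(\<forall>a b. minimizer f a \<longrightarrow> minimizer f b \<longrightarrow> a = b) \<longrightarrow>
          (\<forall>Y a. solves n m g f \<gamma> r Z Y a \<longrightarrow>
             Y = sum_outer n m (L.y L.ts (L.ss L.ts)) u v \<and> a = w L.ts (L.ss L.ts))"
      using L.solution_unique by blast
  next
    show "\<forall>t. 1 \<le> t \<and> t < L.ts \<and> L.y t (L.ss t) $ (r - t - 1) = L.y t (L.ss t) $ (r - t) \<longrightarrow>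
          L.y t (L.ss t) = L.y L.ts (L.ss L.ts) \<and>
          (w t (L.ss t) = w L.ts (L.ss L.ts) \<or>
           case_C1 n g f r (L.ss t) t (trunc_sv r (L.ss t) t (sing_vals Z)) (yt t (L.ss t)) (w t (L.ss t)) \<and>
           case_C1 n g f r (L.ss L.ts) L.ts (trunc_sv r (L.ss L.ts) L.ts (sing_vals Z)) (yt L.ts (L.ss L.ts))
             (w L.ts (L.ss L.ts)))"
    proof (intro allI impI conjI)
      fix t assume t: "1 \<le> t \<and> t < L.ts \<and> L.y t (L.ss t) $ (r - t - 1) = L.y t (L.ss t) $ (r - t)"
      show "L.y t (L.ss t) = L.y L.ts (L.ss L.ts)" by (rule III[OF t])
      have "t \<in> {1..r}" using t L.search.ts_range by auto
      from L.equal_w_or_C1[OF this ss_le L.ts_in ss_le III[OF t]]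
      show "w t (L.ss t) = w L.ts (L.ss L.ts) \<or>
           case_C1 n g f r (L.ss t) t (trunc_sv r (L.ss t) t (sing_vals Z)) (yt t (L.ss t)) (w t (L.ss t)) \<and>
           case_C1 n g f r (L.ss L.ts) L.ts (trunc_sv r (L.ss L.ts) L.ts (sing_vals Z)) (yt L.ts (L.ss L.ts))
             (w L.ts (L.ss L.ts))" .
    qed
  next
    show "\<forall>t\<in>{1..r}. \<forall>s. s < L.ss t \<and> L.y t s $ (r + s - 1) = L.y t s $ (r + s) \<longrightarrow>
          L.y t s = L.y t (L.ss t) \<and>
          (w t s = w t (L.ss t) \<or>
           case_C1 n g f r s t (trunc_sv r s t (sing_vals Z)) (yt t s) (w t s) \<and>
           case_C1 n g f r (L.ss t) t (trunc_sv r (L.ss t) t (sing_vals Z)) (yt t (L.ss t)) (w t (L.ss t)))"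
    proof (intro ballI allI impI conjI)
      fix t s assume t: "t \<in> {1..r}" and s: "s < L.ss t \<and> L.y t s $ (r + s - 1) = L.y t s $ (r + s)"
      show "L.y t s = L.y t (L.ss t)" by (rule VI[OF t s])
      have "s \<le> n - r" using s ss_le[of t] by simp
      from L.equal_w_or_C1[OF t this t ss_le VI[OF t s]]
      show "w t s = w t (L.ss t) \<or>
           case_C1 n g f r s t (trunc_sv r s t (sing_vals Z)) (yt t s) (w t s) \<and>
           case_C1 n g f r (L.ss t) t (trunc_sv r (L.ss t) t (sing_vals Z)) (yt t (L.ss t)) (w t (L.ss t))" .
    qed
  qed (use I II IV V in blast)+
qed

end
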